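(* A cubical transition system $X$ is fibrant in $\mathbf L_{\underline{\mathrm{Cub}}}\mathbf{CTS}$ if and only if it is combinatorially fibrant, i.e. for any $n\ge1$, any states $\alpha,\beta$ of $X$ and any actions $u_1,v_1,\dots,u_n,v_n$ of $X$ such that $\mu(u_i)=\mu(v_i)$ for $1\le i\le n$, if the tuple $(\alpha,u_1,\dots,u_n,\beta)$ is a transition of $X$, then the tuple $(\alpha,v_1,\dots,v_n,\beta)$ is a transition of $X$ as well.
   Context: Fix a nonempty set $\Sigma$ of labels. A weak transition system is a triple $X=(S,\mu:L\to\Sigma,T=\bigcup_{n\ge1}T_n)$ where $S$ is a set (states), $L$ a set (actions), $\mu$ a map (labelling map), $T_n\subset S\times L^n\times S$ ($n$-transitions), such that: (Multiset axiom) if $(\alpha,u_1,\dots,u_n,\beta)$ is a transition with $n\ge2$, so is $(\alpha,u_{\sigma(1)},\dots,u_{\sigma(n)},\beta)$ for every permutation $\sigma$; (Composition axiom) for $n\ge3$ and $p,q\ge1$ with $p+q<n$, if $(\alpha,u_1,\dots,u_n,\beta)$, $(\alpha,u_1,\dots,u_p,\nu_1)$, $(\nu_1,u_{p+1},\dots,u_n,\beta)$, $(\alpha,u_1,\dots,u_{p+q},\nu_2)$, $(\nu_2,u_{p+q+1},\dots,u_n,\beta)$ are transitions, then so is $(\nu_1,u_{p+1},\dots,u_{p+q},\nu_2)$. A map consists of a map on states and a map on actions commuting with the labelling maps to $\Sigma$, sending transitions to transitions. $X$ is cubical if every action $u$ occurs in some $1$-transition $(\alpha,u,\beta)$ and the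 Intermediate state axiom holds: for every transition $(\alpha,u_1,\dots,u_n,\beta)$ with $n\ge2$ and every $1\le p<n$ there is a (not necessarily unique) state $\nu$ with $(\alpha,u_1,\dots,u_p,\nu)$ and $(\nu,u_{p+1},\dots,u_n,\beta)$ transitions. $\mathbf{CTS}$ is the category of cubical transition systems. A set is viewed as a transition system with that set of states and no actions. For $x_1,\dots,x_n\in\Sigma$, the $n$-cube $C_n[x_1,\dots,x_n]$ has states $\{0,1\}^n$, actions $(x_1,1),\dots,(x_n,n)$ with $\mu(x_i,i)=x_i$, and transitions $((\epsilon_i),(x_{i_1},i_1),\dots,(x_{i_d},i_d),(\epsilon'_i))$, $d\geq1$, with $i_1,\dots,i_d$ distinct, $\epsilon_i\le\epsilon'_i$ for all $i$, and $\epsilon_i\ne\epsilon_i'$ iff $i\in\{i_1,\dots,i_d\}$. For $n\ge1$, the boundary $\partial C_n[x_1,\dots,x_n]$ is obtained by removing from the $n$-cube all its $n$-transitions (for $n=1$ it is the two-state set $\{0,1\}$, with no action). The double transition $\uparrow\! x\!\uparrow$ ($x\in\Sigma$) has states $1,2,3,4$, one action $x$ labelled $x$, and transitions $(1,x,2),(3,x,4)$. Let $\mathcal I=\{\varnothing\to\{0\},\ \{0,1\}\to\{0\}\}\cup\{\partial C_n[x_1,\dots,x_n]\to C_n[x_1,\dots,x_n]\mid n\ge1,\ x_i\in\Sigma\}\cup\{C_1[x]\to\ \uparrow\! x\!\uparrow\ \mid x\in\Sigma\}$. For $x\in\Sigma$, $p_x:C_1[x]\sqcup C_1[x]\to\ \uparrow\!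 x\!\uparrow$ is the map bijective on states sending the $1$-transitions of the two copies of $C_1[x]$ to $(1,x,2)$ and $(3,x,4)$ respectively. $\mathcal S=\{p_x\mid x\in\Sigma\}$. The left determined model structure on $\mathbf{CTS}$ is the (existing, combinatorial, left proper) model structure with generating cofibrations $\mathcal I$ (its cofibrations are the maps one-to-one on actions) whose weak equivalences form the smallest Grothendieck localizer, where, $\mathcal C$ being the class of cofibrations, a Grothendieck localizer is a class of maps satisfying two-out-of-three, containing all maps with the right lifting property with respect to $\mathcal C$, and whose intersection with $\mathcal C$ is closed under pushouts and transfinite compositions. $\mathbf L_{\underline{\mathrm{Cub}}}\mathbf{CTS}$ is its left Bousfield localization with respect to the cubification functor $\underline{\mathrm{Cub}}$ (i.e. with respect to the class of maps $f$ such that $\underline{\mathrm{Cub}}(f)$ is a weak equivalence, where $\underline{\mathrm{Cub}}(X)$ is the canonical colimit of all cubes $C_n[x_1,\dots,x_n]$, $n\ge 0$, mapping to $X$); it coincides with the left Bousfield localization with respect to $\mathcal S$. *)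

theory Defs
  imports
    "HOL-Library.FuncSet"
    "HOL-Combinatorics.Permutations"
begin

unbundle cardinal_syntax

section \<open>Categories, lifting properties and colimits\<close>

record ('o, 'm) cat =
  Obj :: "'o set"
  Arr :: "'m set"
  Dom :: "'m \<Rightarrow> 'o"
  Cod :: "'m \<Rightarrow> 'o"
  Comp :: "'m \<Rightarrow> 'm \<Rightarrow> 'm"
  Ident :: "'o \<Rightarrow> 'm"

text \<open>Composition is written in applicative order: \<open>Comp C g f\<close> is \<open>g\<close> after \<open>f\<close>.\<close>

definition in_hom :: "('o, 'm) cat \<Rightarrow> 'm \<Rightarrow> 'o \<Rightarrow> 'o \<Rightarrow> bool" where
  "in_hom C f X Y \<longleftrightarrow> f \<in> Arr C \<and> Dom C f = X \<and> Cod C f = Y"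

definition commuting_square :: "('o, 'm) cat \<Rightarrow> 'm \<Rightarrow> 'm \<Rightarrow> 'm \<Rightarrow> 'm \<Rightarrow> bool" where
  "commuting_square C i p a b \<longleftrightarrow>
     i \<in> Arr C \<and> p \<in> Arr C \<and>
     in_hom C a (Dom C i) (Dom C p) \<and> in_hom C b (Cod C i) (Cod C p) \<and>
     Comp C p a = Comp C b i"

definition lifts :: "('o, 'm) cat \<Rightarrow> 'm \<Rightarrow> 'm \<Rightarrow> bool" where
  "lifts C i p \<longleftrightarrow>
     (\<forall>a b. commuting_square C i p a b \<longrightarrow>
        (\<exists>h. in_hom C h (Cod C i) (Dom C p) \<and> Comp C h i = a \<and> Comp C p h = b))"

definition llp :: "('o, 'm) cat \<Rightarrow> 'm set \<Rightarrow> 'm set" where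
  "llp C R = {i \<in> Arr C. \<forall>p\<in>R. lifts C i p}"

definition rlp :: "('o, 'm) cat \<Rightarrow> 'm set \<Rightarrow> 'm set" where
  "rlp C L = {p \<in> Arr C. \<forall>i\<in>L. lifts C i p}"

definition retract_of :: "('o, 'm) cat \<Rightarrow> 'm \<Rightarrow> 'm \<Rightarrow> bool" where
  "retract_of C f g \<longleftrightarrow>
     f \<in> Arr C \<and> g \<in> Arr C \<and>
     (\<exists>i r j s.
        in_hom C i (Dom C f) (Dom C g) \<and> in_hom C r (Dom C g) (Dom C f) \<and>
        in_hom C j (Cod C f) (Cod C g) \<and> in_hom C s (Cod C g) (Cod C f) \<and>
        Comp C r i = Ident C (Dom C f) \<and> Comp C s j = Ident C (Cod C f) \<and>
        Comp C g i = Comp C j f \<and> Comp C f r = Comp C s g)"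

definition terminal :: "('o, 'm) cat \<Rightarrow> 'o \<Rightarrow> bool" where
  "terminal C T \<longleftrightarrow> T \<in> Obj C \<and> (\<forall>X\<in>Obj C. \<exists>!f. in_hom C f X T)"

text \<open>A diagram is given by its set \<open>J\<close> of vertices, the objects \<open>D j\<close>, and a set \<open>E\<close> of
  triples \<open>(j, m, j')\<close> with \<open>m\<close> an arrow from \<open>D j\<close> to \<open>D j'\<close>. Cocones under a functor only
  depend on this data.\<close>

definition cocone ::
  "('o, 'm) cat \<Rightarrow> 'j set \<Rightarrow> ('j \<Rightarrow> 'o) \<Rightarrow> ('j \<times> 'm \<times> 'j) set \<Rightarrow> 'o \<Rightarrow> ('j \<Rightarrow> 'm) \<Rightarrow> bool" where
  "cocone C J D E Q l \<longleftrightarrow>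
     Q \<in> Obj C \<and> (\<forall>j\<in>J. in_hom C (l j) (D j) Q) \<and>
     (\<forall>(j, m, j')\<in>E. Comp C (l j') m = l j)"

definition is_colimit ::
  "('o, 'm) cat \<Rightarrow> 'j set \<Rightarrow> ('j \<Rightarrow> 'o) \<Rightarrow> ('j \<times> 'm \<times> 'j) set \<Rightarrow> 'o \<Rightarrow> ('j \<Rightarrow> 'm) \<Rightarrow> bool" where
  "is_colimit C J D E Q l \<longleftrightarrow>
     cocone C J D E Q l \<and>
     (\<forall>Q' l'. cocone C J D E Q' l' \<longrightarrow>
        (\<exists>!h. in_hom C h Q Q' \<and> (\<forall>j\<in>J. Comp C h (l j) = l' j)))"

text \<open>In \<open>is_pushout C f g f' g'\<close>, the arrow \<open>f'\<close> is the pushout of \<open>f\<close> along \<open>g\<close>, and \<open>g'\<close>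
  is the arrow from the target of \<open>f\<close>.\<close>

definition is_pushout :: "('o, 'm) cat \<Rightarrow> 'm \<Rightarrow> 'm \<Rightarrow> 'm \<Rightarrow> 'm \<Rightarrow> bool" where
  "is_pushout C f g f' g' \<longleftrightarrow>
     f \<in> Arr C \<and> in_hom C g (Dom C f) (Cod C g) \<and>
     in_hom C f' (Cod C g) (Cod C f') \<and> in_hom C g' (Cod C f) (Cod C f') \<and>
     Comp C f' g = Comp C g' f \<and>
     (\<forall>Z a b. in_hom C a (Cod C g) Z \<and> in_hom C b (Cod C f) Z \<and> Comp C a g = Comp C b f \<longrightarrow>
        (\<exists>!h. in_hom C h (Cod C f') Z \<and> Comp C h f' = a \<and> Comp C h g' = b))"


section \<open>Transfinite compositions\<close>

text \<open>Ordinals are represented by well-orders \<open>r\<close> (reflexive on their field).\<close>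

definition covers :: "'i rel \<Rightarrow> 'i \<Rightarrow> 'i \<Rightarrow> bool" where
  "covers r i j \<longleftrightarrow> (i, j) \<in> r \<and> i \<noteq> j \<and> (\<forall>k. (i, k) \<in> r \<and> (k, j) \<in> r \<longrightarrow> k = i \<or> k = j)"

definition least_index :: "'i rel \<Rightarrow> 'i \<Rightarrow> bool" where
  "least_index r i \<longleftrightarrow> i \<in> Field r \<and> (\<forall>j\<in>Field r. (i, j) \<in> r)"

definition limit_index :: "'i rel \<Rightarrow> 'i \<Rightarrow> bool" where
  "limit_index r j \<longleftrightarrow> j \<in> Field r \<and> \<not> least_index r j \<and> \<not> (\<exists>i. covers r i j)"

definition below :: "'i rel \<Rightarrow> 'i \<Rightarrow> 'i set" where
  "below r j = {i. (i, j) \<in> r \<and> i \<noteq> j}"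

definition edges :: "'i rel \<Rightarrow> 'i set \<Rightarrow> ('i \<Rightarrow> 'i \<Rightarrow> 'm) \<Rightarrow> ('i \<times> 'm \<times> 'i) set" where
  "edges r A \<phi> = {(i, \<phi> i j, j) | i j. i \<in> A \<and> j \<in> A \<and> (i, j) \<in> r}"

text \<open>A colimit-preserving functor from the well-order \<open>r\<close> to \<open>C\<close>.\<close>

definition transfinite_sequence ::
  "('o, 'm) cat \<Rightarrow> 'i rel \<Rightarrow> ('i \<Rightarrow> 'o) \<Rightarrow> ('i \<Rightarrow> 'i \<Rightarrow> 'm) \<Rightarrow> bool" where
  "transfinite_sequence C r D \<phi> \<longleftrightarrow>
     (\<forall>i\<in>Field r. D i \<in> Obj C \<and> \<phi> i i = Ident C (D i)) \<and>
     (\<forall>(i, j)\<in>r. in_hom C (\<phi> i j) (D i) (D j)) \<and>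
     (\<forall>i j k. (i, j) \<in> r \<and> (j, k) \<in> r \<longrightarrow> Comp C (\<phi> j k) (\<phi> i j) = \<phi> i k) \<and>
     (\<forall>j. limit_index r j \<longrightarrow>
        is_colimit C (below r j) D (edges r (below r j) \<phi>) (D j) (\<lambda>i. \<phi> i j))"

text \<open>The parameter \<open>Ords\<close> is the class of well-orders allowed as lengths; it is instantiated
  below with all small ones.\<close>

definition closed_under_transfinite_composition ::
  "('o, 'm) cat \<Rightarrow> 'i rel set \<Rightarrow> 'm set \<Rightarrow> bool" where
  "closed_under_transfinite_composition C Ords W \<longleftrightarrow>
     (\<forall>r\<in>Ords. \<forall>D \<phi> Q l i0.
        transfinite_sequence C r D \<phi> \<and>
        (\<forall>i j. covers r i j \<longrightarrow> \<phi> i j \<in> W) \<and>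
        is_colimit C (Field r) D (edges r (Field r) \<phi>) Q l \<and>
        least_index r i0 \<longrightarrow> l i0 \<in> W)"

definition closed_under_pushout :: "('o, 'm) cat \<Rightarrow> 'm set \<Rightarrow> bool" where
  "closed_under_pushout C W \<longleftrightarrow> (\<forall>f g f' g'. f \<in> W \<and> is_pushout C f g f' g' \<longrightarrow> f' \<in> W)"


section \<open>Model structures and left Bousfield localization\<close>

definition two_out_of_three :: "('o, 'm) cat \<Rightarrow> 'm set \<Rightarrow> bool" where
  "two_out_of_three C W \<longleftrightarrow>
     (\<forall>f g. f \<in> Arr C \<and> g \<in> Arr C \<and> Cod C f = Dom C g \<longrightarrow>
        (f \<in> W \<and> g \<in> W \<longrightarrow> Comp C g f \<in> W) \<and>
        (f \<in> W \<and> Comp C g f \<in> W \<longrightarrow> g \<in> W) \<and>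
        (g \<in> W \<and> Comp C g f \<in> W \<longrightarrow> f \<in> W))"

definition closed_under_retract :: "('o, 'm) cat \<Rightarrow> 'm set \<Rightarrow> bool" where
  "closed_under_retract C W \<longleftrightarrow> (\<forall>f g. g \<in> W \<and> retract_of C f g \<longrightarrow> f \<in> W)"

definition factors_through :: "('o, 'm) cat \<Rightarrow> 'm set \<Rightarrow> 'm set \<Rightarrow> bool" where
  "factors_through C L R \<longleftrightarrow>
     (\<forall>f\<in>Arr C. \<exists>i\<in>L. \<exists>p\<in>R. Cod C i = Dom C p \<and> Comp C p i = f)"

record 'm model =
  cofs :: "'m set"
  weqs :: "'m set"
  fibs :: "'m set"

definition model_structure :: "('o, 'm) cat \<Rightarrow> 'm model \<Rightarrow> bool" where
  "model_structure C M \<longleftrightarrow>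
     cofs M \<subseteq> Arr C \<and> weqs M \<subseteq> Arr C \<and> fibs M \<subseteq> Arr C \<and>
     two_out_of_three C (weqs M) \<and>
     closed_under_retract C (cofs M) \<and>
     closed_under_retract C (weqs M) \<and>
     closed_under_retract C (fibs M) \<and>
     (\<forall>i\<in>cofs M \<inter> weqs M. \<forall>p\<in>fibs M. lifts C i p) \<and>
     (\<forall>i\<in>cofs M. \<forall>p\<in>fibs M \<inter> weqs M. lifts C i p) \<and>
     factors_through C (cofs M \<inter> weqs M) (fibs M) \<and>
     factors_through C (cofs M) (fibs M \<inter> weqs M)"

text \<open>In a model structure the fibrations are determined by the other two classes.\<close>

definition model_of :: "('o, 'm) cat \<Rightarrow> 'm set \<Rightarrow> 'm set \<Rightarrow> 'm model" where
  "model_of C Cof W = \<lparr>cofs = Cof, weqs = W, fibs = rlp C (Cof \<inter> W)\<rparr>"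

definition fibrant :: "('o, 'm) cat \<Rightarrow> 'm model \<Rightarrow> 'o \<Rightarrow> bool" where
  "fibrant C M X \<longleftrightarrow> X \<in> Obj C \<and> (\<exists>T f. terminal C T \<and> in_hom C f X T \<and> f \<in> fibs M)"

definition grothendieck_localizer ::
  "('o, 'm) cat \<Rightarrow> 'i rel set \<Rightarrow> 'm set \<Rightarrow> 'm set \<Rightarrow> bool" where
  "grothendieck_localizer C Ords Cof W \<longleftrightarrow>
     W \<subseteq> Arr C \<and>
     two_out_of_three C W \<and>
     rlp C Cof \<subseteq> W \<and>
     closed_under_pushout C (W \<inter> Cof) \<and>
     closed_under_transfinite_composition C Ords (W \<inter> Cof)"

definition smallest_localizer :: "('o, 'm) cat \<Rightarrow> 'i rel set \<Rightarrow> 'm set \<Rightarrow> 'm set" where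
  "smallest_localizer C Ords Cof = \<Inter> {W. grothendieck_localizer C Ords Cof W}"

definition left_determined_model :: "('o, 'm) cat \<Rightarrow> 'i rel set \<Rightarrow> 'm set \<Rightarrow> 'm model" where
  "left_determined_model C Ords I =
     model_of C (llp C (rlp C I)) (smallest_localizer C Ords (llp C (rlp C I)))"

text \<open>The left Bousfield localization of \<open>M\<close> with respect to \<open>K\<close> is defined by its universal
  property: it has the cofibrations of \<open>M\<close>, and among the model structures with these
  cofibrations in which the weak equivalences of \<open>M\<close> and the arrows of \<open>K\<close> are weak
  equivalences it has the fewest weak equivalences.\<close>

definition left_bousfield_localization :: "('o, 'm) cat \<Rightarrow> 'm model \<Rightarrow> 'm set \<Rightarrow> 'm model" where
  "left_bousfield_localization C M K =
     model_of C (cofs M)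
       (\<Inter> {W. model_structure C (model_of C (cofs M) W) \<and> weqs M \<union> K \<subseteq> W})"


section \<open>Cubical transition systems\<close>

text \<open>The set of labels is the type \<open>'x\<close>. An \<open>n\<close>-transition is a triple \<open>(\<alpha>, us, \<beta>)\<close> with
  \<open>length us = n\<close>. The labelling map is only meaningful on the set of actions.\<close>

record ('s, 'l, 'x) ts =
  states :: "'s set"
  actions :: "'l set"
  lab :: "'l \<Rightarrow> 'x"
  transitions :: "('s \<times> 'l list \<times> 's) set"

definition weak_ts :: "('s, 'l, 'x) ts \<Rightarrow> bool" where
  "weak_ts X \<longleftrightarrow>
     (\<forall>(\<alpha>, us, \<beta>)\<in>transitions X.
        \<alpha> \<in> states X \<and> \<beta> \<in> states X \<and> us \<noteq> [] \<and> set us \<subseteq> actions X) \<and>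
     (\<forall>\<alpha> us \<beta> \<sigma>.
        (\<alpha>, us, \<beta>) \<in> transitions X \<and> length us \<ge> 2 \<and> \<sigma> permutes {..<length us} \<longrightarrow>
        (\<alpha>, permute_list \<sigma> us, \<beta>) \<in> transitions X) \<and>
     (\<forall>\<alpha> \<beta> \<nu>1 \<nu>2 us vs ws.
        us \<noteq> [] \<and> vs \<noteq> [] \<and> ws \<noteq> [] \<and>
        (\<alpha>, us @ vs @ ws, \<beta>) \<in> transitions X \<and>
        (\<alpha>, us, \<nu>1) \<in> transitions X \<and> (\<nu>1, vs @ ws, \<beta>) \<in> transitions X \<and>
        (\<alpha>, us @ vs, \<nu>2) \<in> transitions X \<and> (\<nu>2, ws, \<beta>) \<in> transitions X \<longrightarrow>
        (\<nu>1, vs, \<nu>2) \<in> transitions X)"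

definition cubical_ts :: "('s, 'l, 'x) ts \<Rightarrow> bool" where
  "cubical_ts X \<longleftrightarrow>
     weak_ts X \<and>
     (\<forall>u\<in>actions X. \<exists>\<alpha> \<beta>. (\<alpha>, [u], \<beta>) \<in> transitions X) \<and>
     (\<forall>\<alpha> us \<beta> p.
        (\<alpha>, us, \<beta>) \<in> transitions X \<and> length us \<ge> 2 \<and> 1 \<le> p \<and> p < length us \<longrightarrow>
        (\<exists>\<nu>\<in>states X.
           (\<alpha>, take p us, \<nu>) \<in> transitions X \<and> (\<nu>, drop p us, \<beta>) \<in> transitions X))"

definition ts_map ::
  "('s, 'l, 'x) ts \<Rightarrow> ('t, 'k, 'x) ts \<Rightarrow> ('s \<Rightarrow> 't) \<Rightarrow> ('l \<Rightarrow> 'k) \<Rightarrow> bool" where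
  "ts_map X Y f g \<longleftrightarrow>
     f \<in> states X \<rightarrow> states Y \<and> g \<in> actions X \<rightarrow> actions Y \<and>
     (\<forall>u\<in>actions X. lab Y (g u) = lab X u) \<and>
     (\<forall>(\<alpha>, us, \<beta>)\<in>transitions X. (f \<alpha>, map g us, f \<beta>) \<in> transitions Y)"

definition ts_iso ::
  "('s, 'l, 'x) ts \<Rightarrow> ('t, 'k, 'x) ts \<Rightarrow> ('s \<Rightarrow> 't) \<Rightarrow> ('l \<Rightarrow> 'k) \<Rightarrow> bool" where
  "ts_iso X Y f g \<longleftrightarrow>
     ts_map X Y f g \<and>
     (\<exists>f' g'. ts_map Y X f' g' \<and>
        (\<forall>s\<in>states X. f' (f s) = s) \<and> (\<forall>u\<in>actions X. g' (g u) = u) \<and>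
        (\<forall>t\<in>states Y. f (f' t) = t) \<and> (\<forall>v\<in>actions Y. g (g' v) = v))"


section \<open>The category of cubical transition systems\<close>

text \<open>A type \<open>'u\<close> plays the role of a universe: a small set is one of cardinality strictly less
  than that of \<open>'u\<close>. When the cardinality of \<open>'u\<close> is inaccessible these are, up to bijection,
  the members of a Grothendieck universe.\<close>

definition small :: "'u set \<Rightarrow> bool" where
  "small A \<longleftrightarrow> |A| <o |UNIV :: 'u set|"

definition small_ordinals :: "'u rel set" where
  "small_ordinals = {r. Well_order r \<and> Field r \<noteq> {} \<and> small (Field r)}"

record ('u, 'x) ts_arrow =
  src :: "('u, 'u, 'x) ts"
  tgt :: "('u, 'u, 'x) ts"
  st :: "'u \<Rightarrow> 'u"
  act :: "'u \<Rightarrow> 'u"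

definition cts_objects :: "('u, 'u, 'x) ts set" where
  "cts_objects = {X. cubical_ts X \<and> small (states X) \<and> small (actions X)}"

text \<open>The two components of an arrow are undefined outside the states and actions of the
  source, so that equality of arrows is equality of maps.\<close>

definition CTS :: "(('u, 'u, 'x) ts, ('u, 'x) ts_arrow) cat" where
  "CTS =
     \<lparr>Obj = cts_objects,
      Arr = {f. src f \<in> cts_objects \<and> tgt f \<in> cts_objects \<and>
                ts_map (src f) (tgt f) (st f) (act f) \<and>
                st f \<in> extensional (states (src f)) \<and> act f \<in> extensional (actions (src f))},
      Dom = src,
      Cod = tgt,
      Comp = (\<lambda>g f. \<lparr>src = src f, tgt = tgt g,
                     st = compose (states (src f)) (st g) (st f),
                     act = compose (actions (src f)) (act g) (act f)\<rparr>),
      Ident = (\<lambda>X. \<lparr>src = X, tgt = X,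
                    st = restrict id (states X), act = restrict id (actions X)\<rparr>)\<rparr>"


section \<open>Cubes, boundaries and double transitions\<close>

definition discrete_ts :: "'s set \<Rightarrow> ('s, 'l, 'x) ts" where
  "discrete_ts S = \<lparr>states = S, actions = {}, lab = undefined, transitions = {}\<rparr>"

text \<open>The coordinates of the cube \<open>C\<^sub>n[x\<^sub>1, \<dots>, x\<^sub>n]\<close> are numbered from \<open>0\<close>. States are boolean
  lists, with \<open>False\<close> for \<open>0\<close> and \<open>True\<close> for \<open>1\<close>.\<close>

definition cube :: "'x list \<Rightarrow> (bool list, 'x \<times> nat, 'x) ts" where
  "cube xs =
     \<lparr>states = {\<epsilon>. length \<epsilon> = length xs},
      actions = {(xs ! i, i) | i. i < length xs},
      lab = fst,
      transitions =
        {(\<epsilon>, map (\<lambda>i. (xs ! i, i)) is, \<epsilon>') | \<epsilon> is \<epsilon>'.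
           length \<epsilon> = length xs \<and> length \<epsilon>' = length xs \<and>
           is \<noteq> [] \<and> distinct is \<and> set is \<subseteq> {..<length xs} \<and>
           (\<forall>i<length xs. \<epsilon> ! i \<le> \<epsilon>' ! i) \<and>
           (\<forall>i<length xs. \<epsilon> ! i \<noteq> \<epsilon>' ! i \<longleftrightarrow> i \<in> set is)}\<rparr>"

text \<open>For \<open>n = 1\<close> the action disappears together with the \<open>1\<close>-transition, as every action of a
  cubical transition system is used.\<close>

definition boundary :: "'x list \<Rightarrow> (bool list, 'x \<times> nat, 'x) ts" where
  "boundary xs =
     \<lparr>states = states (cube xs),
      actions = (if length xs = 1 then {} else actions (cube xs)),
      lab = lab (cube xs),
      transitions = {(\<alpha>, us, \<beta>) \<in> transitions (cube xs). length us \<noteq> length xs}\<rparr>"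

definition double_transition :: "'x \<Rightarrow> (nat, 'x, 'x) ts" where
  "double_transition x =
     \<lparr>states = {1, 2, 3, 4}, actions = {x}, lab = id,
      transitions = {(1, [x], 2), (3, [x], 4)}\<rparr>"

text \<open>The arrow \<open>h\<close> of \<open>CTS\<close> is a copy, inside the universe, of the map \<open>(f, g)\<close>.\<close>

definition copy_of_map ::
  "('s, 'l, 'x) ts \<Rightarrow> ('t, 'k, 'x) ts \<Rightarrow> ('s \<Rightarrow> 't) \<Rightarrow> ('l \<Rightarrow> 'k) \<Rightarrow> ('u, 'x) ts_arrow \<Rightarrow> bool" where
  "copy_of_map P Q f g h \<longleftrightarrow>
     h \<in> Arr CTS \<and>
     (\<exists>a a' b b'.
        ts_iso P (src h) a a' \<and> ts_iso Q (tgt h) b b' \<and>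
        (\<forall>s\<in>states P. st h (a s) = b (f s)) \<and>
        (\<forall>u\<in>actions P. act h (a' u) = b' (g u)))"

definition generating_cofibrations :: "('u, 'x) ts_arrow set" where
  "generating_cofibrations =
     {h. copy_of_map
           (discrete_ts {} :: (nat, nat, 'x) ts) (discrete_ts {0} :: (nat, nat, 'x) ts) id id h}
     \<union> {h. copy_of_map
           (discrete_ts {0, 1} :: (nat, nat, 'x) ts) (discrete_ts {0} :: (nat, nat, 'x) ts)
           (\<lambda>_. 0) id h}
     \<union> {h. \<exists>xs. length xs \<ge> 1 \<and> copy_of_map (boundary xs) (cube xs) id id h}
     \<union> {h. \<exists>x. copy_of_map (cube [x]) (double_transition x)
              (\<lambda>\<epsilon>. if \<epsilon> = [True] then 2 else 1) fst h}"


section \<open>Cubification and the localized model structure\<close>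

definition is_cube :: "('s, 'l, 'x) ts \<Rightarrow> bool" where
  "is_cube X \<longleftrightarrow> (\<exists>xs f g. ts_iso (cube xs) X f g)"

definition cubes_over :: "('u, 'u, 'x) ts \<Rightarrow> ('u, 'x) ts_arrow set" where
  "cubes_over X = {c \<in> Arr CTS. is_cube (src c) \<and> tgt c = X}"

definition cubes_over_edges ::
  "('u, 'u, 'x) ts \<Rightarrow> (('u, 'x) ts_arrow \<times> ('u, 'x) ts_arrow \<times> ('u, 'x) ts_arrow) set" where
  "cubes_over_edges X =
     {(c, h, c'). c \<in> cubes_over X \<and> c' \<in> cubes_over X \<and>
        in_hom CTS h (src c) (src c') \<and> Comp CTS c' h = c}"

text \<open>\<open>Q\<close> with legs \<open>l\<close> is the canonical colimit of the cubes mapping to \<open>X\<close>.\<close>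

definition is_cubification ::
  "('u, 'u, 'x) ts \<Rightarrow> ('u, 'u, 'x) ts \<Rightarrow> (('u, 'x) ts_arrow \<Rightarrow> ('u, 'x) ts_arrow) \<Rightarrow> bool" where
  "is_cubification X Q l \<longleftrightarrow> is_colimit CTS (cubes_over X) src (cubes_over_edges X) Q l"

text \<open>The arrow \<open>g\<close> is the image of \<open>f\<close> under the cubification functor, for some choice of the
  colimits defining its values on the source and target of \<open>f\<close>.\<close>

definition cubification_map :: "('u, 'x) ts_arrow \<Rightarrow> ('u, 'x) ts_arrow \<Rightarrow> bool" where
  "cubification_map f g \<longleftrightarrow>
     f \<in> Arr CTS \<and>
     (\<exists>l l'. is_cubification (src f) (src g) l \<and> is_cubification (tgt f) (tgt g) l' \<and>
        g \<in> Arr CTS \<and>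
        (\<forall>c\<in>cubes_over (src f). Comp CTS g (l c) = l' (Comp CTS f c)))"

definition left_determined_CTS :: "('u, 'x) ts_arrow model" where
  "left_determined_CTS =
     left_determined_model CTS (small_ordinals :: 'u rel set) generating_cofibrations"

definition LCub_CTS :: "('u, 'x) ts_arrow model" where
  "LCub_CTS =
     left_bousfield_localization CTS left_determined_CTS
       {f. \<exists>g. cubification_map f g \<and> g \<in> weqs left_determined_CTS}"

definition combinatorially_fibrant :: "('s, 'l, 'x) ts \<Rightarrow> bool" where
  "combinatorially_fibrant X \<longleftrightarrow>
     (\<forall>n\<ge>1. \<forall>\<alpha>\<in>states X. \<forall>\<beta>\<in>states X. \<forall>us vs.
        length us = n \<and> length vs = n \<and> set us \<subseteq> actions X \<and> set vs \<subseteq> actions X \<and>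
        (\<forall>i<n. lab X (us ! i) = lab X (vs ! i)) \<longrightarrow>
        (\<alpha>, us, \<beta>) \<in> transitions X \<longrightarrow> (\<alpha>, vs, \<beta>) \<in> transitions X)"

end

(*
Call an arrow f a local equivalence if every map from
its source to an object with injective labelling extends uniquely along f. With the maps that are
injective on actions as cofibrations, the local equivalences form a model structure; they contain
the smallest localizer, and every f whose cubification is a local equivalence, because cubes are
dense enough to determine maps into objects with injective labelling. Hence the weak equivalences of
the localization are local equivalences. A map from A to a combinatorially fibrant X extends along a
cofibration A -> B that is a local equivalence: identify the actions of X with the same label,
extend uniquely, and correct the extension on the actions coming from A.

Conversely, let X be fibrant. The map p_x has an invertible cubification, so replacing its target by
an object with two actions gives an acyclic cofibration, and lifting against it exchanges the actions
of a 1-transition. For an n-transition with n > 1 the exchange follows by induction from lifting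
against the pushout-product of the inclusion of the (n-1)-skeleton of X with a cylinder inclusion.
*)
theory Submission
  imports Defs "HOL-Library.Countable"
begin

text \<open>The universe \<open>'u\<close> is only assumed infinite and larger than the set of
  labels. It need not be closed under small unions, so small colimits and the small object argument
  are not at hand: both factorizations have explicit middle objects, and every colimit used is
  either given or verified by hand. The weak equivalences of the localization are an intersection
  over all admissible classes, and nothing has to be proved about that intersection. One implication
  exhibits a single admissible class, the other puts explicit cofibrations into every admissible
  class. Injective labelling is the right test because labels then force the action part of an
  arrow. Such objects see neither the identification of actions made by \<open>p_x\<close> nor the
  splitting of actions made by cubification. In the converse, cubification enters only through
  \<open>p_x\<close>, that is for n = 1. For n > 1 the arrow lies already in the smallest localizer.
  It is bijective on states and actions, so an extension along it has no freedom: its existence just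
  says that the additional transitions are preserved.\<close>

locale category =
  fixes C :: "('o, 'm) cat"
  assumes comp_in_hom: "in_hom C f X Y \<Longrightarrow> in_hom C g Y Z \<Longrightarrow> in_hom C (Comp C g f) X Z"
    and comp_assoc: "in_hom C f X Y \<Longrightarrow> in_hom C g Y Z \<Longrightarrow> in_hom C h Z V \<Longrightarrow>
      Comp C h (Comp C g f) = Comp C (Comp C h g) f"
    and ident_in_hom: "X \<in> Obj C \<Longrightarrow> in_hom C (Ident C X) X X"
    and comp_ident_left: "in_hom C f X Y \<Longrightarrow> Comp C (Ident C Y) f = f"
    and comp_ident_right: "in_hom C f X Y \<Longrightarrow> Comp C f (Ident C X) = f"
    and in_hom_obj: "in_hom C f X Y \<Longrightarrow> X \<in> Obj C \<and> Y \<in> Obj C"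
begin

abbreviation hom :: "'m \<Rightarrow> 'o \<Rightarrow> 'o \<Rightarrow> bool"
  where "hom \<equiv> in_hom C"

abbreviation comp :: "'m \<Rightarrow> 'm \<Rightarrow> 'm"  (infixl "\<cdot>" 70)
  where "g \<cdot> f \<equiv> Comp C g f"

lemma arr_hom: "f \<in> Arr C \<Longrightarrow> hom f (Dom C f) (Cod C f)"
  by (simp add: in_hom_def)

lemma homD: "hom f X Y \<Longrightarrow> f \<in> Arr C \<and> Dom C f = X \<and> Cod C f = Y"
  by (simp add: in_hom_def)

section \<open>Lifting properties, retracts and a criterion for model structures\<close>

lemma lifts_iff:
  assumes "hom i A B" "hom p X Y"
  shows "lifts C i p \<longleftrightarrow>
    (\<forall>a b. hom a A X \<and> hom b B Y \<and> p \<cdot> a = b \<cdot> i \<longrightarrow> (\<exists>h. hom h B X \<and> h \<cdot> i = a \<and> p \<cdot> h = b))"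
  using homD[OF assms(1)] homD[OF assms(2)] unfolding lifts_def commuting_square_def by auto

lemma rlp_mono: "A \<subseteq> B \<Longrightarrow> rlp C B \<subseteq> rlp C A"
  unfolding rlp_def by auto

text \<open>The square is moved to \<open>g\<close> by precomposing with \<open>r\<close> and
  \<open>s\<close>; the lift found there is brought back along \<open>j\<close>.\<close>

lemma lifts_retract_left:
  assumes r: "retract_of C f g" and l: "lifts C g p" and p: "p \<in> Arr C"
  shows "lifts C f p"
proof -
  define A B A' B' X Y where d: "A = Dom C f" "B = Cod C f" "A' = Dom C g" "B' = Cod C g"
    "X = Dom C p" "Y = Cod C p"
  obtain i r j s where h: "hom f A B" "hom g A' B'" "hom i A A'" "hom r A' A" "hom j B B'" "hom s B' B"
    and e: "r \<cdot> i = Ident C A" "s \<cdot> j = Ident C B" "g \<cdot> i = j \<cdot> f" "f \<cdot> r = s \<cdot> g"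
    using r arr_hom unfolding retract_of_def d by blast
  have hp: "hom p X Y" using p d arr_hom by auto
  show ?thesis
  proof (subst lifts_iff[OF h(1) hp], intro allI impI, elim conjE)
    fix a b assume ab: "hom a A X" "hom b B Y" "p \<cdot> a = b \<cdot> f"
    have "p \<cdot> (a \<cdot> r) = (b \<cdot> s) \<cdot> g"
      by (metis comp_assoc[OF h(4) ab(1) hp] comp_assoc[OF h(4) h(1) ab(2)]
          comp_assoc[OF h(2) h(6) ab(2)] ab(3) e(4))
    then obtain k where k: "hom k B' X" "k \<cdot> g = a \<cdot> r" "p \<cdot> k = b \<cdot> s"
      using l h ab comp_in_hom unfolding lifts_iff[OF h(2) hp] by meson
    have "(k \<cdot> j) \<cdot> f = a"
      by (metis comp_assoc[OF h(1) h(5) k(1)] comp_assoc[OF h(3) h(2) k(1)]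
          comp_assoc[OF h(3) h(4) ab(1)] comp_ident_right[OF ab(1)] k(2) e(1,3))
    moreover have "p \<cdot> (k \<cdot> j) = b"
      by (metis comp_assoc[OF h(5) k(1) hp] comp_assoc[OF h(5) h(6) ab(2)]
          comp_ident_right[OF ab(2)] k(3) e(2))
    ultimately show "\<exists>h. hom h B X \<and> h \<cdot> f = a \<and> p \<cdot> h = b"
      using comp_in_hom[OF h(5) k(1)] by blast
  qed
qed

lemma lifts_retract_right:
  assumes r: "retract_of C f g" and l: "lifts C i g" and i: "i \<in> Arr C"
  shows "lifts C i f"
proof -
  define A B A' B' X Y where d: "A = Dom C f" "B = Cod C f" "A' = Dom C g" "B' = Cod C g"
    "X = Dom C i" "Y = Cod C i"
  obtain m r j s where h: "hom f A B" "hom g A' B'" "hom m A A'" "hom r A' A" "hom j B B'" "hom s B' B"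
    and e: "r \<cdot> m = Ident C A" "s \<cdot> j = Ident C B" "g \<cdot> m = j \<cdot> f" "f \<cdot> r = s \<cdot> g"
    using r arr_hom unfolding retract_of_def d by blast
  have hi: "hom i X Y" using i d arr_hom by auto
  show ?thesis
  proof (subst lifts_iff[OF hi h(1)], intro allI impI, elim conjE)
    fix a b assume ab: "hom a X A" "hom b Y B" "f \<cdot> a = b \<cdot> i"
    have "g \<cdot> (m \<cdot> a) = (j \<cdot> b) \<cdot> i"
      by (metis comp_assoc[OF ab(1) h(3) h(2)] comp_assoc[OF ab(1) h(1) h(5)]
          comp_assoc[OF hi ab(2) h(5)] ab(3) e(3))
    then obtain k where k: "hom k Y A'" "k \<cdot> i = m \<cdot> a" "g \<cdot> k = j \<cdot> b"
      using l h ab comp_in_hom unfolding lifts_iff[OF hi h(2)] by meson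
    have "(r \<cdot> k) \<cdot> i = a"
      by (metis comp_assoc[OF hi k(1) h(4)] comp_assoc[OF ab(1) h(3) h(4)]
          comp_ident_left[OF ab(1)] k(2) e(1))
    moreover have "f \<cdot> (r \<cdot> k) = b"
      by (metis comp_assoc[OF k(1) h(4) h(1)] comp_assoc[OF k(1) h(2) h(6)]
          comp_assoc[OF ab(2) h(5) h(6)] comp_ident_left[OF ab(2)] k(3) e(2,4))
    ultimately show "\<exists>h. hom h Y A \<and> h \<cdot> i = a \<and> f \<cdot> h = b"
      using comp_in_hom[OF k(1) h(4)] by blast
  qed
qed

lemma closed_under_retract_llp: "R \<subseteq> Arr C \<Longrightarrow> closed_under_retract C (llp C R)"
  unfolding closed_under_retract_def llp_def
  using lifts_retract_left by (auto simp: retract_of_def) blast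

lemma closed_under_retract_rlp: "L \<subseteq> Arr C \<Longrightarrow> closed_under_retract C (rlp C L)"
  unfolding closed_under_retract_def rlp_def
  using lifts_retract_right by (auto simp: retract_of_def) blast

text \<open>The retract argument: a diagonal \<open>k\<close> in the square with top
  \<open>i\<close> and bottom the identity of \<open>D\<close> is a section of \<open>p\<close>, so
  \<open>k\<close> and \<open>p\<close> exhibit the composite as a retract of \<open>i\<close> over
  an identity of sources.\<close>

lemma retract_of_left_factor:
  assumes h: "hom i A B" "hom p B D" and l: "lifts C (p \<cdot> i) p"
  shows "retract_of C (p \<cdot> i) i"
proof -
  have D: "D \<in> Obj C" "A \<in> Obj C" using in_hom_obj h by auto
  have c: "hom (p \<cdot> i) A D" using comp_in_hom h by auto
  obtain k where k: "hom k D B" "k \<cdot> (p \<cdot> i) = i" "p \<cdot> k = Ident C D"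
    using l h D ident_in_hom comp_ident_left[OF c] unfolding lifts_iff[OF c h(2)] by metis
  show ?thesis
    unfolding retract_of_def
    using homD[OF c] homD[OF h(1)]
    apply (intro conjI)
      apply simp
     apply simp
    apply (rule exI[of _ "Ident C A"], rule exI[of _ "Ident C A"], rule exI[of _ k], rule exI[of _ p])
    by (simp add: k h D ident_in_hom comp_ident_left[OF ident_in_hom] comp_ident_right[OF c]
         comp_ident_right[OF h(1)])
qed

text \<open>The dual retract argument: here the diagonal is a retraction of \<open>i\<close>, and
  the composite is a retract of \<open>p\<close> over an identity of targets.\<close>

lemma retract_of_right_factor:
  assumes h: "hom i A B" "hom p B D" and l: "lifts C i (p \<cdot> i)"
  shows "retract_of C (p \<cdot> i) p"
proof -
  have D: "D \<in> Obj C" "A \<in> Obj C" using in_hom_obj h by auto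
  have c: "hom (p \<cdot> i) A D" using comp_in_hom h by auto
  obtain k where k: "hom k B A" "k \<cdot> i = Ident C A" "(p \<cdot> i) \<cdot> k = p"
    using l h D ident_in_hom comp_ident_right[OF c] unfolding lifts_iff[OF h(1) c] by metis
  show ?thesis
    unfolding retract_of_def
    using homD[OF c] homD[OF h(2)]
    apply (intro conjI)
      apply simp
     apply simp
    apply (rule exI[of _ i], rule exI[of _ k], rule exI[of _ "Ident C D"], rule exI[of _ "Ident C D"])
    by (simp add: k h D ident_in_hom comp_ident_left[OF ident_in_hom] comp_ident_left[OF c]
         comp_ident_left[OF h(2)])
qed

lemma lifts_pushout:
  assumes po: "is_pushout C f g f' g'" and l: "lifts C f p" and p: "p \<in> Arr C"
  shows "lifts C f' p"
proof -
  define A B A' B' X Y where d: "A = Dom C f" "B = Cod C f" "A' = Cod C g" "B' = Cod C f'"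
    "X = Dom C p" "Y = Cod C p"
  have h: "hom f A B" "hom g A A'" "hom f' A' B'" "hom g' B B'" and sq: "f' \<cdot> g = g' \<cdot> f"
    and univ: "\<And>Z a b. hom a A' Z \<Longrightarrow> hom b B Z \<Longrightarrow> a \<cdot> g = b \<cdot> f \<Longrightarrow>
      \<exists>!h. hom h B' Z \<and> h \<cdot> f' = a \<and> h \<cdot> g' = b"
    using po arr_hom unfolding is_pushout_def d by blast+
  have hp: "hom p X Y" using p d arr_hom by auto
  show ?thesis
  proof (subst lifts_iff[OF h(3) hp], intro allI impI, elim conjE)
    fix a b assume ab: "hom a A' X" "hom b B' Y" "p \<cdot> a = b \<cdot> f'"
    have "p \<cdot> (a \<cdot> g) = (b \<cdot> g') \<cdot> f"
      by (metis comp_assoc[OF h(2) ab(1) hp] comp_assoc[OF h(2) h(3) ab(2)]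
          comp_assoc[OF h(1) h(4) ab(2)] ab(3) sq)
    then obtain k where k: "hom k B X" "k \<cdot> f = a \<cdot> g" "p \<cdot> k = b \<cdot> g'"
      using l h ab comp_in_hom unfolding lifts_iff[OF h(1) hp] by meson
    obtain m where m: "hom m B' X" "m \<cdot> f' = a" "m \<cdot> g' = k"
      using univ[OF ab(1) k(1)] k by auto
    \<comment> \<open>Both \<open>p \<cdot> m\<close> and \<open>b\<close> restrict to
      \<open>p \<cdot> a\<close> and \<open>p \<cdot> k\<close> along the two legs, so the
      uniqueness half of the pushout property identifies them.\<close>
    have pa: "hom (p \<cdot> a) A' Y" "hom (p \<cdot> k) B Y"
      using comp_in_hom[OF ab(1) hp] comp_in_hom[OF k(1) hp] by auto
    have "(p \<cdot> a) \<cdot> g = (p \<cdot> k) \<cdot> f"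
      by (metis comp_assoc[OF h(2) ab(1) hp] comp_assoc[OF h(1) k(1) hp] k(2))
    from univ[OF pa this] have "p \<cdot> m = b"
      using comp_in_hom[OF m(1) hp] ab(2,3) k(3) comp_assoc[OF h(3) m(1) hp]
        comp_assoc[OF h(4) m(1) hp] m(2,3) by metis
    with m show "\<exists>h. hom h B' X \<and> h \<cdot> f' = a \<and> p \<cdot> h = b" by blast
  qed
qed

lemma closed_under_pushout_llp: "R \<subseteq> Arr C \<Longrightarrow> closed_under_pushout C (llp C R)"
  unfolding closed_under_pushout_def llp_def
  using lifts_pushout by (auto simp: is_pushout_def in_hom_def)


text \<open>The retract argument identifies the fibrations in \<open>W\<close> with
  \<open>rlp C Cof\<close>. After that both lifting axioms hold by definition of \<open>rlp\<close>,
  and what remains is assumed.\<close>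

lemma model_structure_model_of:
  assumes Cof: "Cof = llp C R" "R \<subseteq> Arr C" and W: "W \<subseteq> Arr C" "two_out_of_three C W"
    "closed_under_retract C W" "rlp C Cof \<subseteq> W"
    and fact: "factors_through C Cof (rlp C Cof)" "factors_through C (Cof \<inter> W) (rlp C (Cof \<inter> W))"
  shows "model_structure C (model_of C Cof W)"
proof -
  have CA: "Cof \<subseteq> Arr C" using Cof by (auto simp: llp_def)
  have RA: "rlp C L \<subseteq> Arr C" for L by (auto simp: rlp_def)
  have sub: "rlp C Cof \<subseteq> rlp C (Cof \<inter> W) \<inter> W"
    using rlp_mono[of "Cof \<inter> W" Cof] W by auto
  have conv: "p \<in> rlp C Cof" if p: "p \<in> rlp C (Cof \<inter> W)" "p \<in> W" for p
  proof -
    have pA: "p \<in> Arr C" using p W by auto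
    obtain i q where iq: "i \<in> Cof" "q \<in> rlp C Cof" "Cod C i = Dom C q" "q \<cdot> i = p"
      using fact(1) pA unfolding factors_through_def by blast
    have h: "hom i (Dom C i) (Dom C q)" "hom q (Dom C q) (Cod C q)"
      using arr_hom iq CA RA by (metis subsetD)+
    \<comment> \<open>Two-out-of-three applies to \<open>q \<cdot> i = p\<close>, where
      \<open>q\<close> lies in \<open>W\<close> by \<open>W(4)\<close>. Hence \<open>p\<close> lifts
      against \<open>i\<close>, which is what the retract argument asks for.\<close>
    have "i \<in> W" using W(2,4) iq p CA RA unfolding two_out_of_three_def by blast
    then have "lifts C i p" using p iq by (auto simp: rlp_def)
    then have "retract_of C p q" using retract_of_right_factor[OF h] iq by simp
    then show ?thesis using closed_under_retract_rlp[OF CA] iq(2)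
      unfolding closed_under_retract_def by blast
  qed
  then have eq: "rlp C (Cof \<inter> W) \<inter> W = rlp C Cof" using sub by auto
  have "closed_under_retract C (rlp C (Cof \<inter> W))"
    using CA by (intro closed_under_retract_rlp) auto
  moreover have "\<forall>i\<in>L. \<forall>p\<in>rlp C L. lifts C i p" for L
    by (auto simp: rlp_def)
  moreover have "closed_under_retract C Cof"
    using closed_under_retract_llp[OF Cof(2)] Cof(1) by simp
  ultimately show ?thesis
    unfolding model_structure_def model_of_def
    using CA W(1-3) RA fact by (simp add: eq)
qed

section \<open>Local equivalences: orthogonality to a class of objects\<close>

definition local_equivalences :: "'o set \<Rightarrow> 'm set" where
  "local_equivalences L = {f \<in> Arr C. \<forall>Y\<in>L. \<forall>a. hom a (Dom C f) Y \<longrightarrow>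
     (\<exists>!b. hom b (Cod C f) Y \<and> b \<cdot> f = a)}"

lemma local_equivalencesI:
  assumes "hom f A B"
    and "\<And>Y a. Y \<in> L \<Longrightarrow> hom a A Y \<Longrightarrow> \<exists>b. hom b B Y \<and> b \<cdot> f = a"
    and "\<And>Y b b'. Y \<in> L \<Longrightarrow> hom b B Y \<Longrightarrow> hom b' B Y \<Longrightarrow> b \<cdot> f = b' \<cdot> f \<Longrightarrow> b = b'"
  shows "f \<in> local_equivalences L"
proof -
  have "\<exists>!b. hom b B Y \<and> b \<cdot> f = a" if "Y \<in> L" "hom a A Y" for Y a
    using assms(2)[OF that] assms(3)[OF that(1)] by blast
  then show ?thesis using homD[OF assms(1)] unfolding local_equivalences_def by auto
qed

lemma local_equivalences_ex:
  assumes "f \<in> local_equivalences L" "hom f A B" "Y \<in> L" "hom a A Y"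
  obtains b where "hom b B Y" "b \<cdot> f = a"
  using assms homD[OF assms(2)] unfolding local_equivalences_def by blast

lemma local_equivalences_unique:
  assumes "f \<in> local_equivalences L" "hom f A B" "Y \<in> L" "hom b B Y" "hom b' B Y" "b \<cdot> f = b' \<cdot> f"
  shows "b = b'"
proof -
  have "hom (b \<cdot> f) A Y" using assms comp_in_hom by blast
  then have "\<exists>!c. hom c B Y \<and> c \<cdot> f = b \<cdot> f"
    using assms(1,3) homD[OF assms(2)] unfolding local_equivalences_def by auto
  then show ?thesis using assms(4-6) by metis
qed

text \<open>The definition asks for strictly unique extensions, not extensions up to homotopy. This
  makes the closure properties from here on formal, for every \<open>L\<close> and without any
  colimit having to exist.\<close>

lemma two_out_of_three_local: "two_out_of_three C (local_equivalences L)"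
  unfolding two_out_of_three_def
proof (intro allI impI, elim conjE)
  let ?W = "local_equivalences L"
  fix f g assume fg: "f \<in> Arr C" "g \<in> Arr C" "Cod C f = Dom C g"
  define X Y Z where d: "X = Dom C f" "Y = Dom C g" "Z = Cod C g"
  have f: "hom f X Y" and g: "hom g Y Z" using fg d arr_hom by (metis, metis)
  have gf: "hom (g \<cdot> f) X Z" using f g comp_in_hom by auto
  note as = comp_assoc[OF f g]
  show "(f \<in> ?W \<and> g \<in> ?W \<longrightarrow> g \<cdot> f \<in> ?W) \<and> (f \<in> ?W \<and> g \<cdot> f \<in> ?W \<longrightarrow> g \<in> ?W) \<and>
    (g \<in> ?W \<and> g \<cdot> f \<in> ?W \<longrightarrow> f \<in> ?W)"
  proof (intro conjI impI; elim conjE)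
    assume w: "f \<in> ?W" "g \<in> ?W"
    show "g \<cdot> f \<in> ?W"
    proof (rule local_equivalencesI[OF gf])
      fix V a assume V: "V \<in> L" "hom a X V"
      obtain b where b: "hom b Y V" "b \<cdot> f = a"
        using local_equivalences_ex[OF w(1) f V] .
      obtain c where "hom c Z V" "c \<cdot> g = b"
        using local_equivalences_ex[OF w(2) g V(1) b(1)] .
      then show "\<exists>b. hom b Z V \<and> b \<cdot> (g \<cdot> f) = a" using b(2) as by metis
    next
      fix V b b' assume V: "V \<in> L" "hom b Z V" "hom b' Z V" "b \<cdot> (g \<cdot> f) = b' \<cdot> (g \<cdot> f)"
      have "b \<cdot> g = b' \<cdot> g"
        by (rule local_equivalences_unique[OF w(1) f V(1)])
          (use V(4) as[OF V(2)] as[OF V(3)] comp_in_hom[OF g V(2)] comp_in_hom[OF g V(3)] in simp_all)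
      then show "b = b'" by (rule local_equivalences_unique[OF w(2) g V(1-3)])
    qed
  next
    assume w: "f \<in> ?W" "g \<cdot> f \<in> ?W"
    show "g \<in> ?W"
    proof (rule local_equivalencesI[OF g])
      fix V a assume V: "V \<in> L" "hom a Y V"
      obtain b where b: "hom b Z V" "b \<cdot> (g \<cdot> f) = a \<cdot> f"
        using local_equivalences_ex[OF w(2) gf V(1) comp_in_hom[OF f V(2)]] .
      have "b \<cdot> g = a"
        by (rule local_equivalences_unique[OF w(1) f V(1)])
          (use as[OF b(1)] b comp_in_hom[OF g b(1)] V(2) in simp_all)
      then show "\<exists>b. hom b Z V \<and> b \<cdot> g = a" using b by auto
    next
      fix V b b' assume V: "V \<in> L" "hom b Z V" "hom b' Z V" "b \<cdot> g = b' \<cdot> g"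
      show "b = b'"
        by (rule local_equivalences_unique[OF w(2) gf V(1-3)])
          (use V(4) as[OF V(2)] as[OF V(3)] in simp)
    qed
  next
    assume w: "g \<in> ?W" "g \<cdot> f \<in> ?W"
    show "f \<in> ?W"
    proof (rule local_equivalencesI[OF f])
      fix V a assume V: "V \<in> L" "hom a X V"
      obtain b where b: "hom b Z V" "b \<cdot> (g \<cdot> f) = a"
        using local_equivalences_ex[OF w(2) gf V] .
      then show "\<exists>b. hom b Y V \<and> b \<cdot> f = a"
        using as comp_in_hom[OF g] by metis
    next
      fix V b b' assume V: "V \<in> L" "hom b Y V" "hom b' Y V" "b \<cdot> f = b' \<cdot> f"
      obtain c where c: "hom c Z V" "c \<cdot> g = b"
        using local_equivalences_ex[OF w(1) g V(1,2)] .
      obtain c' where c': "hom c' Z V" "c' \<cdot> g = b'"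
        using local_equivalences_ex[OF w(1) g V(1,3)] .
      have "c = c'" 

        by (rule local_equivalences_unique[OF w(2) gf V(1) c(1) c'(1)])
          (use c c' V(4) as[OF c(1)] as[OF c'(1)] in simp)
      then show "b = b'" using c c' by simp
    qed
  qed
qed

lemma closed_under_retract_local: "closed_under_retract C (local_equivalences L)"
  unfolding closed_under_retract_def
proof (intro allI impI, elim conjE)
  fix f g assume g: "g \<in> local_equivalences L" and r: "retract_of C f g"
  define A B A' B' where d: "A = Dom C f" "B = Cod C f" "A' = Dom C g" "B' = Cod C g"
  obtain i r j s where h: "hom f A B" "hom g A' B'" "hom i A A'" "hom r A' A" "hom j B B'" "hom s B' B"
    and e: "r \<cdot> i = Ident C A" "s \<cdot> j = Ident C B" "g \<cdot> i = j \<cdot> f" "f \<cdot> r = s \<cdot> g"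
    using r arr_hom unfolding retract_of_def d by blast
  show "f \<in> local_equivalences L"
  proof (rule local_equivalencesI[OF h(1)])
    fix V a assume V: "V \<in> L" "hom a A V"
    obtain b where b: "hom b B' V" "b \<cdot> g = a \<cdot> r"
      using local_equivalences_ex[OF g h(2) V(1) comp_in_hom[OF h(4) V(2)]] .
    have "(b \<cdot> j) \<cdot> f = a"
      by (metis comp_assoc[OF h(1) h(5) b(1)] comp_assoc[OF h(3) h(2) b(1)]
          comp_assoc[OF h(3) h(4) V(2)] comp_ident_right[OF V(2)] b(2) e(1,3))
    then show "\<exists>b. hom b B V \<and> b \<cdot> f = a" using comp_in_hom[OF h(5) b(1)] by auto
  next
    fix V b b' assume V: "V \<in> L" "hom b B V" "hom b' B V" "b \<cdot> f = b' \<cdot> f"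
    have "(b \<cdot> s) \<cdot> g = (b' \<cdot> s) \<cdot> g" 
      by (metis comp_assoc[OF h(2) h(6) V(2)] comp_assoc[OF h(2) h(6) V(3)]
          comp_assoc[OF h(4) h(1) V(2)] comp_assoc[OF h(4) h(1) V(3)] V(4) e(4))
    then have "b \<cdot> s = b' \<cdot> s"
      using local_equivalences_unique[OF g h(2) V(1)] comp_in_hom[OF h(6)] V by blast
    then show "b = b'" 
      by (metis comp_assoc[OF h(5) h(6) V(2)] comp_assoc[OF h(5) h(6) V(3)]
          comp_ident_right[OF V(2)] comp_ident_right[OF V(3)] e(2))
  qed
qed

lemma closed_under_pushout_local: "closed_under_pushout C (local_equivalences L)"
  unfolding closed_under_pushout_def
proof (intro allI impI, elim conjE)
  fix f g f' g' assume w: "f \<in> local_equivalences L" and po: "is_pushout C f g f' g'"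
  define A B A' B' where d: "A = Dom C f" "B = Cod C f" "A' = Cod C g" "B' = Cod C f'"
  have h: "hom f A B" "hom g A A'" "hom f' A' B'" "hom g' B B'" and sq: "f' \<cdot> g = g' \<cdot> f"
    and univ: "\<And>Z a b. hom a A' Z \<Longrightarrow> hom b B Z \<Longrightarrow> a \<cdot> g = b \<cdot> f \<Longrightarrow>
      \<exists>!h. hom h B' Z \<and> h \<cdot> f' = a \<and> h \<cdot> g' = b"
    using po arr_hom unfolding is_pushout_def d by blast+
  show "f' \<in> local_equivalences L"
  proof (rule local_equivalencesI[OF h(3)])
    fix V a assume V: "V \<in> L" "hom a A' V"
    obtain b where b: "hom b B V" "b \<cdot> f = a \<cdot> g"
      using local_equivalences_ex[OF w h(1) V(1) comp_in_hom[OF h(2) V(2)]] .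
    then show "\<exists>b. hom b B' V \<and> b \<cdot> f' = a" using univ[OF V(2) b(1)] by auto
  next
    fix V b b' assume V: "V \<in> L" "hom b B' V" "hom b' B' V" "b \<cdot> f' = b' \<cdot> f'"
    have "(b \<cdot> g') \<cdot> f = (b' \<cdot> g') \<cdot> f" 
      by (metis comp_assoc[OF h(1) h(4) V(2)] comp_assoc[OF h(1) h(4) V(3)]
          comp_assoc[OF h(2) h(3) V(2)] comp_assoc[OF h(2) h(3) V(3)] V(4) sq)
    then have "b \<cdot> g' = b' \<cdot> g'"
      using local_equivalences_unique[OF w h(1) V(1)] comp_in_hom[OF h(4)] V by blast
    moreover have "(b \<cdot> f') \<cdot> g = (b \<cdot> g') \<cdot> f" 
      by (metis comp_assoc[OF h(1) h(4) V(2)] comp_assoc[OF h(2) h(3) V(2)] sq)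
    ultimately show "b = b'"
      using univ[OF comp_in_hom[OF h(3) V(2)] comp_in_hom[OF h(4) V(2)]] V by metis
  qed
qed

text \<open>The three cases are exhaustive because \<open>limit_index\<close> is defined by
  excluding the other two. This is the shape in which \<open>transfinite_sequence\<close> gives
  information about a stage.\<close>

lemma well_order_induct_limit [consumes 2, case_names least successor limit]:
  assumes r: "Well_order r" and j: "j \<in> Field r"
    and least: "\<And>j. least_index r j \<Longrightarrow> P j"
    and succ: "\<And>i j. covers r i j \<Longrightarrow> P i \<Longrightarrow> P j"
    and lim: "\<And>j. limit_index r j \<Longrightarrow> (\<And>i. i \<in> below r j \<Longrightarrow> P i) \<Longrightarrow> P j"
  shows "P j"
proof -
  have "wf (r - Id)" using r by (simp add: well_order_on_def)
  then show ?thesis using j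
  proof (induction j rule: wf_induct_rule)
    case (less j)
    consider "least_index r j" | "\<exists>i. covers r i j" | "limit_index r j"
      using less.prems by (auto simp: limit_index_def)
    then show ?case
    proof cases
      case 2
      then obtain i where i: "covers r i j" by auto
      then have "(i, j) \<in> r - Id" by (auto simp: covers_def)
      with less i show ?thesis by (meson DiffD1 FieldI1 succ)
    next
      case 3
      show ?thesis
      proof (rule lim[OF 3])
        fix i assume "i \<in> below r j"
        then have "(i, j) \<in> r - Id" by (auto simp: below_def)
        with less show "P i" by (meson DiffD1 FieldI1)
      qed
    qed (fact least)
  qed
qed

text \<open>Extensions along the \<open>\<phi> i0 i\<close> are unique, hence compatible with each
  other, hence a cocone. The set \<open>A\<close> is either the part below a limit index or the
  whole field, so limit stages and the final colimit are treated at once.\<close>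

lemma local_equivalences_colimit:
  assumes r: "Well_order r" and seq: "transfinite_sequence C r D \<phi>"
    and A: "A \<subseteq> Field r" "i0 \<in> A" and i0: "least_index r i0"
    and w: "\<And>i. i \<in> A \<Longrightarrow> \<phi> i0 i \<in> local_equivalences L"
    and col: "is_colimit C A D (edges r A \<phi>) Q l"
  shows "l i0 \<in> local_equivalences L"
proof -
  have hl: "hom (l i) (D i) Q" if "i \<in> A" for i
    using col that unfolding is_colimit_def cocone_def by auto
  have ll: "l j \<cdot> \<phi> i j = l i" if "i \<in> A" "j \<in> A" "(i, j) \<in> r" for i j
    using col that unfolding is_colimit_def cocone_def edges_def by auto
  have univ: "\<exists>!h. hom h Q Q' \<and> (\<forall>j\<in>A. h \<cdot> l j = l' j)" if "cocone C A D (edges r A \<phi>) Q' l'" for Q' l'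
    using col that unfolding is_colimit_def by blast
  have i0r: "(i0, i) \<in> r" if "i \<in> A" for i
    using i0 that A unfolding least_index_def by auto
  have hp: "hom (\<phi> i j) (D i) (D j)" if "(i, j) \<in> r" for i j
    using seq that unfolding transfinite_sequence_def by auto
  have pp: "\<phi> j k \<cdot> \<phi> i j = \<phi> i k" if "(i, j) \<in> r" "(j, k) \<in> r" for i j k
    using seq that unfolding transfinite_sequence_def by blast
  show ?thesis
  proof (rule local_equivalencesI[OF hl[OF A(2)]])
    fix V a assume V: "V \<in> L" "hom a (D i0) V"
    have "\<exists>h. \<forall>i\<in>A. hom (h i) (D i) V \<and> h i \<cdot> \<phi> i0 i = a"
      by (rule bchoice) (metis V i0r hp local_equivalences_ex w)
    then obtain h where h: "\<And>i. i \<in> A \<Longrightarrow> hom (h i) (D i) V \<and> h i \<cdot> \<phi> i0 i = a" by auto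
    have "h j \<cdot> \<phi> i j = h i" if ij: "i \<in> A" "j \<in> A" "(i, j) \<in> r" for i j
    proof (rule local_equivalences_unique[OF w[OF ij(1)] hp[OF i0r[OF ij(1)]] V(1)])
      show "hom (h j \<cdot> \<phi> i j) (D i) V" using comp_in_hom[OF hp[OF ij(3)]] h ij by auto
      show "(h j \<cdot> \<phi> i j) \<cdot> \<phi> i0 i = h i \<cdot> \<phi> i0 i"
        using comp_assoc[OF hp[OF i0r[OF ij(1)]] hp[OF ij(3)], of "h j" V] h[OF ij(2)] h[OF ij(1)]
          pp[OF i0r[OF ij(1)] ij(3)] by simp
    qed (use h ij in auto)
    then have "cocone C A D (edges r A \<phi>) V h"
      using h in_hom_obj[OF V(2)] unfolding cocone_def edges_def by auto
    from univ[OF this] obtain k where k: "hom k Q V" "\<And>j. j \<in> A \<Longrightarrow> k \<cdot> l j = h j" by auto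
    \<comment> \<open>\<open>\<phi> i0 i0\<close> is an identity, so the component of the cocone at
      the first stage is \<open>a\<close> itself.\<close>
    have "h i0 = a"
      using h[OF A(2)] V seq A i0r[OF A(2)] comp_ident_right unfolding transfinite_sequence_def
      by (metis subsetD)
    then show "\<exists>b. hom b Q V \<and> b \<cdot> l i0 = a" using k A by auto
  next
    fix V b b' assume V: "V \<in> L" "hom b Q V" "hom b' Q V" "b \<cdot> l i0 = b' \<cdot> l i0"
    have "b \<cdot> l i = b' \<cdot> l i" if i: "i \<in> A" for i
    proof (rule local_equivalences_unique[OF w[OF i] hp[OF i0r[OF i]] V(1)])
      show "(b \<cdot> l i) \<cdot> \<phi> i0 i = (b' \<cdot> l i) \<cdot> \<phi> i0 i"
        using comp_assoc[OF hp[OF i0r[OF i]] hl[OF i] V(2)]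
          comp_assoc[OF hp[OF i0r[OF i]] hl[OF i] V(3)] ll[OF A(2) i i0r[OF i]] V(4) by simp
    qed (use comp_in_hom[OF hl[OF i] V(2)] comp_in_hom[OF hl[OF i] V(3)] in simp_all)
    moreover have "cocone C A D (edges r A \<phi>) V (\<lambda>i. b \<cdot> l i)"
      unfolding cocone_def
    proof (intro conjI ballI)
      fix x assume "x \<in> edges r A \<phi>"
      then obtain i j where x: "x = (i, \<phi> i j, j)" "i \<in> A" "j \<in> A" "(i, j) \<in> r"
        unfolding edges_def by auto
      then show "case x of (j, m, j') \<Rightarrow> b \<cdot> l j' \<cdot> m = b \<cdot> l j"
        using comp_assoc[OF hp[OF x(4)] hl[OF x(3)] V(2)] ll[OF x(2-4)] by simp
    qed (use in_hom_obj[OF V(2)] comp_in_hom[OF hl V(2)] in auto)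
    ultimately show "b = b'" using univ V(2,3) by metis
  qed
qed

lemma closed_under_transfinite_composition_local:
  assumes "\<And>r. r \<in> Ords \<Longrightarrow> Well_order r"
  shows "closed_under_transfinite_composition C Ords (local_equivalences L)"
  unfolding closed_under_transfinite_composition_def
proof (intro ballI allI impI, elim conjE)
  let ?W = "local_equivalences L"
  fix r D \<phi> Q l i0
  assume r: "r \<in> Ords" and seq: "transfinite_sequence C r D \<phi>"
    and cov: "\<forall>i j. covers r i j \<longrightarrow> \<phi> i j \<in> ?W"
    and col: "is_colimit C (Field r) D (edges r (Field r) \<phi>) Q l" and i0: "least_index r i0"
  have wo: "Well_order r" using r assms by auto
  have i0F: "i0 \<in> Field r" using i0 by (auto simp: least_index_def)
  have "\<phi> i0 j \<in> ?W" if "j \<in> Field r" for j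
    using wo that
  proof (induction j rule: well_order_induct_limit)
    case (least j)
    then have "(i0, j) \<in> r" "(j, i0) \<in> r" using i0 by (auto simp: least_index_def)
    then have "j = i0" using wo
      by (auto simp: well_order_on_def linear_order_on_def partial_order_on_def antisym_def)
    then have "\<phi> i0 j = Ident C (D i0)" "D i0 \<in> Obj C"
      using seq i0F unfolding transfinite_sequence_def by auto
    then show ?case
      by (auto intro!: local_equivalencesI[OF ident_in_hom] simp: comp_ident_right)
  next
    case (successor i j)
    then have ij: "(i, j) \<in> r" by (auto simp: covers_def)
    then have i: "(i0, i) \<in> r" using i0 by (auto simp: least_index_def FieldI1)
    have "\<phi> i0 j = \<phi> i j \<cdot> \<phi> i0 i" "hom (\<phi> i j) (D i) (D j)" "hom (\<phi> i0 i) (D i0) (D i)"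
      using seq i ij unfolding transfinite_sequence_def by (metis, auto)
    then show ?case using two_out_of_three_local cov successor homD
      unfolding two_out_of_three_def by metis
  next
    case (limit j)
    have "i0 \<in> below r j"
      using limit(1) i0 unfolding limit_index_def below_def least_index_def by auto
    moreover have "below r j \<subseteq> Field r" by (auto simp: below_def FieldI1)
    moreover have "is_colimit C (below r j) D (edges r (below r j) \<phi>) (D j) (\<lambda>i. \<phi> i j)"
      using seq limit(1) unfolding transfinite_sequence_def by auto
    ultimately show ?case
      using local_equivalences_colimit[OF wo seq _ _ i0 limit(2), of "below r j"] by auto
  qed
  then show "l i0 \<in> ?W"
    using local_equivalences_colimit[OF wo seq _ i0F i0 _ col] by auto
qed

end


section \<open>Weak and cubical transition systems and their maps\<close>

lemma weak_tsD:
  assumes "weak_ts X" "(\<alpha>, us, \<beta>) \<in> transitions X"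
  shows "\<alpha> \<in> states X" "\<beta> \<in> states X" "us \<noteq> []" "set us \<subseteq> actions X"
  using assms unfolding weak_ts_def by fast+

text \<open>Lists with equal multisets differ by a permutation. The multiset axiom is silent on
  length one, where there is nothing to permute.\<close>

lemma weak_ts_mset:
  assumes "weak_ts X" "(\<alpha>, us, \<beta>) \<in> transitions X" "mset vs = mset us"
  shows "(\<alpha>, vs, \<beta>) \<in> transitions X"
proof (cases "length us \<ge> 2")
  case True
  obtain p where "p permutes {..<length us}" "permute_list p us = vs"
    using mset_eq_permutation[OF assms(3)] by auto
  then show ?thesis using assms True unfolding weak_ts_def by blast
next
  case False
  then obtain u where "us = [u]"
    using weak_tsD(3)[OF assms(1,2)] by (cases us; cases "tl us") auto
  then show ?thesis using assms by simp
qed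

lemma weak_ts_patch:
  assumes "weak_ts X"
    and "us \<noteq> []" "vs \<noteq> []" "ws \<noteq> []"
    and "(\<alpha>, us @ vs @ ws, \<beta>) \<in> transitions X"
    and "(\<alpha>, us, \<nu>1) \<in> transitions X" "(\<nu>1, vs @ ws, \<beta>) \<in> transitions X"
    and "(\<alpha>, us @ vs, \<nu>2) \<in> transitions X" "(\<nu>2, ws, \<beta>) \<in> transitions X"
  shows "(\<nu>1, vs, \<nu>2) \<in> transitions X"
  using assms(1) unfolding weak_ts_def using assms(2-) by blast

lemma weak_tsI:
  assumes "\<And>\<alpha> us \<beta>. (\<alpha>, us, \<beta>) \<in> transitions X \<Longrightarrow>
      \<alpha> \<in> states X \<and> \<beta> \<in> states X \<and> us \<noteq> [] \<and> set us \<subseteq> actions X"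
    and "\<And>\<alpha> us vs \<beta>. (\<alpha>, us, \<beta>) \<in> transitions X \<Longrightarrow> mset vs = mset us \<Longrightarrow>
      (\<alpha>, vs, \<beta>) \<in> transitions X"
    and "\<And>\<alpha> \<beta> \<nu>1 \<nu>2 us vs ws. us \<noteq> [] \<Longrightarrow> vs \<noteq> [] \<Longrightarrow> ws \<noteq> [] \<Longrightarrow>
      (\<alpha>, us @ vs @ ws, \<beta>) \<in> transitions X \<Longrightarrow>
      (\<alpha>, us, \<nu>1) \<in> transitions X \<Longrightarrow> (\<nu>1, vs @ ws, \<beta>) \<in> transitions X \<Longrightarrow>
      (\<alpha>, us @ vs, \<nu>2) \<in> transitions X \<Longrightarrow> (\<nu>2, ws, \<beta>) \<in> transitions X \<Longrightarrow>
      (\<nu>1, vs, \<nu>2) \<in> transitions X"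
  shows "weak_ts X"
  unfolding weak_ts_def
  apply (intro conjI)
  subgoal using assms(1) by fast
  subgoal using assms(2) by (metis mset_permute_list)
  subgoal using assms(3) by blast
  done

lemma cubical_ts_weak: "cubical_ts X \<Longrightarrow> weak_ts X"
  by (simp add: cubical_ts_def)

lemma cubical_ts_used:
  assumes "cubical_ts X" "u \<in> actions X"
  obtains \<alpha> \<beta> where "(\<alpha>, [u], \<beta>) \<in> transitions X"
  using assms unfolding cubical_ts_def by blast

text \<open>The intermediate state axiom only cuts a list after a prefix. Together with the multiset
  axiom it cuts along any division of the multiset of actions, which is the form used
  throughout.\<close>

lemma cubical_ts_split:
  assumes "cubical_ts X" "(\<alpha>, us, \<beta>) \<in> transitions X" "mset (xs @ ys) = mset us" "xs \<noteq> []" "ys \<noteq> []"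
  obtains \<nu> where "(\<alpha>, xs, \<nu>) \<in> transitions X" "(\<nu>, ys, \<beta>) \<in> transitions X"
proof -
  have "(\<alpha>, xs @ ys, \<beta>) \<in> transitions X"
    using weak_ts_mset[OF cubical_ts_weak[OF assms(1)] assms(2,3)] .
  moreover have "1 \<le> length xs" "1 \<le> length ys"
    using assms(4,5) by (simp_all add: Suc_le_eq)
  then have "length (xs @ ys) \<ge> 2" "1 \<le> length xs" "length xs < length (xs @ ys)"
    using assms(5) by (simp_all add: assms(5))
  ultimately obtain \<nu> where
    "(\<alpha>, take (length xs) (xs @ ys), \<nu>) \<in> transitions X"
    "(\<nu>, drop (length xs) (xs @ ys), \<beta>) \<in> transitions X"
    using assms(1) unfolding cubical_ts_def by blast
  then show ?thesis using that by simp
qed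

lemma cubical_tsI:
  assumes "weak_ts X"
    and "\<And>u. u \<in> actions X \<Longrightarrow> \<exists>\<alpha> \<beta>. (\<alpha>, [u], \<beta>) \<in> transitions X"
    and "\<And>\<alpha> \<beta> xs ys. (\<alpha>, xs @ ys, \<beta>) \<in> transitions X \<Longrightarrow> xs \<noteq> [] \<Longrightarrow> ys \<noteq> [] \<Longrightarrow>
      \<exists>\<nu>. (\<alpha>, xs, \<nu>) \<in> transitions X \<and> (\<nu>, ys, \<beta>) \<in> transitions X"
  shows "cubical_ts X"
  unfolding cubical_ts_def
proof (intro conjI allI impI ballI; (elim conjE)?)
  fix \<alpha> us \<beta> p
  assume us: "(\<alpha>, us, \<beta>) \<in> transitions X" "2 \<le> length us" "1 \<le> p" "p < length us"
  have "take p us \<noteq> []" "drop p us \<noteq> []" "(\<alpha>, take p us @ drop p us, \<beta>) \<in> transitions X"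
    using us by auto
  from assms(3)[OF this(3,1,2)] obtain \<nu> where
    "(\<alpha>, take p us, \<nu>) \<in> transitions X" "(\<nu>, drop p us, \<beta>) \<in> transitions X" by auto
  then show "\<exists>\<nu>\<in>states X. (\<alpha>, take p us, \<nu>) \<in> transitions X \<and> (\<nu>, drop p us, \<beta>) \<in> transitions X"
    using weak_tsD[OF assms(1)] by blast
qed (use assms in auto)

lemma ts_mapI:
  assumes "\<And>s. s \<in> states X \<Longrightarrow> f s \<in> states Y"
    and "\<And>u. u \<in> actions X \<Longrightarrow> g u \<in> actions Y"
    and "\<And>u. u \<in> actions X \<Longrightarrow> lab Y (g u) = lab X u"
    and "\<And>\<alpha> us \<beta>. (\<alpha>, us, \<beta>) \<in> transitions X \<Longrightarrow> (f \<alpha>, map g us, f \<beta>) \<in> transitions Y"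
  shows "ts_map X Y f g"
  using assms unfolding ts_map_def by auto

lemma ts_mapD:
  assumes "ts_map X Y f g"
  shows "s \<in> states X \<Longrightarrow> f s \<in> states Y"
    and "u \<in> actions X \<Longrightarrow> g u \<in> actions Y"
    and "u \<in> actions X \<Longrightarrow> lab Y (g u) = lab X u"
    and "(\<alpha>, us, \<beta>) \<in> transitions X \<Longrightarrow> (f \<alpha>, map g us, f \<beta>) \<in> transitions Y"
  using assms unfolding ts_map_def by auto

lemma ts_map_comp:
  assumes "ts_map X Y f g" "ts_map Y Z f' g'"
  shows "ts_map X Z (\<lambda>s. f' (f s)) (\<lambda>u. g' (g u))"
proof (rule ts_mapI)
  fix \<alpha> us \<beta> assume "(\<alpha>, us, \<beta>) \<in> transitions X"
  from ts_mapD(4)[OF assms(2) ts_mapD(4)[OF assms(1) this]]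
  show "(f' (f \<alpha>), map (\<lambda>u. g' (g u)) us, f' (f \<beta>)) \<in> transitions Z"
    by (simp add: comp_def)
qed (use ts_mapD[OF assms(1)] ts_mapD[OF assms(2)] in auto)

lemma ts_map_cong:
  assumes "ts_map X Y f g" "weak_ts X"
    and "\<And>s. s \<in> states X \<Longrightarrow> f' s = f s" "\<And>u. u \<in> actions X \<Longrightarrow> g' u = g u"
  shows "ts_map X Y f' g'"
proof (rule ts_mapI)
  fix \<alpha> us \<beta> assume t: "(\<alpha>, us, \<beta>) \<in> transitions X"
  have "map g' us = map g us" using weak_tsD[OF assms(2) t] assms(4) by auto
  then show "(f' \<alpha>, map g' us, f' \<beta>) \<in> transitions Y"
    using ts_mapD(4)[OF assms(1) t] weak_tsD[OF assms(2) t] assms(3) by metis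
qed (use ts_mapD[OF assms(1)] assms(3,4) in auto)

lemma ts_iso_bij:
  assumes "ts_iso X Y f g"
  shows "bij_betw f (states X) (states Y)" "bij_betw g (actions X) (actions Y)"
proof -
  obtain f' g' where "ts_map X Y f g" "ts_map Y X f' g'"
    "\<forall>s\<in>states X. f' (f s) = s" "\<forall>u\<in>actions X. g' (g u) = u"
    "\<forall>t\<in>states Y. f (f' t) = t" "\<forall>v\<in>actions Y. g (g' v) = v"
    using assms unfolding ts_iso_def by blast
  then show "bij_betw f (states X) (states Y)" "bij_betw g (actions X) (actions Y)"
    by (auto intro!: bij_betwI[where g = f'] bij_betwI[where g = g'] dest: ts_mapD)
qed


section \<open>Constructions of transition systems\<close>

text \<open>The largest structure on the action set \<open>L\<close> that makes \<open>g\<close> a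
  map over the identity on states. A surjective \<open>g\<close> gives a trivial fibration, hence
  mapping factorizations and cylinders; an inclusion gives the full subsystem on some of the
  actions.\<close>

definition pull_actions :: "('s, 'l, 'x) ts \<Rightarrow> 'k set \<Rightarrow> ('k \<Rightarrow> 'l) \<Rightarrow> ('s, 'k, 'x) ts" where
  "pull_actions Y L g =
     \<lparr>states = states Y, actions = L, lab = (\<lambda>u. lab Y (g u)),
      transitions = {(\<alpha>, us, \<beta>). set us \<subseteq> L \<and> (\<alpha>, map g us, \<beta>) \<in> transitions Y}\<rparr>"

lemma pull_actions_simps [simp]:
  "states (pull_actions Y L g) = states Y"
  "actions (pull_actions Y L g) = L"
  "lab (pull_actions Y L g) u = lab Y (g u)"
  "(\<alpha>, us, \<beta>) \<in> transitions (pull_actions Y L g) \<longleftrightarrow>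
    set us \<subseteq> L \<and> (\<alpha>, map g us, \<beta>) \<in> transitions Y"
  by (auto simp: pull_actions_def)


lemma weak_ts_pull_actions:
  assumes "weak_ts Y" "g ` L \<subseteq> actions Y"
  shows "weak_ts (pull_actions Y L g)"
proof (rule weak_tsI)
  fix \<alpha> us vs \<beta> assume t: "(\<alpha>, us, \<beta>) \<in> transitions (pull_actions Y L g)" "mset vs = mset us"
  then have "(\<alpha>, map g vs, \<beta>) \<in> transitions Y"
    using weak_ts_mset[OF assms(1), of \<alpha> "map g us" \<beta> "map g vs"] by simp
  then show "(\<alpha>, vs, \<beta>) \<in> transitions (pull_actions Y L g)"
    using t mset_eq_setD[OF t(2)] by auto
next
  fix \<alpha> \<beta> \<nu>1 \<nu>2 us vs ws
  assume "us \<noteq> []" "vs \<noteq> []" "ws \<noteq> []"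
    "(\<alpha>, us @ vs @ ws, \<beta>) \<in> transitions (pull_actions Y L g)"
    "(\<alpha>, us, \<nu>1) \<in> transitions (pull_actions Y L g)"
    "(\<nu>1, vs @ ws, \<beta>) \<in> transitions (pull_actions Y L g)"
    "(\<alpha>, us @ vs, \<nu>2) \<in> transitions (pull_actions Y L g)"
    "(\<nu>2, ws, \<beta>) \<in> transitions (pull_actions Y L g)"
  then show "(\<nu>1, vs, \<nu>2) \<in> transitions (pull_actions Y L g)"
    using weak_ts_patch[OF assms(1), of "map g us" "map g vs" "map g ws" \<alpha> \<beta> \<nu>1 \<nu>2] by simp
qed (use weak_tsD[OF assms(1)] in fastforce)

lemma cubical_pull_actions:
  assumes "cubical_ts Y" "g ` L \<subseteq> actions Y"
  shows "cubical_ts (pull_actions Y L g)"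
proof (rule cubical_tsI)
  fix u assume "u \<in> actions (pull_actions Y L g)"
  moreover from this have "g u \<in> actions Y" using assms(2) by auto
  then obtain \<alpha> \<beta> where "(\<alpha>, [g u], \<beta>) \<in> transitions Y" by (rule cubical_ts_used[OF assms(1)])
  ultimately show "\<exists>\<alpha> \<beta>. (\<alpha>, [u], \<beta>) \<in> transitions (pull_actions Y L g)" by auto
next
  fix \<alpha> \<beta> xs ys
  assume t: "(\<alpha>, xs @ ys, \<beta>) \<in> transitions (pull_actions Y L g)" "xs \<noteq> []" "ys \<noteq> []"
  then have "(\<alpha>, map g xs @ map g ys, \<beta>) \<in> transitions Y" by simp
  then obtain \<nu> where "(\<alpha>, map g xs, \<nu>) \<in> transitions Y" "(\<nu>, map g ys, \<beta>) \<in> transitions Y"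
    by (rule cubical_ts_split[OF assms(1) _ refl]) (use t(2,3) in auto)
  then show "\<exists>\<nu>. (\<alpha>, xs, \<nu>) \<in> transitions (pull_actions Y L g) \<and>
      (\<nu>, ys, \<beta>) \<in> transitions (pull_actions Y L g)"
    using t(1) by auto
qed (use weak_ts_pull_actions cubical_ts_weak assms in auto)

lemma ts_map_to_pull_actions:
  assumes "weak_ts X" "f \<in> states X \<rightarrow> states Y" "k \<in> actions X \<rightarrow> L"
    and "ts_map X Y f (\<lambda>u. g (k u))"
  shows "ts_map X (pull_actions Y L g) f k"
proof (rule ts_mapI)
  fix \<alpha> us \<beta> assume t: "(\<alpha>, us, \<beta>) \<in> transitions X"
  show "(f \<alpha>, map k us, f \<beta>) \<in> transitions (pull_actions Y L g)"
    using ts_mapD(4)[OF assms(4) t] weak_tsD(4)[OF assms(1) t] assms(3) by (auto simp: comp_def)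
qed (use ts_mapD[OF assms(4)] assms in auto)

lemma ts_map_pull_actions: "g ` L \<subseteq> actions Y \<Longrightarrow> ts_map (pull_actions Y L g) Y id g"
  by (rule ts_mapI) auto

text \<open>The right adjoint of the inclusion of cubical into weak transition systems. Requiring one
  intermediate state for each splitting of a transition into two parts is enough: by the
  composition axiom, the two parts then have intermediate states as well.\<close>

definition cubical_core :: "('s, 'l, 'x) ts \<Rightarrow> ('s, 'l, 'x) ts" where
  "cubical_core X =
     \<lparr>states = states X,
      actions = {u \<in> actions X. \<exists>\<alpha> \<beta>. (\<alpha>, [u], \<beta>) \<in> transitions X},
      lab = lab X,
      transitions = {(\<alpha>, us, \<beta>) \<in> transitions X.
        \<forall>xs ys. mset (xs @ ys) = mset us \<and> xs \<noteq> [] \<and> ys \<noteq> [] \<longrightarrow>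
          (\<exists>\<nu>. (\<alpha>, xs, \<nu>) \<in> transitions X \<and> (\<nu>, ys, \<beta>) \<in> transitions X)}\<rparr>"

lemma cubical_core_simps [simp]:
  "states (cubical_core X) = states X"
  "actions (cubical_core X) = {u \<in> actions X. \<exists>\<alpha> \<beta>. (\<alpha>, [u], \<beta>) \<in> transitions X}"
  "lab (cubical_core X) = lab X"
  by (auto simp: cubical_core_def)

lemma cubical_core_transI:
  assumes "(\<alpha>, us, \<beta>) \<in> transitions X"
    and "\<And>xs ys. mset (xs @ ys) = mset us \<Longrightarrow> xs \<noteq> [] \<Longrightarrow> ys \<noteq> [] \<Longrightarrow>
      \<exists>\<nu>. (\<alpha>, xs, \<nu>) \<in> transitions X \<and> (\<nu>, ys, \<beta>) \<in> transitions X"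
  shows "(\<alpha>, us, \<beta>) \<in> transitions (cubical_core X)"
  using assms unfolding cubical_core_def by auto

lemma cubical_core_transD:
  assumes "(\<alpha>, us, \<beta>) \<in> transitions (cubical_core X)"
  shows "(\<alpha>, us, \<beta>) \<in> transitions X"
  using assms unfolding cubical_core_def by auto

lemma cubical_core_split:
  assumes "(\<alpha>, us, \<beta>) \<in> transitions (cubical_core X)"
    and "mset (xs @ ys) = mset us" "xs \<noteq> []" "ys \<noteq> []"
  obtains \<nu> where "(\<alpha>, xs, \<nu>) \<in> transitions X" "(\<nu>, ys, \<beta>) \<in> transitions X"
  using assms unfolding cubical_core_def by auto

lemma singleton_not_split: "mset (xs @ ys) = mset [u] \<Longrightarrow> xs = [] \<or> ys = []"
proof -
  assume "mset (xs @ ys) = mset [u]"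
  then have "length (xs @ ys) = 1" by (metis length_Cons list.size(3) One_nat_def size_mset)
  then show ?thesis by (cases xs; cases ys) auto
qed

lemma cubical_cubical_core:
  assumes w: "weak_ts X"
  shows "cubical_ts (cubical_core X)"
proof -
  let ?Y = "cubical_core X"
  \<comment> \<open>Any intermediate state of \<open>X\<close> will do. To split the part
    \<open>xs\<close>, the whole transition is split after \<open>xs1\<close>; the composition axiom
    then supplies the missing middle piece from the new state to \<open>\<nu>\<close>. The part
    \<open>ys\<close> is symmetric.\<close>
  have step: "(\<alpha>, xs, \<nu>) \<in> transitions ?Y \<and> (\<nu>, ys, \<beta>) \<in> transitions ?Y"
    if t: "(\<alpha>, us, \<beta>) \<in> transitions ?Y" "mset (xs @ ys) = mset us" "xs \<noteq> []" "ys \<noteq> []"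
      and n: "(\<alpha>, xs, \<nu>) \<in> transitions X" "(\<nu>, ys, \<beta>) \<in> transitions X" for \<alpha> us \<beta> xs ys \<nu>
  proof (intro conjI cubical_core_transI n)
    fix xs1 xs2 assume s: "mset (xs1 @ xs2) = mset xs" "xs1 \<noteq> []" "xs2 \<noteq> []"
    have m: "mset (xs1 @ xs2 @ ys) = mset us" using s t(2) by (metis append.assoc mset_append)
    then obtain \<nu>' where v: "(\<alpha>, xs1, \<nu>') \<in> transitions X" "(\<nu>', xs2 @ ys, \<beta>) \<in> transitions X"
      using cubical_core_split[OF t(1), of xs1 "xs2 @ ys"] s by auto
    have "(\<nu>', xs2, \<nu>) \<in> transitions X"
      using weak_ts_patch[OF w s(2,3) t(4) _ v(1,2) _ n(2)] weak_ts_mset[OF w]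
        cubical_core_transD[OF t(1)] m n(1) s(1) by metis
    with v show "\<exists>\<nu>'. (\<alpha>, xs1, \<nu>') \<in> transitions X \<and> (\<nu>', xs2, \<nu>) \<in> transitions X" by auto
  next
    fix ys1 ys2 assume s: "mset (ys1 @ ys2) = mset ys" "ys1 \<noteq> []" "ys2 \<noteq> []"
    have m: "mset (xs @ ys1 @ ys2) = mset us" using s t(2) by simp
    then obtain \<nu>' where v: "(\<alpha>, xs @ ys1, \<nu>') \<in> transitions X" "(\<nu>', ys2, \<beta>) \<in> transitions X"
      using cubical_core_split[OF t(1), of "xs @ ys1" ys2] s by auto
    have "(\<nu>, ys1, \<nu>') \<in> transitions X"
      using weak_ts_patch[OF w t(3) s(2,3) _ n(1) _ v] weak_ts_mset[OF w]
        cubical_core_transD[OF t(1)] m n(2) s(1) by metis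
    with v show "\<exists>\<nu>'. (\<nu>, ys1, \<nu>') \<in> transitions X \<and> (\<nu>', ys2, \<beta>) \<in> transitions X" by auto
  qed
  have single: "(\<alpha>, [u], \<beta>) \<in> transitions ?Y" if "(\<alpha>, [u], \<beta>) \<in> transitions X" for \<alpha> u \<beta>
    using that by (rule cubical_core_transI) (blast dest: singleton_not_split)
  show ?thesis
  proof (rule cubical_tsI[OF weak_tsI])
    fix \<alpha> us \<beta> assume t: "(\<alpha>, us, \<beta>) \<in> transitions ?Y"
    note t' = cubical_core_transD[OF t]
    \<comment> \<open>Splitting off \<open>[u]\<close> shows that \<open>u\<close> labels a
      1-transition; if nothing else remains, the transition is itself that 1-transition.\<close>
    have "u \<in> actions ?Y" if "u \<in> set us" for u
    proof -
      have "\<exists>\<nu>. (\<alpha>, [u], \<nu>) \<in> transitions X"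
      proof (cases "remove1 u us = []")
        case True
        then have "us = [u]" using that by (cases us) (auto split: if_splits)
        then show ?thesis using t' by auto
      next
        case False
        have "mset ([u] @ remove1 u us) = mset us" using that by simp
        then show ?thesis using cubical_core_split[OF t _ _ False, of "[u]"] by blast
      qed
      then show ?thesis using weak_tsD[OF w t'] that by auto
    qed
    then show "\<alpha> \<in> states ?Y \<and> \<beta> \<in> states ?Y \<and> us \<noteq> [] \<and> set us \<subseteq> actions ?Y"
      using weak_tsD[OF w t'] by auto
  next
    fix \<alpha> us vs \<beta> assume "(\<alpha>, us, \<beta>) \<in> transitions ?Y" "mset vs = mset us"
    then show "(\<alpha>, vs, \<beta>) \<in> transitions ?Y"
      using weak_ts_mset[OF w, of \<alpha> us \<beta> vs] unfolding cubical_core_def by auto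
  next
    fix \<alpha> \<beta> \<nu>1 \<nu>2 us vs ws
    assume ne: "us \<noteq> []" "vs \<noteq> []" "ws \<noteq> []" and t: "(\<alpha>, us @ vs @ ws, \<beta>) \<in> transitions ?Y"
      "(\<alpha>, us, \<nu>1) \<in> transitions ?Y" "(\<nu>1, vs @ ws, \<beta>) \<in> transitions ?Y"
      "(\<alpha>, us @ vs, \<nu>2) \<in> transitions ?Y" "(\<nu>2, ws, \<beta>) \<in> transitions ?Y"
    have "(\<nu>1, vs, \<nu>2) \<in> transitions X"
      using weak_ts_patch[OF w ne] t[THEN cubical_core_transD] by blast
    then show "(\<nu>1, vs, \<nu>2) \<in> transitions ?Y"
      using step[OF t(3) refl ne(2,3)] t(5)[THEN cubical_core_transD] by blast
  next
    fix u assume "u \<in> actions ?Y"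
    then show "\<exists>\<alpha> \<beta>. (\<alpha>, [u], \<beta>) \<in> transitions ?Y" using single by fastforce
  next
    fix \<alpha> \<beta> xs ys
    assume "(\<alpha>, xs @ ys, \<beta>) \<in> transitions ?Y" "xs \<noteq> []" "ys \<noteq> []"
    then show "\<exists>\<nu>. (\<alpha>, xs, \<nu>) \<in> transitions ?Y \<and> (\<nu>, ys, \<beta>) \<in> transitions ?Y"
      using step[of \<alpha> "xs @ ys" \<beta> xs ys] cubical_core_split[of \<alpha> "xs @ ys" \<beta> X xs ys] by metis
  qed
qed

lemma mset_map_lift:
  assumes "mset (map f us) = mset zs"
  obtains us' where "mset us' = mset us" "map f us' = zs"
proof -
  obtain p where p: "p permutes {..<length (map f us)}" "permute_list p (map f us) = zs"
    using mset_eq_permutation[OF assms[symmetric]] by auto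
  then have "map f (permute_list p us) = zs" using permute_list_map[of p us f] by simp
  moreover have "mset (permute_list p us) = mset us" using p(1) by simp
  ultimately show ?thesis using that by blast
qed

lemma cubical_split_map:
  assumes c: "cubical_ts B" and f: "ts_map B X f g" and t: "(\<alpha>, us, \<beta>) \<in> transitions B"
    and m: "mset (xs @ ys) = mset (map g us)" "xs \<noteq> []" "ys \<noteq> []"
  obtains \<nu> where "(f \<alpha>, xs, \<nu>) \<in> transitions X" "(\<nu>, ys, f \<beta>) \<in> transitions X"
proof -
  obtain us' where us': "mset us' = mset us" "map g us' = xs @ ys"
    using mset_map_lift[OF m(1)[symmetric]] .
  then obtain xs' ys' where e: "us' = xs' @ ys'" "map g xs' = xs" "map g ys' = ys"
    by (auto simp: map_eq_append_conv)
  then obtain \<nu> where "(\<alpha>, xs', \<nu>) \<in> transitions B" "(\<nu>, ys', \<beta>) \<in> transitions B"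
    using cubical_ts_split[OF c t, of xs' ys'] us' m by auto
  then show ?thesis using that ts_mapD(4)[OF f] e by metis
qed

text \<open>Universal property of the coreflection: in \<open>B\<close> every action is used and
  every transition splits, and the map carries these witnesses to \<open>X\<close>.\<close>

lemma ts_map_to_cubical_core:
  assumes c: "cubical_ts B" and f: "ts_map B X f g"
  shows "ts_map B (cubical_core X) f g"
proof (rule ts_mapI)
  fix u assume u: "u \<in> actions B"
  obtain \<alpha> \<beta> where "(\<alpha>, [u], \<beta>) \<in> transitions B" using cubical_ts_used[OF c u] .
  then have "(f \<alpha>, [g u], f \<beta>) \<in> transitions X" using ts_mapD(4)[OF f] by fastforce
  then show "g u \<in> actions (cubical_core X)" using ts_mapD(2)[OF f u] by auto
next
  fix \<alpha> us \<beta> assume t: "(\<alpha>, us, \<beta>) \<in> transitions B"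
  show "(f \<alpha>, map g us, f \<beta>) \<in> transitions (cubical_core X)"
    using cubical_split_map[OF c f t] ts_mapD(4)[OF f t] by (intro cubical_core_transI) metis+
qed (use ts_mapD[OF f] in auto)

lemma ts_map_from_cubical_core: "ts_map (cubical_core X) X id id"
  by (rule ts_mapI) (auto dest: cubical_core_transD)


section \<open>The category of cubical transition systems\<close>

lemma CTS_simps [simp]: "Obj CTS = cts_objects" "Dom CTS = src" "Cod CTS = tgt"
  by (auto simp: CTS_def)

lemma CTS_in_hom_iff:
  "in_hom CTS f X Y \<longleftrightarrow> src f = X \<and> tgt f = Y \<and> X \<in> cts_objects \<and> Y \<in> cts_objects \<and>
     ts_map X Y (st f) (act f) \<and> st f \<in> extensional (states X) \<and> act f \<in> extensional (actions X)"
  by (auto simp: in_hom_def CTS_def)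

lemma CTS_arr_hom: "f \<in> Arr CTS \<longleftrightarrow> in_hom CTS f (src f) (tgt f)"
  by (simp add: in_hom_def)

lemma CTS_homD:
  assumes "in_hom CTS f X Y"
  shows "f \<in> Arr CTS" "src f = X" "tgt f = Y" "X \<in> cts_objects" "Y \<in> cts_objects"
    "ts_map X Y (st f) (act f)" "cubical_ts X" "cubical_ts Y" "weak_ts X" "weak_ts Y"
  using assms by (auto simp: CTS_in_hom_iff cts_objects_def cubical_ts_weak in_hom_def CTS_def)

lemma cts_objectsD: "X \<in> cts_objects \<Longrightarrow> cubical_ts X" "X \<in> cts_objects \<Longrightarrow> weak_ts X"
  "X \<in> cts_objects \<Longrightarrow> small (states X)" "X \<in> cts_objects \<Longrightarrow> small (actions X)"
  by (auto simp: cts_objects_def cubical_ts_weak)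

lemma cts_objectsI: "cubical_ts X \<Longrightarrow> small (states X) \<Longrightarrow> small (actions X) \<Longrightarrow> X \<in> cts_objects"
  by (auto simp: cts_objects_def)

lemma CTS_eqI:
  assumes "in_hom CTS f X Y" "in_hom CTS g X Y"
    and "\<And>s. s \<in> states X \<Longrightarrow> st f s = st g s" "\<And>u. u \<in> actions X \<Longrightarrow> act f u = act g u"
  shows "f = g"
proof -
  have "st f = st g" "act f = act g"
    using assms by (auto simp: CTS_in_hom_iff intro: extensionalityI)
  then show ?thesis using assms(1,2) by (auto simp: CTS_in_hom_iff)
qed

definition arrow ::
  "('u, 'u, 'x) ts \<Rightarrow> ('u, 'u, 'x) ts \<Rightarrow> ('u \<Rightarrow> 'u) \<Rightarrow> ('u \<Rightarrow> 'u) \<Rightarrow> ('u, 'x) ts_arrow" where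
  "arrow X Y f g = \<lparr>src = X, tgt = Y, st = restrict f (states X), act = restrict g (actions X)\<rparr>"

lemma arrow_simps [simp]:
  "src (arrow X Y f g) = X" "tgt (arrow X Y f g) = Y"
  "s \<in> states X \<Longrightarrow> st (arrow X Y f g) s = f s"
  "u \<in> actions X \<Longrightarrow> act (arrow X Y f g) u = g u"
  by (auto simp: arrow_def)

lemma arrow_in_hom:
  assumes "X \<in> cts_objects" "Y \<in> cts_objects" "ts_map X Y f g"
  shows "in_hom CTS (arrow X Y f g) X Y"
  using assms ts_map_cong[OF assms(3), of "st (arrow X Y f g)" "act (arrow X Y f g)"]
  by (auto simp: CTS_in_hom_iff cts_objectsD) (auto simp: arrow_def)

lemma CTS_comp_simps [simp]:
  "src (Comp CTS g f) = src f" "tgt (Comp CTS g f) = tgt g"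
  "s \<in> states (src f) \<Longrightarrow> st (Comp CTS g f) s = st g (st f s)"
  "u \<in> actions (src f) \<Longrightarrow> act (Comp CTS g f) u = act g (act f u)"
  by (auto simp: CTS_def compose_def)

lemma CTS_st_act [simp]:
  assumes "in_hom CTS f X Y"
  shows "s \<in> states X \<Longrightarrow> st f s \<in> states Y" "u \<in> actions X \<Longrightarrow> act f u \<in> actions Y"
    "u \<in> actions X \<Longrightarrow> lab Y (act f u) = lab X u"
  using ts_mapD[OF CTS_homD(6)[OF assms]] by auto

lemma CTS_trans:
  assumes "in_hom CTS f X Y" "(\<alpha>, us, \<beta>) \<in> transitions X"
  shows "(st f \<alpha>, map (act f) us, st f \<beta>) \<in> transitions Y"
  using ts_mapD[OF CTS_homD(6)[OF assms(1)]] assms by auto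

lemma CTS_comp_in_hom:
  assumes "in_hom CTS f X Y" "in_hom CTS g Y Z"
  shows "in_hom CTS (Comp CTS g f) X Z"
proof -
  have "ts_map X Z (st (Comp CTS g f)) (act (Comp CTS g f))"
    by (rule ts_map_cong[OF ts_map_comp[OF CTS_homD(6)[OF assms(1)] CTS_homD(6)[OF assms(2)]]])
      (use CTS_homD[OF assms(1)] in auto)
  then show ?thesis using CTS_homD[OF assms(1)] CTS_homD[OF assms(2)]
    by (auto simp: CTS_in_hom_iff) (auto simp: CTS_def)
qed

lemma CTS_ident_simps [simp]:
  "s \<in> states X \<Longrightarrow> st (Ident CTS X) s = s" "u \<in> actions X \<Longrightarrow> act (Ident CTS X) u = u"
  by (auto simp: CTS_def)

lemma ts_map_id: "ts_map X X (\<lambda>s. s) (\<lambda>u. u)"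
  by (rule ts_mapI) auto

lemma CTS_ident_in_hom: "X \<in> cts_objects \<Longrightarrow> in_hom CTS (Ident CTS X) X X"
  using arrow_in_hom[of X X id id] ts_map_id[of X] by (simp add: arrow_def CTS_def id_def)

interpretation CTS: category CTS
proof
  fix f g h and X Y Z V :: "('u, 'u, 'x) ts"
  show "Comp CTS h (Comp CTS g f) = Comp CTS (Comp CTS h g) f"
    if "in_hom CTS f X Y" "in_hom CTS g Y Z" "in_hom CTS h Z V"
    using that by (intro CTS_eqI[of _ X V]) (auto intro!: CTS_comp_in_hom simp: CTS_homD)
  show "Comp CTS (Ident CTS Y) f = f" if "in_hom CTS f X Y"
    using that by (intro CTS_eqI[of _ X Y])
      (auto intro!: CTS_comp_in_hom CTS_ident_in_hom simp: CTS_homD)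
  show "Comp CTS f (Ident CTS X) = f" if "in_hom CTS f X Y"
    using that CTS_homD(2)[OF CTS_ident_in_hom[of X]] CTS_homD[OF that] by (intro CTS_eqI[of _ X Y])
      (auto intro!: CTS_comp_in_hom CTS_ident_in_hom)
qed (auto intro: CTS_comp_in_hom CTS_ident_in_hom simp: CTS_homD)


section \<open>Copies\<close>

text \<open>Transport of structure along injections. It brings cubes, boundaries and double
  transitions, whose states and actions have types of their own, into the universe
  \<open>'u\<close>.\<close>

definition image_ts ::
  "('s, 'l, 'x) ts \<Rightarrow> ('s \<Rightarrow> 't) \<Rightarrow> ('l \<Rightarrow> 'k) \<Rightarrow> ('t, 'k, 'x) ts" where
  "image_ts X f g =
     \<lparr>states = f ` states X, actions = g ` actions X,
      lab = (\<lambda>v. lab X (inv_into (actions X) g v)),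
      transitions = (\<lambda>(\<alpha>, us, \<beta>). (f \<alpha>, map g us, f \<beta>)) ` transitions X\<rparr>"

lemma image_ts_simps [simp]:
  "states (image_ts X f g) = f ` states X"
  "actions (image_ts X f g) = g ` actions X"
  by (auto simp: image_ts_def)

lemma ts_iso_image_ts:
  assumes w: "weak_ts X" and f: "inj_on f (states X)" and g: "inj_on g (actions X)"
  shows "ts_iso X (image_ts X f g) f g"
  unfolding ts_iso_def
proof (intro conjI exI)
  show "ts_map X (image_ts X f g) f g"
    by (rule ts_mapI) (auto simp: image_ts_def g image_iff intro!: bexI)
  show "ts_map (image_ts X f g) X (inv_into (states X) f) (inv_into (actions X) g)"
  proof (rule ts_mapI)
    fix \<alpha>' us' \<beta>' assume "(\<alpha>', us', \<beta>') \<in> transitions (image_ts X f g)"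
    then obtain \<alpha> us \<beta> where t: "(\<alpha>, us, \<beta>) \<in> transitions X"
      and e: "\<alpha>' = f \<alpha>" "us' = map g us" "\<beta>' = f \<beta>"
      by (auto simp: image_ts_def)
    have "map (inv_into (actions X) g) us' = us"
      unfolding e map_map by (rule map_idI) (use weak_tsD(4)[OF w t] g in auto)
    then show "(inv_into (states X) f \<alpha>', map (inv_into (actions X) g) us',
        inv_into (states X) f \<beta>') \<in> transitions X"
      using t weak_tsD[OF w t] f by (simp add: e(1,3))
  qed (auto simp: image_ts_def inv_into_into f_inv_into_f)
qed (auto simp: f g f_inv_into_f)

text \<open>\<open>ts_iso\<close> controls \<open>Y\<close> only on its states and actions. It does
  not exclude transitions that leave them, hence the assumption \<open>wf\<close>.\<close>

lemma ts_iso_cubical: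
  assumes c: "cubical_ts X" and w: "ts_iso X Y f g"
    and wf: "\<And>\<alpha> us \<beta>. (\<alpha>, us, \<beta>) \<in> transitions Y \<Longrightarrow> \<alpha> \<in> states Y \<and> \<beta> \<in> states Y \<and> set us \<subseteq> actions Y"
  shows "cubical_ts Y"
proof -
  obtain f' g' where m: "ts_map X Y f g" and m': "ts_map Y X f' g'"
    and fg: "\<And>t. t \<in> states Y \<Longrightarrow> f (f' t) = t" "\<And>v. v \<in> actions Y \<Longrightarrow> g (g' v) = v"
    using w unfolding ts_iso_def by blast
  have gg: "map g (map g' vs) = vs" if "set vs \<subseteq> actions Y" for vs
    unfolding map_map by (rule map_idI) (use that fg in auto)
  note push = ts_mapD(4)[OF m]
  note pull = ts_mapD(4)[OF m']
  have reflects: "(\<alpha>, vs, \<beta>) \<in> transitions Y" if "(f' \<alpha>, map g' vs, f' \<beta>) \<in> transitions X"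
    "\<alpha> \<in> states Y" "\<beta> \<in> states Y" "set vs \<subseteq> actions Y" for \<alpha> vs \<beta>
    using push[OF that(1)] gg[OF that(4)] fg that(2,3) by simp
  show ?thesis
  proof (rule cubical_tsI[OF weak_tsI])
    fix \<alpha> us \<beta> assume t: "(\<alpha>, us, \<beta>) \<in> transitions Y"
    then show "\<alpha> \<in> states Y \<and> \<beta> \<in> states Y \<and> us \<noteq> [] \<and> set us \<subseteq> actions Y"
      using wf[OF t] weak_tsD(3)[OF cubical_ts_weak[OF c] pull[OF t]] by auto
  next
    fix \<alpha> us vs \<beta> assume t: "(\<alpha>, us, \<beta>) \<in> transitions Y" "mset vs = mset us"
    have "(f' \<alpha>, map g' vs, f' \<beta>) \<in> transitions X"
      by (rule weak_ts_mset[OF cubical_ts_weak[OF c] pull[OF t(1)]]) (simp add: t(2))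
    then show "(\<alpha>, vs, \<beta>) \<in> transitions Y"
      by (rule reflects) (use wf[OF t(1)] mset_eq_setD[OF t(2)] in auto)
  next
    fix \<alpha> \<beta> \<nu>1 \<nu>2 us vs ws
    assume ne: "us \<noteq> []" "vs \<noteq> []" "ws \<noteq> []"
      and t: "(\<alpha>, us @ vs @ ws, \<beta>) \<in> transitions Y"
      "(\<alpha>, us, \<nu>1) \<in> transitions Y" "(\<nu>1, vs @ ws, \<beta>) \<in> transitions Y"
      "(\<alpha>, us @ vs, \<nu>2) \<in> transitions Y" "(\<nu>2, ws, \<beta>) \<in> transitions Y"
    have "(f' \<nu>1, map g' vs, f' \<nu>2) \<in> transitions X"
      by (rule weak_ts_patch[OF cubical_ts_weak[OF c], of "map g' us" "map g' vs" "map g' ws" "f' \<alpha>" "f' \<beta>"])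
        (use ne t[THEN pull] in auto)
    then show "(\<nu>1, vs, \<nu>2) \<in> transitions Y"
      by (rule reflects) (use wf[OF t(3)] wf[OF t(4)] in auto)
  next
    fix u assume u: "u \<in> actions Y"
    then have "g' u \<in> actions X" using ts_mapD(2)[OF m'] by auto
    then obtain \<alpha> \<beta> where "(\<alpha>, [g' u], \<beta>) \<in> transitions X" by (rule cubical_ts_used[OF c])
    from push[OF this] show "\<exists>\<alpha> \<beta>. (\<alpha>, [u], \<beta>) \<in> transitions Y" using fg(2)[OF u] by auto
  next
    fix \<alpha> \<beta> xs ys assume t: "(\<alpha>, xs @ ys, \<beta>) \<in> transitions Y" "xs \<noteq> []" "ys \<noteq> []"
    have "(f' \<alpha>, map g' xs @ map g' ys, f' \<beta>) \<in> transitions X" using pull[OF t(1)] by simp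
    then obtain \<nu> where "(f' \<alpha>, map g' xs, \<nu>) \<in> transitions X" "(\<nu>, map g' ys, f' \<beta>) \<in> transitions X"
      by (rule cubical_ts_split[OF c _ refl]) (use t(2,3) in auto)
    from this[THEN push] show "\<exists>\<nu>. (\<alpha>, xs, \<nu>) \<in> transitions Y \<and> (\<nu>, ys, \<beta>) \<in> transitions Y"
      using wf[OF t(1)] gg[of xs] gg[of ys] fg(1) by auto
  qed
qed

lemma cubical_image_ts:
  assumes "cubical_ts X" "inj_on f (states X)" "inj_on g (actions X)"
  shows "cubical_ts (image_ts X f g)"
proof (rule ts_iso_cubical[OF assms(1) ts_iso_image_ts[OF cubical_ts_weak[OF assms(1)] assms(2,3)]])
  fix \<alpha> us \<beta> assume "(\<alpha>, us, \<beta>) \<in> transitions (image_ts X f g)"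
  then show "\<alpha> \<in> states (image_ts X f g) \<and> \<beta> \<in> states (image_ts X f g) \<and> set us \<subseteq> actions (image_ts X f g)"
    using weak_tsD[OF cubical_ts_weak[OF assms(1)]] by (fastforce simp: image_ts_def)
qed

lemma ts_iso_ts_map_left:
  assumes "ts_iso X Y f g" "weak_ts Y" "ts_map X Z (\<lambda>s. f' (f s)) (\<lambda>u. g' (g u))"
  shows "ts_map Y Z f' g'"
proof -
  obtain h k where m': "ts_map Y X h k"
    and fg: "\<And>t. t \<in> states Y \<Longrightarrow> f (h t) = t" "\<And>v. v \<in> actions Y \<Longrightarrow> g (k v) = v"
    using assms(1) unfolding ts_iso_def by blast
  show ?thesis
    by (rule ts_map_cong[OF ts_map_comp[OF m' assms(3)] assms(2)]) (auto simp: fg)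
qed


section \<open>Reflection to transition systems with injective labelling\<close>

text \<open>Identifying actions can break the composition axiom: transitions that had different
  actions before may afterwards fit together as its premises. The quotient therefore has to be
  closed under the axioms of a weak transition system.\<close>

inductive_set ts_closure :: "('s \<times> 'l list \<times> 's) set \<Rightarrow> ('s \<times> 'l list \<times> 's) set"
  for T where
    base: "t \<in> T \<Longrightarrow> t \<in> ts_closure T"
  | perm: "(\<alpha>, us, \<beta>) \<in> ts_closure T \<Longrightarrow> mset vs = mset us \<Longrightarrow> (\<alpha>, vs, \<beta>) \<in> ts_closure T"
  | patch: "us \<noteq> [] \<Longrightarrow> vs \<noteq> [] \<Longrightarrow> ws \<noteq> [] \<Longrightarrow> (\<alpha>, us @ vs @ ws, \<beta>) \<in> ts_closure T \<Longrightarrow>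
      (\<alpha>, us, \<nu>1) \<in> ts_closure T \<Longrightarrow> (\<nu>1, vs @ ws, \<beta>) \<in> ts_closure T \<Longrightarrow>
      (\<alpha>, us @ vs, \<nu>2) \<in> ts_closure T \<Longrightarrow> (\<nu>2, ws, \<beta>) \<in> ts_closure T \<Longrightarrow>
      (\<nu>1, vs, \<nu>2) \<in> ts_closure T"

lemma ts_closure_wf:
  assumes "\<And>\<alpha> us \<beta>. (\<alpha>, us, \<beta>) \<in> T \<Longrightarrow> \<alpha> \<in> S \<and> \<beta> \<in> S \<and> us \<noteq> [] \<and> set us \<subseteq> L"
    and "(\<alpha>, us, \<beta>) \<in> ts_closure T"
  shows "\<alpha> \<in> S \<and> \<beta> \<in> S \<and> us \<noteq> [] \<and> set us \<subseteq> L"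
proof -
  have "(\<lambda>(\<alpha>, us, \<beta>). \<alpha> \<in> S \<and> \<beta> \<in> S \<and> us \<noteq> [] \<and> set us \<subseteq> L) t" if "t \<in> ts_closure T" for t
    using that
  proof (induction rule: ts_closure.induct)
    case (perm \<alpha> us \<beta> vs)
    then show ?case using mset_eq_setD[OF perm(2)] by auto
  qed (use assms(1) in auto)
  then show ?thesis using assms(2) by blast
qed

lemma ts_closure_map:
  assumes w: "weak_ts Y" and T: "\<And>\<alpha> us \<beta>. (\<alpha>, us, \<beta>) \<in> T \<Longrightarrow> (f \<alpha>, map g us, f \<beta>) \<in> transitions Y"
    and t: "(\<alpha>, us, \<beta>) \<in> ts_closure T"
  shows "(f \<alpha>, map g us, f \<beta>) \<in> transitions Y"
proof -
  have "(\<lambda>(\<alpha>, us, \<beta>). (f \<alpha>, map g us, f \<beta>) \<in> transitions Y) t" if "t \<in> ts_closure T" for t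
    using that
  proof (induction rule: ts_closure.induct)
    case (perm \<alpha> us \<beta> vs)
    then show ?case using weak_ts_mset[OF w, of "f \<alpha>" "map g us" "f \<beta>" "map g vs"] by simp
  next
    case (patch us vs ws \<alpha> \<beta> \<nu>1 \<nu>2)
    then show ?case
      using weak_ts_patch[OF w, of "map g us" "map g vs" "map g ws" "f \<alpha>" "f \<beta>" "f \<nu>1" "f \<nu>2"] by simp
  qed (use T in auto)
  then show ?thesis using t by blast
qed

text \<open>The composition rule creates no transition without intermediate states. To split
  \<open>vs\<close> into \<open>xs\<close> and \<open>ys\<close>, split the long transition
  \<open>us @ vs @ ws\<close> after \<open>us @ xs\<close>; two further uses of the composition rule
  connect the state obtained with \<open>\<nu>1\<close> and \<open>\<nu>2\<close>.\<close>

lemma ts_closure_split: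
  assumes T: "\<And>\<alpha> us \<beta> xs ys. (\<alpha>, us, \<beta>) \<in> T \<Longrightarrow> mset (xs @ ys) = mset us \<Longrightarrow> xs \<noteq> [] \<Longrightarrow> ys \<noteq> [] \<Longrightarrow>
      \<exists>\<nu>. (\<alpha>, xs, \<nu>) \<in> T \<and> (\<nu>, ys, \<beta>) \<in> T"
    and t: "(\<alpha>, us, \<beta>) \<in> ts_closure T" and m: "mset (xs @ ys) = mset us" "xs \<noteq> []" "ys \<noteq> []"
  shows "\<exists>\<nu>. (\<alpha>, xs, \<nu>) \<in> ts_closure T \<and> (\<nu>, ys, \<beta>) \<in> ts_closure T"
proof -
  have "(\<lambda>(\<alpha>, us, \<beta>). \<forall>xs ys. mset (xs @ ys) = mset us \<longrightarrow> xs \<noteq> [] \<longrightarrow> ys \<noteq> [] \<longrightarrow>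
      (\<exists>\<nu>. (\<alpha>, xs, \<nu>) \<in> ts_closure T \<and> (\<nu>, ys, \<beta>) \<in> ts_closure T)) t" if "t \<in> ts_closure T" for t
    using that
  proof (induction rule: ts_closure.induct)
    case (base t)
    obtain \<alpha> us \<beta> where t: "t = (\<alpha>, us, \<beta>)" by (cases t)
    show ?case unfolding t prod.case
    proof (intro allI impI)
      fix xs ys assume "mset (xs @ ys) = mset us" "xs \<noteq> []" "ys \<noteq> []"
      with base T[of \<alpha> us \<beta> xs ys] show
        "\<exists>\<nu>. (\<alpha>, xs, \<nu>) \<in> ts_closure T \<and> (\<nu>, ys, \<beta>) \<in> ts_closure T"
        unfolding t by (meson ts_closure.base)
    qed
  next
    case (perm \<alpha> us \<beta> vs)
    then show ?case by simp
  next
    case (patch us vs ws \<alpha> \<beta> \<nu>1 \<nu>2)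
    show ?case
    proof (clarify)
      fix xs ys assume m: "mset (xs @ ys) = mset vs" "xs \<noteq> []" "ys \<noteq> []"
      have "mset ((us @ xs) @ (ys @ ws)) = mset (us @ vs @ ws)" using m(1) by simp
      from patch.IH(1)[unfolded prod.case, rule_format, OF this]
      obtain \<nu> where n: "(\<alpha>, us @ xs, \<nu>) \<in> ts_closure T" "(\<nu>, ys @ ws, \<beta>) \<in> ts_closure T"
        using patch.hyps(1) m(3) by auto
      have p: "(\<alpha>, us @ xs @ ys @ ws, \<beta>) \<in> ts_closure T" "(\<nu>1, xs @ ys @ ws, \<beta>) \<in> ts_closure T"
        "(\<alpha>, (us @ xs) @ ys @ ws, \<beta>) \<in> ts_closure T" "(\<alpha>, (us @ xs) @ ys, \<nu>2) \<in> ts_closure T"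
        using m(1) patch.hyps by (auto intro: ts_closure.perm)
      have "(\<nu>1, xs, \<nu>) \<in> ts_closure T"
        using ts_closure.patch[OF patch.hyps(1) m(2) _ p(1) patch.hyps(5) p(2) n] m(3) by simp
      moreover have "(\<nu>, ys, \<nu>2) \<in> ts_closure T"
        using ts_closure.patch[OF _ m(3) patch.hyps(3) p(3) n p(4) patch.hyps(8)] m(2) by simp
      ultimately show "\<exists>\<nu>. (\<nu>1, xs, \<nu>) \<in> ts_closure T \<and> (\<nu>, ys, \<nu>2) \<in> ts_closure T" by auto
    qed
  qed
  from this[OF t] show ?thesis unfolding prod.case using m by blast
qed

text \<open>Choosing representatives, instead of passing to labels or to classes, keeps the quotient
  inside the old set of actions. It thus has the same type and stays small.\<close>

definition label_rep :: "('s, 'l, 'x) ts \<Rightarrow> 'l \<Rightarrow> 'l" where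
  "label_rep X u = (SOME v. v \<in> actions X \<and> lab X v = lab X u)"

lemma label_rep:
  assumes "u \<in> actions X"
  shows "label_rep X u \<in> actions X" "lab X (label_rep X u) = lab X u"
  using someI[of "\<lambda>v. v \<in> actions X \<and> lab X v = lab X u" u] assms unfolding label_rep_def by auto

lemma label_rep_eq: "lab X u = lab X v \<Longrightarrow> label_rep X u = label_rep X v"
  by (simp add: label_rep_def)

lemma inj_on_lab_label_rep: "inj_on (lab X) (label_rep X ` actions X)"
  by (auto simp: inj_on_def label_rep intro: label_rep_eq)

definition label_quotient :: "('s, 'l, 'x) ts \<Rightarrow> ('s, 'l, 'x) ts" where
  "label_quotient X =
     \<lparr>states = states X, actions = label_rep X ` actions X, lab = lab X,
      transitions = ts_closure {(\<alpha>, map (label_rep X) us, \<beta>) | \<alpha> us \<beta>. (\<alpha>, us, \<beta>) \<in> transitions X}\<rparr>"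

lemma label_quotient_simps [simp]:
  "states (label_quotient X) = states X"
  "actions (label_quotient X) = label_rep X ` actions X"
  "lab (label_quotient X) = lab X"
  by (auto simp: label_quotient_def)

lemma ts_map_label_quotient: "ts_map X (label_quotient X) (\<lambda>s. s) (label_rep X)"
  by (rule ts_mapI) (auto simp: label_rep label_quotient_def intro!: ts_closure.base)

lemma cubical_label_quotient:
  assumes c: "cubical_ts X"
  shows "cubical_ts (label_quotient X)"
proof -
  let ?T = "{(\<alpha>, map (label_rep X) us, \<beta>) | \<alpha> us \<beta>. (\<alpha>, us, \<beta>) \<in> transitions X}"
  let ?Q = "label_quotient X"
  have T: "transitions ?Q = ts_closure ?T" by (simp add: label_quotient_def)
  have wf: "\<alpha> \<in> states X \<and> \<beta> \<in> states X \<and> us \<noteq> [] \<and> set us \<subseteq> actions ?Q" if "(\<alpha>, us, \<beta>) \<in> ?T" for \<alpha> us \<beta>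
    using that weak_tsD[OF cubical_ts_weak[OF c]] by fastforce
  have split: "\<exists>\<nu>. (\<alpha>, xs, \<nu>) \<in> ?T \<and> (\<nu>, ys, \<beta>) \<in> ?T"
    if t: "(\<alpha>, us, \<beta>) \<in> ?T" and m: "mset (xs @ ys) = mset us" "xs \<noteq> []" "ys \<noteq> []" for \<alpha> us \<beta> xs ys
  proof -
    obtain us0 where us0: "us = map (label_rep X) us0" "(\<alpha>, us0, \<beta>) \<in> transitions X" using t by auto
    obtain us' where us': "mset us' = mset us0" "map (label_rep X) us' = xs @ ys"
      using mset_map_lift[of "label_rep X" us0 "xs @ ys"] m us0 by metis
    then obtain xs' ys' where e: "us' = xs' @ ys'" "xs = map (label_rep X) xs'" "ys = map (label_rep X) ys'"
      by (auto simp: map_eq_append_conv)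
    then obtain \<nu> where "(\<alpha>, xs', \<nu>) \<in> transitions X" "(\<nu>, ys', \<beta>) \<in> transitions X"
      using cubical_ts_split[OF c us0(2), of xs' ys'] us' m by auto
    then show ?thesis using e by blast
  qed
  show ?thesis
  proof (rule cubical_tsI[OF weak_tsI]; (unfold T)?)
    fix \<alpha> us \<beta> assume "(\<alpha>, us, \<beta>) \<in> ts_closure ?T"
    then show "\<alpha> \<in> states ?Q \<and> \<beta> \<in> states ?Q \<and> us \<noteq> [] \<and> set us \<subseteq> actions ?Q"
      using ts_closure_wf[of ?T "states X" "actions ?Q" \<alpha> us \<beta>, OF wf] by simp
  next
    fix u assume "u \<in> actions ?Q"
    then obtain v where v: "v \<in> actions X" "u = label_rep X v" by auto
    obtain \<alpha> \<beta> where "(\<alpha>, [v], \<beta>) \<in> transitions X" using cubical_ts_used[OF c v(1)] .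
    from ts_mapD(4)[OF ts_map_label_quotient this]
    show "\<exists>\<alpha> \<beta>. (\<alpha>, [u], \<beta>) \<in> ts_closure ?T" using v unfolding T by auto
  next
    fix \<alpha> \<beta> xs ys assume t: "(\<alpha>, xs @ ys, \<beta>) \<in> ts_closure ?T" "xs \<noteq> []" "ys \<noteq> []"
    show "\<exists>\<nu>. (\<alpha>, xs, \<nu>) \<in> ts_closure ?T \<and> (\<nu>, ys, \<beta>) \<in> ts_closure ?T"
      by (rule ts_closure_split[OF split t(1) refl t(2,3)])
  qed (fact ts_closure.perm ts_closure.patch)+
qed

text \<open>Universal property of the reflection, with the same underlying functions: a map into
  \<open>Y\<close> cannot tell apart two actions with the same label, and the transitions added by
  the closure are already present in the weak transition system \<open>Y\<close>.\<close>

lemma ts_map_from_label_quotient: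
  assumes m: "ts_map X Y f g" and w: "weak_ts X" "weak_ts Y" and i: "inj_on (lab Y) (actions Y)"
  shows "ts_map (label_quotient X) Y f g"
    and "u \<in> actions X \<Longrightarrow> g (label_rep X u) = g u"
proof -
  show eq: "g (label_rep X u) = g u" if "u \<in> actions X" for u
    using i ts_mapD[OF m] label_rep[OF that] that by (auto simp: inj_on_def)
  show "ts_map (label_quotient X) Y f g"
  proof (rule ts_mapI)
    fix \<alpha> us \<beta> assume "(\<alpha>, us, \<beta>) \<in> transitions (label_quotient X)"
    then show "(f \<alpha>, map g us, f \<beta>) \<in> transitions Y"
      unfolding label_quotient_def ts.simps
    proof (rule ts_closure_map[OF w(2), rotated])
      fix \<alpha> us \<beta> assume "(\<alpha>, us, \<beta>) \<in> {(\<alpha>, map (label_rep X) us, \<beta>) | \<alpha> us \<beta>. (\<alpha>, us, \<beta>) \<in> transitions X}"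
      then obtain us0 where e: "us = map (label_rep X) us0" "(\<alpha>, us0, \<beta>) \<in> transitions X" by auto
      have "map g us = map g us0" using e weak_tsD(4)[OF w(1) e(2)] eq by auto
      then show "(f \<alpha>, map g us, f \<beta>) \<in> transitions Y" using ts_mapD(4)[OF m e(2)] by simp
    qed
  qed (use ts_mapD[OF m] label_rep[of _ X] eq in auto)
qed


section \<open>Cubes\<close>

lemma discrete_ts_simps [simp]:
  "states (discrete_ts S) = S" "actions (discrete_ts S) = {}" "transitions (discrete_ts S) = {}"
  by (auto simp: discrete_ts_def)

lemma cubical_discrete_ts: "cubical_ts (discrete_ts S)"
  by (rule cubical_tsI[OF weak_tsI]) auto

text \<open>The bound is strict, so this is the skeleton of dimension \<open>n - 1\<close>; with
  \<open>n\<close> the dimension of a cube it is the boundary of that cube, from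
  \<open>n = 2\<close> on.\<close>

definition skeleton_ts :: "nat \<Rightarrow> ('s, 'l, 'x) ts \<Rightarrow> ('s, 'l, 'x) ts" where
  "skeleton_ts n X = X\<lparr>transitions := {(\<alpha>, us, \<beta>) \<in> transitions X. length us < n}\<rparr>"

lemma skeleton_ts_simps [simp]:
  "states (skeleton_ts n X) = states X"
  "actions (skeleton_ts n X) = actions X"
  "lab (skeleton_ts n X) = lab X"
  "(\<alpha>, us, \<beta>) \<in> transitions (skeleton_ts n X) \<longleftrightarrow> (\<alpha>, us, \<beta>) \<in> transitions X \<and> length us < n"
  by (auto simp: skeleton_ts_def)

lemma cubical_skeleton_ts:
  assumes c: "cubical_ts X" and n: "n \<ge> 2"
  shows "cubical_ts (skeleton_ts n X)"
proof (rule cubical_tsI[OF weak_tsI])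
  note w = cubical_ts_weak[OF c]
  fix \<alpha> us vs \<beta> assume "(\<alpha>, us, \<beta>) \<in> transitions (skeleton_ts n X)" "mset vs = mset us"
  then show "(\<alpha>, vs, \<beta>) \<in> transitions (skeleton_ts n X)"
    using weak_ts_mset[OF w, of \<alpha> us \<beta> vs] mset_eq_length[of vs us] by simp
next
  fix \<alpha> \<beta> \<nu>1 \<nu>2 us vs ws
  assume "us \<noteq> []" "vs \<noteq> []" "ws \<noteq> []"
    "(\<alpha>, us @ vs @ ws, \<beta>) \<in> transitions (skeleton_ts n X)"
    "(\<alpha>, us, \<nu>1) \<in> transitions (skeleton_ts n X)"
    "(\<nu>1, vs @ ws, \<beta>) \<in> transitions (skeleton_ts n X)"
    "(\<alpha>, us @ vs, \<nu>2) \<in> transitions (skeleton_ts n X)"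
    "(\<nu>2, ws, \<beta>) \<in> transitions (skeleton_ts n X)"
  then show "(\<nu>1, vs, \<nu>2) \<in> transitions (skeleton_ts n X)"
    using weak_ts_patch[OF cubical_ts_weak[OF c], of us vs ws \<alpha> \<beta> \<nu>1 \<nu>2] by simp
next
  fix u assume "u \<in> actions (skeleton_ts n X)"
  then have "u \<in> actions X" by simp
  then obtain \<alpha> \<beta> where "(\<alpha>, [u], \<beta>) \<in> transitions X" by (rule cubical_ts_used[OF c])
  then show "\<exists>\<alpha> \<beta>. (\<alpha>, [u], \<beta>) \<in> transitions (skeleton_ts n X)" using n by auto
next
  fix \<alpha> \<beta> xs ys assume t: "(\<alpha>, xs @ ys, \<beta>) \<in> transitions (skeleton_ts n X)" "xs \<noteq> []" "ys \<noteq> []"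
  then have "(\<alpha>, xs @ ys, \<beta>) \<in> transitions X" by simp
  then obtain \<nu> where "(\<alpha>, xs, \<nu>) \<in> transitions X" "(\<nu>, ys, \<beta>) \<in> transitions X"
    by (rule cubical_ts_split[OF c _ refl t(2,3)])
  then show "\<exists>\<nu>. (\<alpha>, xs, \<nu>) \<in> transitions (skeleton_ts n X) \<and> (\<nu>, ys, \<beta>) \<in> transitions (skeleton_ts n X)"
    using t(1) by auto
qed (use weak_tsD[OF cubical_ts_weak[OF c]] in fastforce)

lemma cube_simps [simp]:
  "states (cube xs) = {\<epsilon>. length \<epsilon> = length xs}"
  "actions (cube xs) = {(xs ! i, i) | i. i < length xs}"
  "lab (cube xs) = fst"
  by (auto simp: cube_def)

text \<open>The coordinates are read off from the actions by \<open>snd\<close>, which removes the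
  existential over lists of coordinates. The axioms for cubes then reduce to statements about sets
  of coordinates.\<close>

lemma cube_trans_iff:
  "(\<epsilon>, us, \<epsilon>') \<in> transitions (cube xs) \<longleftrightarrow>
     length \<epsilon> = length xs \<and> length \<epsilon>' = length xs \<and> us \<noteq> [] \<and> distinct (map snd us) \<and>
     set us \<subseteq> actions (cube xs) \<and>
     (\<forall>i<length xs. (i \<in> snd ` set us \<longrightarrow> \<not> \<epsilon> ! i) \<and> (\<epsilon>' ! i \<longleftrightarrow> \<epsilon> ! i \<or> i \<in> snd ` set us))"
proof
  assume "(\<epsilon>, us, \<epsilon>') \<in> transitions (cube xs)"
  then obtain "is" where i: "us = map (\<lambda>i. (xs ! i, i)) is" "length \<epsilon> = length xs"
    "length \<epsilon>' = length xs" "is \<noteq> []" "distinct is" "set is \<subseteq> {..<length xs}"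
    "\<forall>i<length xs. \<epsilon> ! i \<le> \<epsilon>' ! i" "\<forall>i<length xs. \<epsilon> ! i \<noteq> \<epsilon>' ! i \<longleftrightarrow> i \<in> set is"
    by (auto simp: cube_def)
  have s: "map snd us = is" "snd ` set us = set is" unfolding i by (auto simp: comp_def image_image)
  show "length \<epsilon> = length xs \<and> length \<epsilon>' = length xs \<and> us \<noteq> [] \<and> distinct (map snd us) \<and>
     set us \<subseteq> actions (cube xs) \<and>
     (\<forall>i<length xs. (i \<in> snd ` set us \<longrightarrow> \<not> \<epsilon> ! i) \<and> (\<epsilon>' ! i \<longleftrightarrow> \<epsilon> ! i \<or> i \<in> snd ` set us))"
    unfolding s using i by auto
next
  assume a: "length \<epsilon> = length xs \<and> length \<epsilon>' = length xs \<and> us \<noteq> [] \<and> distinct (map snd us) \<and>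
     set us \<subseteq> actions (cube xs) \<and>
     (\<forall>i<length xs. (i \<in> snd ` set us \<longrightarrow> \<not> \<epsilon> ! i) \<and> (\<epsilon>' ! i \<longleftrightarrow> \<epsilon> ! i \<or> i \<in> snd ` set us))"
  have u: "map (\<lambda>i. (xs ! i, i)) (map snd us) = us"
    unfolding map_map by (rule map_idI) (use a in auto)
  have "set (map snd us) \<subseteq> {..<length xs}" using a by auto
  then have "(\<epsilon>, map (\<lambda>i. (xs ! i, i)) (map snd us), \<epsilon>') \<in> transitions (cube xs)"
    unfolding cube_def ts.simps mem_Collect_eq using a
    by (intro exI[of _ \<epsilon>] exI[of _ "map snd us"] exI[of _ \<epsilon>'] conjI refl) auto
  then show "(\<epsilon>, us, \<epsilon>') \<in> transitions (cube xs)" unfolding u .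
qed

lemma cubical_cube: "cubical_ts (cube xs)"
proof (rule cubical_tsI[OF weak_tsI])
  fix \<alpha> us vs \<beta> assume t: "(\<alpha>, us, \<beta>) \<in> transitions (cube xs)" "mset vs = mset us"
  have "set vs = set us" using t(2) by (rule mset_eq_setD)
  moreover have "distinct (map snd vs) = distinct (map snd us)"
    using t(2) by (intro mset_eq_imp_distinct_iff) simp
  moreover have "vs \<noteq> []" using t by (auto simp: cube_trans_iff)
  ultimately show "(\<alpha>, vs, \<beta>) \<in> transitions (cube xs)"
    using t(1) unfolding cube_trans_iff by simp
next
  fix \<alpha> \<beta> \<nu>1 \<nu>2 us vs ws
  assume "us \<noteq> []" "vs \<noteq> []" "ws \<noteq> []" and
    t: "(\<alpha>, us @ vs @ ws, \<beta>) \<in> transitions (cube xs)"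
    "(\<alpha>, us, \<nu>1) \<in> transitions (cube xs)" "(\<nu>1, vs @ ws, \<beta>) \<in> transitions (cube xs)"
    "(\<alpha>, us @ vs, \<nu>2) \<in> transitions (cube xs)" "(\<nu>2, ws, \<beta>) \<in> transitions (cube xs)"
  then show "(\<nu>1, vs, \<nu>2) \<in> transitions (cube xs)"
    unfolding cube_trans_iff by (simp add: image_Un)
next
  fix u assume "u \<in> actions (cube xs)"
  then obtain i where i: "u = (xs ! i, i)" "i < length xs" by auto
  have "(replicate (length xs) False, [u], (replicate (length xs) False)[i := True]) \<in> transitions (cube xs)"
    using i by (auto simp: cube_trans_iff nth_list_update)
  then show "\<exists>\<alpha> \<beta>. (\<alpha>, [u], \<beta>) \<in> transitions (cube xs)" by blast
next
  fix \<alpha> \<beta> us vs assume t: "(\<alpha>, us @ vs, \<beta>) \<in> transitions (cube xs)" "us \<noteq> []" "vs \<noteq> []"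
  define \<nu> where "\<nu> = map (\<lambda>i. \<alpha> ! i \<or> i \<in> snd ` set us) [0..<length xs]"
  have nu: "length \<nu> = length xs" "\<And>i. i < length xs \<Longrightarrow> \<nu> ! i \<longleftrightarrow> \<alpha> ! i \<or> i \<in> snd ` set us"
    by (auto simp: \<nu>_def)
  have "(\<alpha>, us, \<nu>) \<in> transitions (cube xs)"
    using t nu unfolding cube_trans_iff by (simp add: image_Un)
  moreover have "(\<nu>, vs, \<beta>) \<in> transitions (cube xs)"
    using t nu unfolding cube_trans_iff by (simp add: image_Un) blast
  ultimately show "\<exists>\<nu>. (\<alpha>, us, \<nu>) \<in> transitions (cube xs) \<and> (\<nu>, vs, \<beta>) \<in> transitions (cube xs)"
    by blast
qed (auto simp: cube_trans_iff)

lemma cube_trans_length: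
  assumes "(\<epsilon>, us, \<epsilon>') \<in> transitions (cube xs)"
  shows "length us \<le> length xs"
proof -
  have "set (map snd us) \<subseteq> {..<length xs}" "distinct (map snd us)"
    using assms by (auto simp: cube_trans_iff)
  then have "length (map snd us) \<le> card {..<length xs}"
    by (metis card_mono distinct_card finite_lessThan)
  then show ?thesis by simp
qed

lemma cube_top:
  assumes "xs \<noteq> []"
  shows "(replicate (length xs) False, zip xs [0..<length xs], replicate (length xs) True)
    \<in> transitions (cube xs)"
proof -
  have "map snd (zip xs [0..<length xs]) = [0..<length xs]" by simp
  then have "distinct (map snd (zip xs [0..<length xs]))"
    "snd ` set (zip xs [0..<length xs]) = {0..<length xs}"
    by (simp, metis set_map set_upt)
  then show ?thesis using assms unfolding cube_trans_iff by (auto simp: set_zip)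
qed

lemma boundary_simps [simp]:
  "states (boundary xs) = states (cube xs)"
  "lab (boundary xs) = fst"
  "length xs \<noteq> 1 \<Longrightarrow> actions (boundary xs) = actions (cube xs)"
  "length xs = 1 \<Longrightarrow> actions (boundary xs) = {}"
  "(\<alpha>, us, \<beta>) \<in> transitions (boundary xs) \<longleftrightarrow> (\<alpha>, us, \<beta>) \<in> transitions (cube xs) \<and> length us \<noteq> length xs"
  by (auto simp: boundary_def cube_def)

lemma cubical_boundary:
  assumes "xs \<noteq> []"
  shows "cubical_ts (boundary xs)"
proof (cases "length xs = 1")
  case True
  have "transitions (boundary xs) = {}"
  proof (intro equals0I)
    fix t assume t: "t \<in> transitions (boundary xs)"
    obtain \<alpha> us \<beta> where e: "t = (\<alpha>, us, \<beta>)" by (cases t)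
    then show False using t cube_trans_length[of \<alpha> us \<beta> xs] True
      by (cases us) (auto simp: cube_trans_iff)
  qed
  then show ?thesis using True by (intro cubical_tsI weak_tsI) auto
next
  case False
  then have n: "length xs \<ge> 2" using assms by (cases xs) (auto simp: Suc_le_eq)
  have "boundary xs = skeleton_ts (length xs) (cube xs)"
    using False n cube_trans_length[of _ _ _ xs]
    by (auto simp: boundary_def skeleton_ts_def cube_def order_less_le)
  then show ?thesis using cubical_skeleton_ts[OF cubical_cube n] by simp
qed

lemma finite_cube: "finite (states (cube xs))" "finite (actions (cube xs))"
  using finite_lists_length_eq[of "UNIV :: bool set" "length xs"] by (simp_all add: setcompr_eq_image)

text \<open>The intermediate states at the vertices of the cube can be chosen independently of each other:
  the composition axiom supplies the transitions between them.\<close>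

lemma cube_map_exists:
  assumes c: "cubical_ts X" and t: "(\<alpha>, us, \<beta>) \<in> transitions X"
  obtains \<phi> where "ts_map (cube (map (lab X) us)) X \<phi> (\<lambda>u. us ! snd u)"
    "\<phi> (replicate (length us) False) = \<alpha>" "\<phi> (replicate (length us) True) = \<beta>"
proof -
  note w = cubical_ts_weak[OF c]
  define n where "n = length us"
  \<comment> \<open>At the vertex \<open>\<epsilon>\<close>, the list \<open>P \<epsilon>\<close>
    consists of the actions already performed and \<open>F \<epsilon>\<close> of those still to
    come.\<close>
  define F where "F \<epsilon> = map ((!) us) (filter (\<lambda>i. \<not> \<epsilon> ! i) [0..<n])" for \<epsilon> :: "bool list"
  define P where "P \<epsilon> = map ((!) us) (filter (\<lambda>i. \<epsilon> ! i) [0..<n])" for \<epsilon> :: "bool list"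
  have PF: "mset (P \<epsilon> @ F \<epsilon>) = mset us" for \<epsilon>
  proof -
    have "mset (P \<epsilon> @ F \<epsilon>) = image_mset ((!) us) (mset (filter (\<lambda>i. \<epsilon> ! i) [0..<n]) +
        mset (filter (\<lambda>i. \<not> \<epsilon> ! i) [0..<n]))"
      by (simp add: P_def F_def)
    also have "\<dots> = image_mset ((!) us) (mset [0..<n])"
      by (metis mset_filter multiset_partition)
    also have "\<dots> = mset us" by (metis map_nth mset_map n_def)
    finally show ?thesis .
  qed
  \<comment> \<open>Empty lists are not transitions, so the first and the last vertex are pinned to
    \<open>\<alpha>\<close> and \<open>\<beta>\<close> instead.\<close>
  have "\<exists>\<nu>. (P \<epsilon> = [] \<longrightarrow> \<nu> = \<alpha>) \<and> (P \<epsilon> \<noteq> [] \<longrightarrow> (\<alpha>, P \<epsilon>, \<nu>) \<in> transitions X) \<and>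
      (F \<epsilon> = [] \<longrightarrow> \<nu> = \<beta>) \<and> (F \<epsilon> \<noteq> [] \<longrightarrow> (\<nu>, F \<epsilon>, \<beta>) \<in> transitions X)" for \<epsilon>
  proof -
    have "P \<epsilon> \<noteq> [] \<or> F \<epsilon> \<noteq> []" using PF[of \<epsilon>] weak_tsD(3)[OF w t] by auto
    moreover have "(\<alpha>, F \<epsilon>, \<beta>) \<in> transitions X" if "P \<epsilon> = []"
      using PF[of \<epsilon>] that by (intro weak_ts_mset[OF w t]) simp
    moreover have "(\<alpha>, P \<epsilon>, \<beta>) \<in> transitions X" if "F \<epsilon> = []"
      using PF[of \<epsilon>] that by (intro weak_ts_mset[OF w t]) simp
    moreover have "\<exists>\<nu>. (\<alpha>, P \<epsilon>, \<nu>) \<in> transitions X \<and> (\<nu>, F \<epsilon>, \<beta>) \<in> transitions X"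
      if "P \<epsilon> \<noteq> []" "F \<epsilon> \<noteq> []"
      using cubical_ts_split[OF c t PF that] by blast
    ultimately show ?thesis by metis
  qed
  then obtain \<phi> where \<phi>: "\<And>\<epsilon>. P \<epsilon> = [] \<Longrightarrow> \<phi> \<epsilon> = \<alpha>" "\<And>\<epsilon>. P \<epsilon> \<noteq> [] \<Longrightarrow> (\<alpha>, P \<epsilon>, \<phi> \<epsilon>) \<in> transitions X"
    "\<And>\<epsilon>. F \<epsilon> = [] \<Longrightarrow> \<phi> \<epsilon> = \<beta>" "\<And>\<epsilon>. F \<epsilon> \<noteq> [] \<Longrightarrow> (\<phi> \<epsilon>, F \<epsilon>, \<beta>) \<in> transitions X"
    by metis
  let ?C = "cube (map (lab X) us)"
  have us: "us ! i \<in> actions X" if "i < n" for i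
    using weak_tsD(4)[OF w t] that by (auto simp: n_def)
  have "ts_map ?C X \<phi> (\<lambda>u. us ! snd u)"
  proof (rule ts_mapI)
    fix \<epsilon> assume "\<epsilon> \<in> states ?C"
    show "\<phi> \<epsilon> \<in> states X"
      using \<phi>(1,2)[of \<epsilon>] weak_tsD(1,2)[OF w] t by blast
  next
    fix \<epsilon> vs \<epsilon>' assume v: "(\<epsilon>, vs, \<epsilon>') \<in> transitions ?C"
    define ks where "ks = map snd vs"
    define ws where "ws = map ((!) us) ks"
    have ws: "map (\<lambda>u. us ! snd u) vs = ws" by (simp add: ws_def ks_def comp_def)
    have ks: "ks \<noteq> []" "distinct ks" "set ks \<subseteq> {..<n}"
      "\<And>i. i < n \<Longrightarrow> i \<in> set ks \<Longrightarrow> \<not> \<epsilon> ! i" "\<And>i. i < n \<Longrightarrow> \<epsilon>' ! i \<longleftrightarrow> \<epsilon> ! i \<or> i \<in> set ks"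
      using v by (auto simp: cube_trans_iff ks_def n_def)
    have e1: "mset (filter (\<lambda>i. \<epsilon>' ! i) [0..<n]) = mset (filter (\<lambda>i. \<epsilon> ! i) [0..<n] @ ks)"
      using ks by (intro set_eq_iff_mset_eq_distinct[THEN iffD1]) auto
    have e2: "mset (filter (\<lambda>i. \<not> \<epsilon> ! i) [0..<n]) = mset (ks @ filter (\<lambda>i. \<not> \<epsilon>' ! i) [0..<n])"
      using ks by (intro set_eq_iff_mset_eq_distinct[THEN iffD1]) auto
    have mP: "mset (P \<epsilon>') = mset (P \<epsilon> @ ws)" using e1 by (simp add: P_def ws_def)
    have mF: "mset (F \<epsilon>) = mset (ws @ F \<epsilon>')" using e2 by (simp add: F_def ws_def)
    have ne: "ws \<noteq> []" "P \<epsilon>' \<noteq> []" "F \<epsilon> \<noteq> []" using mP mF ks(1) by (auto simp: ws_def)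
    have a: "(\<alpha>, P \<epsilon> @ ws, \<phi> \<epsilon>') \<in> transitions X"
      using weak_ts_mset[OF w \<phi>(2)[OF ne(2)] mP[symmetric]] .
    have b: "(\<phi> \<epsilon>, ws @ F \<epsilon>', \<beta>) \<in> transitions X"
      using weak_ts_mset[OF w \<phi>(4)[OF ne(3)] mF[symmetric]] .
    have "(\<phi> \<epsilon>, ws, \<phi> \<epsilon>') \<in> transitions X"
    \<comment> \<open>The composition axiom needs three nonempty blocks. If an outer one is empty,
      the corresponding vertex is \<open>\<alpha>\<close> or \<open>\<beta>\<close>, and
      \<open>a\<close> or \<open>b\<close> is already the claim.\<close>
    proof (cases "P \<epsilon> = [] \<or> F \<epsilon>' = []")
      case True
      then show ?thesis using a b \<phi>(1)[of \<epsilon>] \<phi>(3)[of \<epsilon>'] by auto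
    next
      case False
      have "mset (P \<epsilon> @ ws @ F \<epsilon>') = mset us" using PF[of \<epsilon>] mF by simp
      then have "(\<alpha>, P \<epsilon> @ ws @ F \<epsilon>', \<beta>) \<in> transitions X" using weak_ts_mset[OF w t] by blast
      then show ?thesis
        using weak_ts_patch[OF w _ ne(1) _ _ \<phi>(2) b a \<phi>(4)] False by blast
    qed
    then show "(\<phi> \<epsilon>, map (\<lambda>u. us ! snd u) vs, \<phi> \<epsilon>') \<in> transitions X" unfolding ws .
  qed (use us in \<open>auto simp: n_def\<close>)
  moreover have "\<phi> (replicate (length us) False) = \<alpha>"
    by (rule \<phi>(1)) (simp add: P_def n_def filter_empty_conv)
  moreover have "\<phi> (replicate (length us) True) = \<beta>"
    by (rule \<phi>(3)) (simp add: F_def n_def filter_empty_conv)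
  ultimately show ?thesis using that by blast
qed

lemma double_transition_simps [simp]:
  "states (double_transition x) = {1, 2, 3, 4}" "actions (double_transition x) = {x}"
  "lab (double_transition x) = id" "transitions (double_transition x) = {(1, [x], 2), (3, [x], 4)}"
  by (auto simp: double_transition_def)

lemma cubical_length_one:
  assumes "\<And>\<alpha> us \<beta>. (\<alpha>, us, \<beta>) \<in> transitions X \<Longrightarrow>
      \<alpha> \<in> states X \<and> \<beta> \<in> states X \<and> (\<exists>u\<in>actions X. us = [u])"
    and "\<And>u. u \<in> actions X \<Longrightarrow> \<exists>\<alpha> \<beta>. (\<alpha>, [u], \<beta>) \<in> transitions X"
  shows "cubical_ts X"
proof (rule cubical_tsI[OF weak_tsI])
  fix \<alpha> us vs \<beta> assume "(\<alpha>, us, \<beta>) \<in> transitions X" "mset vs = mset us"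
  moreover from this obtain u where "us = [u]" using assms(1) by blast
  ultimately show "(\<alpha>, vs, \<beta>) \<in> transitions X" by simp
next
  fix \<alpha> us \<beta> assume "(\<alpha>, us, \<beta>) \<in> transitions X"
  from assms(1)[OF this] show "\<alpha> \<in> states X \<and> \<beta> \<in> states X \<and> us \<noteq> [] \<and> set us \<subseteq> actions X"
    by auto
next
  fix \<alpha> us vs ws \<beta> assume "us \<noteq> []" "vs \<noteq> []" "(\<alpha>, us @ vs @ ws, \<beta>) \<in> transitions X"
  with assms(1)[OF this(3)] have False by (cases us) auto
  then show "(\<nu>1, vs, \<nu>2) \<in> transitions X" for \<nu>1 \<nu>2 ..
next
  fix \<alpha> \<beta> xs ys assume "(\<alpha>, xs @ ys, \<beta>) \<in> transitions X" "xs \<noteq> []" "ys \<noteq> []"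
  with assms(1)[OF this(1)] have False by (cases xs) auto
  then show "\<exists>\<nu>. (\<alpha>, xs, \<nu>) \<in> transitions X \<and> (\<nu>, ys, \<beta>) \<in> transitions X" ..
qed (fact assms(2))

lemma cubical_double_transition: "cubical_ts (double_transition x)"
  by (rule cubical_length_one) auto


lemma ts_map_image_ts:
  assumes c: "cubical_ts P" and i: "inj_on s (states P)" "inj_on l (actions P)" and m: "ts_map P Z f g"
  shows "ts_map (image_ts P s l) Z (\<lambda>x. f (inv_into (states P) s x)) (\<lambda>v. g (inv_into (actions P) l v))"
proof (rule ts_iso_ts_map_left[OF ts_iso_image_ts[OF cubical_ts_weak[OF c] i]])
  show "weak_ts (image_ts P s l)" using cubical_image_ts[OF c i] by (rule cubical_ts_weak)
  show "ts_map P Z (\<lambda>x. f (inv_into (states P) s (s x))) (\<lambda>v. g (inv_into (actions P) l (l v)))"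
    by (rule ts_map_cong[OF m cubical_ts_weak[OF c]]) (auto simp: i)
qed

lemma CTS_comp_eqD:
  assumes "Comp CTS g f = Comp CTS g' f'" "in_hom CTS f X Y" "in_hom CTS f' X Y'"
  shows "s \<in> states X \<Longrightarrow> st g (st f s) = st g' (st f' s)"
    and "u \<in> actions X \<Longrightarrow> act g (act f u) = act g' (act f' u)"
  using assms(1) CTS_homD(2)[OF assms(2)] CTS_homD(2)[OF assms(3)] by (metis CTS_comp_simps(3), metis CTS_comp_simps(4))

lemma CTS_comp_eqI:
  assumes "in_hom CTS f X Y" "in_hom CTS g Y Z" "in_hom CTS h X Z"
    and "\<And>s. s \<in> states X \<Longrightarrow> st g (st f s) = st h s"
    and "\<And>u. u \<in> actions X \<Longrightarrow> act g (act f u) = act h u"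
  shows "Comp CTS g f = h"
  using assms CTS_homD(2)[OF assms(1)]
  by (intro CTS_eqI[OF CTS_comp_in_hom[OF assms(1,2)] assms(3)]) auto


section \<open>Cofibrations and trivial fibrations\<close>

definition cofibrations :: "('u, 'x) ts_arrow set" where
  "cofibrations = {i \<in> Arr CTS. inj_on (act i) (actions (src i))}"

text \<open>An explicit form of the maps with the right lifting property, both against the
  generators and against all cofibrations. The last clause says that the source is the
  \<open>pull_actions\<close> of the target, up to renaming states.\<close>

definition trivial_fibrations :: "('u, 'x) ts_arrow set" where
  "trivial_fibrations = {p \<in> Arr CTS.
     bij_betw (st p) (states (src p)) (states (tgt p)) \<and>
     act p ` actions (src p) = actions (tgt p) \<and>
     (\<forall>\<alpha>\<in>states (src p). \<forall>\<beta>\<in>states (src p). \<forall>us. set us \<subseteq> actions (src p) \<longrightarrow>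
        (st p \<alpha>, map (act p) us, st p \<beta>) \<in> transitions (tgt p) \<longrightarrow>
        (\<alpha>, us, \<beta>) \<in> transitions (src p))}"

lemma cofibrationsI:
  "in_hom CTS i A B \<Longrightarrow> inj_on (act i) (actions A) \<Longrightarrow> i \<in> cofibrations"
  by (auto simp: cofibrations_def CTS_homD)

lemma trivial_fibrationsI:
  assumes "in_hom CTS p X Y" "bij_betw (st p) (states X) (states Y)" "act p ` actions X = actions Y"
    and "\<And>\<alpha> us \<beta>. \<alpha> \<in> states X \<Longrightarrow> \<beta> \<in> states X \<Longrightarrow> set us \<subseteq> actions X \<Longrightarrow>
      (st p \<alpha>, map (act p) us, st p \<beta>) \<in> transitions Y \<Longrightarrow> (\<alpha>, us, \<beta>) \<in> transitions X"
  shows "p \<in> trivial_fibrations"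
  using assms by (simp add: trivial_fibrations_def CTS_homD[OF assms(1)])

text \<open>States lift uniquely since \<open>p\<close> is bijective on them. An action coming from
  \<open>A\<close> must follow \<open>a\<close>, which is consistent because \<open>i\<close> is
  injective on actions; the others lift by surjectivity. Transitions lift because \<open>p\<close>
  reflects them.\<close>

lemma lifts_cofibration_trivial_fibration:
  fixes i p :: "('u, 'x) ts_arrow"
  assumes "i \<in> cofibrations" "p \<in> trivial_fibrations"
  shows "lifts CTS i p"
proof -
  define A B X Y where d: "A = src i" "B = tgt i" "X = src p" "Y = tgt p"
  have i: "in_hom CTS i A B" "inj_on (act i) (actions A)"
    using assms(1) by (auto simp: cofibrations_def d CTS_arr_hom)
  have p: "in_hom CTS p X Y" "bij_betw (st p) (states X) (states Y)" "act p ` actions X = actions Y"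
    and reflects: "\<And>\<alpha> us \<beta>. \<alpha> \<in> states X \<Longrightarrow> \<beta> \<in> states X \<Longrightarrow> set us \<subseteq> actions X \<Longrightarrow>
      (st p \<alpha>, map (act p) us, st p \<beta>) \<in> transitions Y \<Longrightarrow> (\<alpha>, us, \<beta>) \<in> transitions X"
    using assms(2) by (auto simp: trivial_fibrations_def d CTS_arr_hom)
  show ?thesis
  proof (subst CTS.lifts_iff[OF i(1) p(1)], intro allI impI, elim conjE)
    fix a b assume a: "in_hom CTS a A X" and b: "in_hom CTS b B Y" and sq: "Comp CTS p a = Comp CTS b i"
    note sqs = CTS_comp_eqD[OF sq a i(1)]
    define h where "h s = inv_into (states X) (st p) (st b s)" for s
    define k where "k w = (if w \<in> act i ` actions A then act a (inv_into (actions A) (act i) w)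
       else inv_into (actions X) (act p) (act b w))" for w
    have h: "h s \<in> states X" "st p (h s) = st b s" if "s \<in> states B" for s
    proof -
      have "st b s \<in> st p ` states X" using b that p(2) by (auto simp: bij_betw_def)
      then show "h s \<in> states X" "st p (h s) = st b s"
        unfolding h_def by (auto intro: inv_into_into f_inv_into_f)
    qed
    have k: "k w \<in> actions X \<and> act p (k w) = act b w" if "w \<in> actions B" for w
    proof (cases "w \<in> act i ` actions A")
      case True
      then obtain u where u: "u \<in> actions A" "w = act i u" by auto
      then have "k w = act a u" using i(2) by (auto simp: k_def)
      then show ?thesis using u a sqs(2)[OF u(1)] by simp
    next
      case False
      have "act b w \<in> act p ` actions X" using b that p(3) by auto
      with False show ?thesis by (auto simp: k_def inv_into_into f_inv_into_f)
    qed
    have m: "ts_map B X h k"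
    proof (rule ts_mapI)
      fix w assume w: "w \<in> actions B"
      show "lab X (k w) = lab B w" using k[OF w] CTS_st_act(3)[OF p(1)] CTS_st_act(3)[OF b w] by metis
    next
      fix \<alpha> us \<beta> assume t: "(\<alpha>, us, \<beta>) \<in> transitions B"
      note wf = weak_tsD[OF CTS_homD(9)[OF b] t]
      have e: "map (act p) (map k us) = map (act b) us" using wf(4) k by auto
      have "(st p (h \<alpha>), map (act p) (map k us), st p (h \<beta>)) \<in> transitions Y"
        unfolding e using CTS_trans[OF b t] wf h by simp
      then show "(h \<alpha>, map k us, h \<beta>) \<in> transitions X"
        using wf h k by (intro reflects) auto
    qed (use h k in auto)
    define H where "H = arrow B X h k"
    have H: "in_hom CTS H B X" unfolding H_def
      by (rule arrow_in_hom[OF CTS_homD(5)[OF i(1)] CTS_homD(4)[OF p(1)] m])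
    have "Comp CTS H i = a"
    proof (rule CTS_comp_eqI[OF i(1) H a])
      fix s assume s: "s \<in> states A"
      then have "st i s \<in> states B" "st a s \<in> states X" using i a by auto
      then show "st H (st i s) = st a s"
        using sqs(1)[OF s] p(2) by (simp add: H_def h_def bij_betw_def flip: sqs(1)[OF s])
    next
      fix u assume u: "u \<in> actions A"
      then have "act i u \<in> actions B" using i by auto
      then show "act H (act i u) = act a u" using u i(2) by (simp add: H_def k_def)
    qed
    moreover have "Comp CTS p H = b"
      by (rule CTS_comp_eqI[OF H p(1) b]) (auto simp: H_def h k)
    ultimately show "\<exists>h. in_hom CTS h B X \<and> Comp CTS h i = a \<and> Comp CTS p h = b" using H by blast
  qed
qed

lemma pull_actions_trivial_fibration:
  assumes Y: "Y \<in> cts_objects" and L: "small L" "g ` L = actions Y"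
  shows "pull_actions Y L g \<in> cts_objects"
    and "in_hom CTS (arrow (pull_actions Y L g) Y id g) (pull_actions Y L g) Y"
    and "arrow (pull_actions Y L g) Y id g \<in> trivial_fibrations"
proof -
  show o: "pull_actions Y L g \<in> cts_objects"
    using Y L by (intro cts_objectsI cubical_pull_actions) (auto simp: cts_objectsD)
  show h: "in_hom CTS (arrow (pull_actions Y L g) Y id g) (pull_actions Y L g) Y"
    using L by (intro arrow_in_hom o Y ts_map_pull_actions) auto
  show "arrow (pull_actions Y L g) Y id g \<in> trivial_fibrations"
  proof (rule trivial_fibrationsI[OF h])
    fix \<alpha> us \<beta> assume a: "set us \<subseteq> actions (pull_actions Y L g)"
      and t: "\<alpha> \<in> states (pull_actions Y L g)" "\<beta> \<in> states (pull_actions Y L g)"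
      "(st (arrow (pull_actions Y L g) Y id g) \<alpha>, map (act (arrow (pull_actions Y L g) Y id g)) us,
        st (arrow (pull_actions Y L g) Y id g) \<beta>) \<in> transitions Y"
    have e: "map (act (arrow (pull_actions Y L g) Y id g)) us = map g us" using a by auto
    show "(\<alpha>, us, \<beta>) \<in> transitions (pull_actions Y L g)" using a t unfolding e by simp
  qed (use L in \<open>auto simp: bij_betw_def inj_on_def\<close>)
qed

section \<open>Small sets, and encodings of labels, pairs and numbers in the universe\<close>

locale universe =
  fixes code :: "'x \<Rightarrow> 'u" and pair :: "'u \<times> 'u \<Rightarrow> 'u" and num :: "nat \<Rightarrow> 'u"
  assumes infinite_universe: "infinite (UNIV :: 'u set)"
    and inj_code: "inj code" and small_code: "small (range code)"
    and inj_pair: "inj pair" and inj_num: "inj num"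
begin

lemma small_subset: "small (B :: 'u set) \<Longrightarrow> A \<subseteq> B \<Longrightarrow> small A"
  unfolding small_def using card_of_mono1 ordLeq_ordLess_trans by blast

lemma small_image: "small (A :: 'u set) \<Longrightarrow> small (f ` A :: 'u set)"
  unfolding small_def using card_of_image ordLeq_ordLess_trans by blast

lemma small_finite: "finite (A :: 'u set) \<Longrightarrow> small A"
  unfolding small_def using infinite_universe
  by (intro finite_ordLess_infinite card_of_Well_order) (simp_all add: Field_card_of)

lemma small_Un: "small (A :: 'u set) \<Longrightarrow> small B \<Longrightarrow> small (A \<union> B)"
  unfolding small_def using infinite_universe card_of_Un_ordLess_infinite by blast

lemma small_pairs:
  assumes "small (A :: 'u set)" "small B"
  shows "small (pair ` (A \<times> B))"
proof (cases "finite (A \<union> B)")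
  case True
  then show ?thesis by (intro small_finite) auto
next
  case False
  have "|pair ` (A \<times> B)| \<le>o |(A \<union> B) \<times> (A \<union> B)|"
    by (rule ordLeq_transitive[OF card_of_image card_of_mono1]) auto
  also have "|(A \<union> B) \<times> (A \<union> B)| =o |A \<union> B|"
    using False by (intro card_of_Times_infinite[THEN conjunct1] ordLeq_refl card_of_Card_order) auto
  also have "|A \<union> B| <o |UNIV :: 'u set|"
    using small_Un[OF assms] by (simp add: small_def)
  finally show ?thesis by (simp add: small_def)
qed

lemma num_eq [simp]: "num m = num n \<longleftrightarrow> m = n"
  using inj_num by (auto dest: injD)

lemma pair_eq [simp]: "pair z = pair z' \<longleftrightarrow> z = z'"
  using inj_pair by (auto dest: injD)

definition unpair :: "'u \<Rightarrow> 'u \<times> 'u" where "unpair = inv pair"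

lemma unpair_pair [simp]: "unpair (pair z) = z"
  using inj_pair by (simp add: unpair_def)

text \<open>The middle object has the states of \<open>Y\<close>, the disjoint union of the two sets
  of actions (tagged by \<open>num 0\<close> and \<open>num 1\<close>), and the transitions pulled
  back from \<open>Y\<close>. The copy of the actions of \<open>X\<close> makes \<open>i\<close>
  injective, and that of the actions of \<open>Y\<close> makes \<open>p\<close> surjective on
  actions.\<close>

lemma factor_cofibration_trivial_fibration:
  fixes f :: "('u, 'x) ts_arrow"
  assumes f: "in_hom CTS f X Y"
  obtains i p Z where "in_hom CTS i X Z" "in_hom CTS p Z Y" "i \<in> cofibrations"
    "p \<in> trivial_fibrations" "Comp CTS p i = f"
proof -
  define L where "L = pair ` ({num 0} \<times> actions X) \<union> pair ` ({num 1} \<times> actions Y)"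
  define g where "g z = (case unpair z of (t, u) \<Rightarrow> if t = num 0 then act f u else u)" for z
  note o = CTS_homD(4,5)[OF f]
  have L: "small L" unfolding L_def using o
    by (intro small_Un small_pairs) (auto intro: small_finite simp: cts_objectsD)
  have gL: "g ` L = actions Y"
    using f by (force simp: L_def g_def image_Un image_image)
  let ?Z = "pull_actions Y L g"
  note p = pull_actions_trivial_fibration[OF o(2) L gL]
  have m: "ts_map X ?Z (st f) (\<lambda>u. pair (num 0, u))"
    by (rule ts_map_to_pull_actions)
      (use CTS_homD[OF f] f in \<open>auto simp: L_def g_def\<close>)
  have i: "in_hom CTS (arrow X ?Z (st f) (\<lambda>u. pair (num 0, u))) X ?Z"
    by (rule arrow_in_hom[OF o(1) p(1) m])
  show ?thesis
  proof (rule that[OF i p(2) _ p(3)])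
    show "arrow X ?Z (st f) (\<lambda>u. pair (num 0, u)) \<in> cofibrations"
      by (rule cofibrationsI[OF i]) (auto simp: inj_on_def)
    show "Comp CTS (arrow ?Z Y id g) (arrow X ?Z (st f) (\<lambda>u. pair (num 0, u))) = f"
      by (rule CTS_comp_eqI[OF i p(2) f]) (use f in \<open>auto simp: L_def g_def\<close>)
  qed
qed

text \<open>By the retract argument a map with the left lifting property is a retract of the
  cofibration in its factorization, and injectivity on actions passes to retracts.\<close>

lemma llp_trivial_fibrations: "llp CTS trivial_fibrations = (cofibrations :: ('u, 'x) ts_arrow set)"
proof
  show "cofibrations \<subseteq> llp CTS (trivial_fibrations :: ('u, 'x) ts_arrow set)"
    using lifts_cofibration_trivial_fibration unfolding llp_def by (auto simp: cofibrations_def)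
  show "llp CTS trivial_fibrations \<subseteq> (cofibrations :: ('u, 'x) ts_arrow set)"
  proof
    fix f :: "('u, 'x) ts_arrow" assume f: "f \<in> llp CTS trivial_fibrations"
    then have fh: "in_hom CTS f (src f) (tgt f)" by (simp add: llp_def CTS_arr_hom)
    obtain i p Z where ip: "in_hom CTS i (src f) Z" "in_hom CTS p Z (tgt f)" "i \<in> cofibrations"
      "p \<in> trivial_fibrations" "Comp CTS p i = f"
      using factor_cofibration_trivial_fibration[OF fh] .
    have "lifts CTS f p" using f ip(4) by (auto simp: llp_def)
    then have "retract_of CTS f i" using CTS.retract_of_left_factor[OF ip(1,2)] ip(5) by simp
    then obtain r j where r: "in_hom CTS j (src f) (src i)" "in_hom CTS r (tgt f) (tgt i)"
      and e: "Comp CTS i j = Comp CTS r f" and rj: "\<exists>q. Comp CTS q j = Ident CTS (src f)"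
      unfolding retract_of_def by auto
    have "inj_on (act f) (actions (src f))"
    proof (rule inj_onI)
      fix u v assume uv: "u \<in> actions (src f)" "v \<in> actions (src f)" "act f u = act f v"
      have "act i (act j u) = act i (act j v)"
        using CTS_comp_eqD(2)[OF e r(1) fh] uv by simp
      then have "act j u = act j v"
        using ip(3) r(1) uv by (auto simp: cofibrations_def dest: inj_onD)
      moreover obtain q where "Comp CTS q j = Ident CTS (src f)" using rj by auto
      ultimately show "u = v"
        using uv CTS_homD(2)[OF r(1)] by (metis CTS_comp_simps(4) CTS_ident_simps(2))
    qed
    then show "f \<in> cofibrations" using fh by (auto intro: cofibrationsI)
  qed
qed

lemma generating_cofibrations_subset:
  "generating_cofibrations \<subseteq> (cofibrations :: ('u, 'x) ts_arrow set)"
proof -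
  have inj: "h \<in> cofibrations"
    if h: "copy_of_map P Q f g h" and g: "inj_on g (actions P)" "g ` actions P \<subseteq> actions Q"
    for P :: "('s, 'l, 'x) ts" and Q :: "('t, 'k, 'x) ts" and f g and h :: "('u, 'x) ts_arrow"
  proof -
    obtain a a' b b' where i: "ts_iso P (src h) a a'" "ts_iso Q (tgt h) b b'"
      and e: "\<And>u. u \<in> actions P \<Longrightarrow> act h (a' u) = b' (g u)" and hA: "h \<in> Arr CTS"
      using h unfolding copy_of_map_def by blast
    have "inj_on b' (g ` actions P)"
      using ts_iso_bij(2)[OF i(2)] g(2) by (auto simp: bij_betw_def intro: inj_on_subset)
    then have "inj_on (\<lambda>u. b' (g u)) (actions P)"
      using comp_inj_on[OF g(1)] by (simp add: comp_def)
    then have "inj_on (\<lambda>u. act h (a' u)) (actions P)" using e by (simp cong: inj_on_cong)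
    then have "inj_on (act h) (a' ` actions P)" using inj_on_imageI[of "act h" a'] by (simp add: comp_def)
    then have "inj_on (act h) (actions (src h))" using ts_iso_bij(2)[OF i(1)] by (simp add: bij_betw_def)
    then show ?thesis using hA by (simp add: cofibrations_def)
  qed
  have b: "id ` actions (boundary xs) \<subseteq> actions (cube xs)" for xs :: "'x list"
    by (auto simp: boundary_def)
  have s: "inj_on fst (actions (cube [x]))" "fst ` actions (cube [x]) \<subseteq> actions (double_transition x)"
    for x :: 'x by (auto simp: inj_on_def)
  show ?thesis
    unfolding generating_cofibrations_def
    using inj[OF _ inj_on_id b] inj[OF _ s] by (auto intro: inj)
qed

text \<open>Arrows of \<open>CTS\<close> can only be copies of a generator. Since the generator is
  finite, injections \<open>s1\<close>, \<open>l1\<close>, \<open>s2\<close>, \<open>l2\<close>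
  yield a small copy, and a lift against that copy is carried back to the generator itself.\<close>

lemma copy_lift:
  fixes P :: "('s, 'l, 'x) ts" and Q :: "('t, 'k, 'x) ts" and p :: "('u, 'x) ts_arrow"
    and s1 :: "'s \<Rightarrow> 'u" and l1 :: "'l \<Rightarrow> 'u" and s2 :: "'t \<Rightarrow> 'u" and l2 :: "'k \<Rightarrow> 'u"
  assumes P: "cubical_ts P" "finite (states P)" "finite (actions P)" "inj_on s1 (states P)" "inj_on l1 (actions P)"
    and Q: "cubical_ts Q" "finite (states Q)" "finite (actions Q)" "inj_on s2 (states Q)" "inj_on l2 (actions Q)"
    and m: "ts_map P Q f g" and p: "in_hom CTS p X Y"
    and l: "\<And>h. copy_of_map P Q f g h \<Longrightarrow> lifts CTS h p"
    and a: "ts_map P X a a'" and b: "ts_map Q Y b b'"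
    and eq: "\<And>s. s \<in> states P \<Longrightarrow> st p (a s) = b (f s)" "\<And>u. u \<in> actions P \<Longrightarrow> act p (a' u) = b' (g u)"
  obtains k k' where "ts_map Q X k k'"
    "\<And>s. s \<in> states P \<Longrightarrow> k (f s) = a s" "\<And>u. u \<in> actions P \<Longrightarrow> k' (g u) = a' u"
    "\<And>s. s \<in> states Q \<Longrightarrow> st p (k s) = b s" "\<And>u. u \<in> actions Q \<Longrightarrow> act p (k' u) = b' u"
proof -
  let ?P = "image_ts P (s1 :: 's \<Rightarrow> 'u) l1" and ?Q = "image_ts Q (s2 :: 't \<Rightarrow> 'u) l2"
  have o: "?P \<in> cts_objects" "?Q \<in> cts_objects"
    using P Q by (auto intro!: cts_objectsI cubical_image_ts small_finite)
  have i: "ts_iso P ?P s1 l1" "ts_iso Q ?Q s2 l2"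
    using P Q by (auto intro!: ts_iso_image_ts cubical_ts_weak)
  have im: "ts_map Q ?Q s2 l2" using i(2) by (simp add: ts_iso_def)
  note om = CTS_homD(4,5)[OF p]
  have H: "in_hom CTS (arrow ?P ?Q (\<lambda>x. s2 (f (inv_into (states P) s1 x)))
      (\<lambda>x. l2 (g (inv_into (actions P) l1 x)))) ?P ?Q" (is "in_hom CTS ?h _ _")
    by (rule arrow_in_hom[OF o ts_map_image_ts[OF P(1,4,5) ts_map_comp[OF m im]]])
  have A: "in_hom CTS (arrow ?P X (\<lambda>x. a (inv_into (states P) s1 x)) (\<lambda>x. a' (inv_into (actions P) l1 x))) ?P X"
    (is "in_hom CTS ?a _ _")
    by (rule arrow_in_hom[OF o(1) om(1) ts_map_image_ts[OF P(1,4,5) a]])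
  have B: "in_hom CTS (arrow ?Q Y (\<lambda>x. b (inv_into (states Q) s2 x)) (\<lambda>x. b' (inv_into (actions Q) l2 x))) ?Q Y"
    (is "in_hom CTS ?b _ _")
    by (rule arrow_in_hom[OF o(2) om(2) ts_map_image_ts[OF Q(1,4,5) b]])
  have "copy_of_map P Q f g ?h"
    unfolding copy_of_map_def
  proof (intro conjI exI)
    show "ts_iso P (src ?h) s1 l1" "ts_iso Q (tgt ?h) s2 l2" using i by simp_all
  qed (use CTS_homD(1)[OF H] P(4,5) in auto)
  then have lift: "lifts CTS ?h p" by (rule l)
  have sq: "Comp CTS p ?a = Comp CTS ?b ?h"
  proof (rule CTS_comp_eqI[OF A p CTS_comp_in_hom[OF H B]])
    fix s assume "s \<in> states ?P"
    then show "st p (st ?a s) = st (Comp CTS ?b ?h) s"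
      using ts_mapD(1)[OF m] eq(1) P(4) Q(4) by auto
  next
    fix u assume "u \<in> actions ?P"
    then show "act p (act ?a u) = act (Comp CTS ?b ?h) u"
      using ts_mapD(2)[OF m] eq(2) P(5) Q(5) by auto
  qed
  from lift[unfolded CTS.lifts_iff[OF H p], rule_format, OF conjI[OF A conjI[OF B sq]]]
  obtain K where K: "in_hom CTS K ?Q X" "Comp CTS K ?h = ?a" "Comp CTS p K = ?b"
    by blast
  have KA: "Comp CTS K ?h = Comp CTS ?a (Ident CTS ?P)" "Comp CTS p K = Comp CTS ?b (Ident CTS ?Q)"
    using K CTS.comp_ident_right[OF A] CTS.comp_ident_right[OF B] by auto
  note ke = CTS_comp_eqD[OF KA(1) H CTS_ident_in_hom[OF o(1)]]
    CTS_comp_eqD[OF KA(2) K(1) CTS_ident_in_hom[OF o(2)]]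
  show ?thesis
  proof (rule that)
    show "ts_map Q X (\<lambda>s. st K (s2 s)) (\<lambda>u. act K (l2 u))"
      by (rule ts_map_comp[OF im CTS_homD(6)[OF K(1)]])
    show "st K (s2 (f s)) = a s" if "s \<in> states P" for s using ke(1)[of "s1 s"] that P(4) by simp
    show "act K (l2 (g u)) = a' u" if "u \<in> actions P" for u using ke(2)[of "l1 u"] that P(5) by simp
    show "st p (st K (s2 s)) = b s" if "s \<in> states Q" for s using ke(3)[of "s2 s"] that Q(4) by simp
    show "act p (act K (l2 u)) = b' u" if "u \<in> actions Q" for u using ke(4)[of "l2 u"] that Q(5) by simp
  qed
qed

lemma num_to_nat_inj: "inj_on (\<lambda>\<epsilon> :: bool list. num (to_nat \<epsilon>)) S" "inj_on num N"
  by (auto simp: inj_on_def)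

lemma num_snd_inj: "inj_on (\<lambda>u. num (snd u)) (actions (cube xs))" "inj_on (\<lambda>u. num (snd u)) (actions (boundary xs))"
  by (auto simp: inj_on_def boundary_def)

lemma finite_boundary: "finite (states (boundary xs))" "finite (actions (boundary xs))"
  using finite_cube[of xs] by (auto simp: boundary_def)

lemma boundary_in_generating_cofibrations:
  "xs \<noteq> [] \<Longrightarrow> copy_of_map (boundary xs) (cube xs) id id h \<Longrightarrow> h \<in> generating_cofibrations"
  unfolding generating_cofibrations_def by (cases xs) (auto intro!: exI[of _ xs])

text \<open>Each kind of generator yields one clause: the two maps between discrete systems give
  surjectivity and injectivity on states, the boundary of the 1-cube gives surjectivity on actions,
  the double transition gives reflection of 1-transitions, and the higher boundaries give reflection
  of longer transitions by induction on length.\<close>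

lemma rlp_generating_cofibrations_subset:
  "rlp CTS generating_cofibrations \<subseteq> (trivial_fibrations :: ('u, 'x) ts_arrow set)"
proof
  fix p :: "('u, 'x) ts_arrow" assume p: "p \<in> rlp CTS generating_cofibrations"
  define X Y where "X = src p" and "Y = tgt p"
  have ph: "in_hom CTS p X Y" using p by (simp add: rlp_def CTS_arr_hom X_def Y_def)
  note cX = CTS_homD(7)[OF ph] and cY = CTS_homD(8)[OF ph] and wX = CTS_homD(9)[OF ph] and wY = CTS_homD(10)[OF ph]
  have lp: "lifts CTS h p" if "h \<in> generating_cofibrations" for h using p that by (auto simp: rlp_def)
  note dc = cubical_discrete_ts
  have surj: "y \<in> st p ` states X" if y: "y \<in> states Y" for y
  proof -
    have m: "ts_map (discrete_ts {} :: (nat, nat, 'x) ts) (discrete_ts {0} :: (nat, nat, 'x) ts) id id"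
      "ts_map (discrete_ts {} :: (nat, nat, 'x) ts) X (\<lambda>_. undefined) (\<lambda>_. undefined)"
      "ts_map (discrete_ts {0} :: (nat, nat, 'x) ts) Y (\<lambda>_. y) (\<lambda>_. undefined)"
      using y by (auto intro!: ts_mapI)
    obtain k k' where "ts_map (discrete_ts {0} :: (nat, nat, 'x) ts) X k k'"
      "\<And>s. s \<in> states (discrete_ts {0} :: (nat, nat, 'x) ts) \<Longrightarrow> st p (k s) = y"
      by (rule copy_lift[OF dc _ _ num_to_nat_inj(2) num_to_nat_inj(2) dc _ _ num_to_nat_inj(2)
            num_to_nat_inj(2) m(1) ph lp m(2,3)]) (auto simp: generating_cofibrations_def)
    then show ?thesis by (auto dest!: ts_mapD(1)[of _ _ _ _ 0])
  qed
  have inj: "x = x'" if x: "x \<in> states X" "x' \<in> states X" "st p x = st p x'" for x x'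
  proof -
    have m: "ts_map (discrete_ts {0, 1} :: (nat, nat, 'x) ts) (discrete_ts {0} :: (nat, nat, 'x) ts) (\<lambda>_. 0) id"
      "ts_map (discrete_ts {0, 1} :: (nat, nat, 'x) ts) X (\<lambda>n. if n = 0 then x else x') (\<lambda>_. undefined)"
      "ts_map (discrete_ts {0} :: (nat, nat, 'x) ts) Y (\<lambda>_. st p x) (\<lambda>_. undefined)"
      using x ph by (auto intro!: ts_mapI)
    obtain k k' where "ts_map (discrete_ts {0} :: (nat, nat, 'x) ts) X k k'"
      "\<And>s. s \<in> states (discrete_ts {0, 1} :: (nat, nat, 'x) ts) \<Longrightarrow> k 0 = (if s = 0 then x else x')"
      by (rule copy_lift[OF dc _ _ num_to_nat_inj(2) num_to_nat_inj(2) dc _ _ num_to_nat_inj(2)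
            num_to_nat_inj(2) m(1) ph lp m(2,3)]) (use x in \<open>auto simp: generating_cofibrations_def\<close>)
    from this(2)[of 0] this(2)[of 1] show ?thesis by simp
  qed
  have bij: "bij_betw (st p) (states X) (states Y)"
    unfolding bij_betw_def using surj inj ph by (auto intro: inj_onI)
  have act_surj: "v \<in> act p ` actions X" if v: "v \<in> actions Y" for v
  proof -
    obtain \<alpha> \<beta> where t: "(\<alpha>, [v], \<beta>) \<in> transitions Y" using cubical_ts_used[OF cY v] .
    note wf = weak_tsD[OF wY t]
    obtain x x' where x: "x \<in> states X" "x' \<in> states X" "st p x = \<alpha>" "st p x' = \<beta>"
      using surj wf by (metis imageE)
    let ?C = "cube [lab Y v]" and ?B = "boundary [lab Y v]"
    obtain \<phi> where \<phi>: "ts_map ?C Y \<phi> (\<lambda>u. [v] ! snd u)"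
      "\<phi> [False] = \<alpha>" "\<phi> [True] = \<beta>"
      using cube_map_exists[OF cY t] by auto
    have st2: "\<epsilon> = [False] \<or> \<epsilon> = [True]" if "length \<epsilon> = Suc 0" for \<epsilon> :: "bool list"
      using that by (cases \<epsilon>) auto
    have nt: "(\<epsilon>, us, \<epsilon>') \<notin> transitions ?B" for \<epsilon> us \<epsilon>'
      using cube_trans_length[of \<epsilon> us \<epsilon>' "[lab Y v]"] by (cases us) (auto simp: cube_trans_iff)
    have m: "ts_map ?B ?C id id"
      "ts_map ?B X (\<lambda>\<epsilon>. if \<epsilon> = [False] then x else x') (\<lambda>_. undefined)"
      using x nt by (auto intro!: ts_mapI simp: nt simp del: boundary_simps(5))
    obtain k k' where k: "ts_map ?C X k k'"
      "\<And>u. u \<in> actions ?C \<Longrightarrow> act p (k' u) = [v] ! snd u"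
      by (rule copy_lift[OF cubical_boundary finite_boundary num_to_nat_inj(1) num_snd_inj(2)
            cubical_cube finite_cube num_to_nat_inj(1) num_snd_inj(1) m(1) ph
            lp[OF boundary_in_generating_cofibrations] m(2) \<phi>(1)])
        (use x \<phi>(2,3) in \<open>auto dest: st2\<close>)
    have "(lab Y v, 0) \<in> actions ?C" by simp
    then show ?thesis using k(2)[of "(lab Y v, 0)"] ts_mapD(2)[OF k(1), of "(lab Y v, 0)"] by force
  qed
  have reflects: "(\<alpha>, us, \<beta>) \<in> transitions X"
    if "\<alpha> \<in> states X" "\<beta> \<in> states X" "set us \<subseteq> actions X"
      "(st p \<alpha>, map (act p) us, st p \<beta>) \<in> transitions Y" for \<alpha> us \<beta>
    using that
  proof (induction "length us" arbitrary: \<alpha> us \<beta> rule: less_induct)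
    case less
    note t = less.prems(4)
    have ne: "us \<noteq> []" using weak_tsD(3)[OF wY t] by simp
    show ?case
    proof (cases "length us = 1")
      case True
      then obtain u where u: "us = [u]" "u \<in> actions X" using less.prems(3) by (cases us) auto
      \<comment> \<open>The action \<open>u\<close> occurs somewhere in \<open>X\<close>. The first
        edge of the double transition goes there and the second lies over the wanted transition; the
        lift then carries the same action \<open>u\<close> on the second edge.\<close>
      obtain \<gamma> \<delta> where g: "(\<gamma>, [u], \<delta>) \<in> transitions X" using cubical_ts_used[OF cX u(2)] .
      note wg = weak_tsD[OF wX g]
      let ?C = "cube [lab X u]" and ?D = "double_transition (lab X u)"
      obtain \<phi> where \<phi>: "ts_map ?C X \<phi> (\<lambda>w. [u] ! snd w)" "\<phi> [False] = \<gamma>" "\<phi> [True] = \<delta>"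
        using cube_map_exists[OF cX g] by auto
      define b where "b n = (if n = 1 then st p \<gamma> else if n = 2 then st p \<delta> else if n = 3 then st p \<alpha>
        else st p \<beta>)" for n :: nat
      have st2: "\<epsilon> = [False] \<or> \<epsilon> = [True]" if "length \<epsilon> = Suc 0" for \<epsilon> :: "bool list"
        using that by (cases \<epsilon>) auto
      have one: "us' = [(lab X u, 0)] \<and> \<epsilon> = [False] \<and> \<epsilon>' = [True]"
        if "(\<epsilon>, us', \<epsilon>') \<in> transitions ?C" for \<epsilon> us' \<epsilon>'
        using that cube_trans_length[OF that] st2[of \<epsilon>] st2[of \<epsilon>'] by (cases us') (auto simp: cube_trans_iff)
      have m: "ts_map ?C ?D (\<lambda>\<epsilon>. if \<epsilon> = [True] then 2 else 1) fst"
        by (rule ts_mapI) (auto dest: one)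
      have mb: "ts_map ?D Y b (\<lambda>_. act p u)"
        using CTS_trans[OF ph g] t u less.prems(1,2) wg ph
        by (intro ts_mapI) (auto simp: b_def)
      obtain k k' where k: "ts_map ?D X k k'"
        "\<And>w. w \<in> actions ?C \<Longrightarrow> k' (fst w) = [u] ! snd w"
        "\<And>s. s \<in> states ?D \<Longrightarrow> st p (k s) = b s"
        by (rule copy_lift[OF cubical_cube finite_cube num_to_nat_inj(1) num_snd_inj(1)
              cubical_double_transition _ _ num_to_nat_inj(2) _ m ph lp \<phi>(1) mb, of "\<lambda>_. num 0"])
          (use \<phi>(2,3) st2 in \<open>fastforce simp: generating_cofibrations_def b_def\<close>)+
      have kt: "(k 3, [k' (lab X u)], k 4) \<in> transitions X"
        using ts_mapD(4)[OF k(1), of 3 "[lab X u]" 4] by simp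
      have "k' (lab X u) = u" using k(2)[of "(lab X u, 0)"] by simp
      moreover have "k 3 = \<alpha>" "k 4 = \<beta>"
        using k(3)[of 3] k(3)[of 4] inj[of "k 3" \<alpha>] inj[of "k 4" \<beta>] ts_mapD(1)[OF k(1)] less.prems(1,2)
        by (auto simp: b_def)
      ultimately show ?thesis using kt u by simp
    next
      case False
      let ?xs = "map (lab X) us"
      have labs: "map (lab Y) (map (act p) us) = ?xs" using less.prems(3) ph by auto
      let ?C = "cube ?xs" and ?B = "boundary ?xs"
      obtain \<phi> where \<phi>: "ts_map ?C Y \<phi> (\<lambda>u. map (act p) us ! snd u)"
        "\<phi> (replicate (length us) False) = st p \<alpha>" "\<phi> (replicate (length us) True) = st p \<beta>"
        using cube_map_exists[OF cY t] unfolding labs length_map by blast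
      define a where "a \<epsilon> = inv_into (states X) (st p) (\<phi> \<epsilon>)" for \<epsilon>
      have a: "a \<epsilon> \<in> states X" "st p (a \<epsilon>) = \<phi> \<epsilon>" if "length \<epsilon> = length us" for \<epsilon>
      proof -
        have "\<phi> \<epsilon> \<in> st p ` states X" using ts_mapD(1)[OF \<phi>(1), of \<epsilon>] that surj by simp
        then show "a \<epsilon> \<in> states X" "st p (a \<epsilon>) = \<phi> \<epsilon>" by (auto simp: a_def inv_into_into f_inv_into_f)
      qed
      \<comment> \<open>The states of the cube lift by bijectivity. Transitions of the boundary are
        shorter than \<open>us\<close>, so the induction hypothesis lifts them.\<close>
      have mB: "ts_map ?B X a (\<lambda>u. us ! snd u)"
      proof (rule ts_mapI)
        fix \<epsilon> vs \<epsilon>' assume v: "(\<epsilon>, vs, \<epsilon>') \<in> transitions ?B"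
        then have v': "(\<epsilon>, vs, \<epsilon>') \<in> transitions ?C" "length vs < length us"
          using cube_trans_length[of \<epsilon> vs \<epsilon>' ?xs] by auto
        have s: "set vs \<subseteq> actions ?C" "length \<epsilon> = length us" "length \<epsilon>' = length us"
          using v'(1) by (auto simp: cube_trans_iff)
        have e: "map (act p) (map (\<lambda>u. us ! snd u) vs) = map (\<lambda>u. map (act p) us ! snd u) vs"
          using s by auto
        have "(st p (a \<epsilon>), map (act p) (map (\<lambda>u. us ! snd u) vs), st p (a \<epsilon>')) \<in> transitions Y"
          unfolding e using ts_mapD(4)[OF \<phi>(1) v'(1)] a s by simp
        then show "(a \<epsilon>, map (\<lambda>u. us ! snd u) vs, a \<epsilon>') \<in> transitions X"
          using less.prems(3) s by (intro less.hyps) (use v'(2) a in \<open>fastforce+\<close>)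
      qed (use a less.prems(3) False in auto)
      have mi: "ts_map ?B ?C id id" using False by (intro ts_mapI) auto
      obtain k k' where k: "ts_map ?C X k k'"
        "\<And>u. u \<in> actions ?B \<Longrightarrow> k' u = us ! snd u" "\<And>s. s \<in> states ?C \<Longrightarrow> st p (k s) = \<phi> s"
        by (rule copy_lift[OF cubical_boundary finite_boundary num_to_nat_inj(1) num_snd_inj(2)
            cubical_cube finite_cube num_to_nat_inj(1) num_snd_inj(1) mi ph
            lp[OF boundary_in_generating_cofibrations] mB \<phi>(1)])
          (use ne False a in auto)
      \<comment> \<open>The lift is defined on the full cube; its value on the long transition
        missing from the boundary is the transition sought.\<close>
      have top: "(replicate (length us) False, zip ?xs [0..<length us], replicate (length us) True) \<in> transitions ?C"
        using cube_top[of ?xs] ne by simp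
      have "map k' (zip ?xs [0..<length us]) = us"
        by (rule nth_equalityI) (use k(2) False in auto)
      moreover have "k (replicate (length us) False) = \<alpha>" "k (replicate (length us) True) = \<beta>"
        using k(3) \<phi>(2,3) ts_mapD(1)[OF k(1)] inj less.prems(1,2) by auto
      ultimately show ?thesis using ts_mapD(4)[OF k(1) top] by simp
    qed
  qed
  show "p \<in> trivial_fibrations"
    by (rule trivial_fibrationsI[OF ph bij _ reflects]) (use act_surj ph in auto)
qed

lemma rlp_generating_cofibrations:
  "rlp CTS generating_cofibrations = (trivial_fibrations :: ('u, 'x) ts_arrow set)"
  and rlp_cofibrations: "rlp CTS cofibrations = (trivial_fibrations :: ('u, 'x) ts_arrow set)"
proof -
  have "trivial_fibrations \<subseteq> rlp CTS (cofibrations :: ('u, 'x) ts_arrow set)"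
    using lifts_cofibration_trivial_fibration by (auto simp: rlp_def trivial_fibrations_def)
  moreover have "rlp CTS cofibrations \<subseteq> rlp CTS (generating_cofibrations :: ('u, 'x) ts_arrow set)"
    by (rule CTS.rlp_mono[OF generating_cofibrations_subset])
  ultimately show "rlp CTS generating_cofibrations = (trivial_fibrations :: ('u, 'x) ts_arrow set)"
    "rlp CTS cofibrations = (trivial_fibrations :: ('u, 'x) ts_arrow set)"
    using rlp_generating_cofibrations_subset by auto
qed

lemma llp_rlp_generating_cofibrations:
  "llp CTS (rlp CTS generating_cofibrations) = (cofibrations :: ('u, 'x) ts_arrow set)"
  by (simp add: rlp_generating_cofibrations llp_trivial_fibrations)

end


section \<open>Systems with injective labelling, and the localizer of local equivalences\<close>

lemma closed_under_intersection:
  "closed_under_pushout C V \<Longrightarrow> closed_under_pushout C W \<Longrightarrow> closed_under_pushout C (V \<inter> W)"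
  "closed_under_transfinite_composition C Ords V \<Longrightarrow> closed_under_transfinite_composition C Ords W \<Longrightarrow>
    closed_under_transfinite_composition C Ords (V \<inter> W)"
  unfolding closed_under_pushout_def closed_under_transfinite_composition_def by (blast, blast)

definition label_injective :: "('u, 'u, 'x) ts set" where
  "label_injective = {Y \<in> cts_objects. inj_on (lab Y) (actions Y)}"

lemma label_injective_actions_eq:
  assumes "Y \<in> label_injective" "in_hom CTS f X Y" "in_hom CTS g X Y" "u \<in> actions X"
  shows "act f u = act g u"
proof -
  have "lab Y (act f u) = lab Y (act g u)" using assms by simp
  then show ?thesis
    using assms(1) CTS_st_act(2)[OF assms(2,4)] CTS_st_act(2)[OF assms(3,4)]
    by (auto simp: label_injective_def dest: inj_onD)
qed

text \<open>The label of an action forces its image, so only the states remain to be compared. This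
  reduces most equations between arrows below to equations on states.\<close>

lemma label_injective_arrow_eq:
  assumes "Y \<in> label_injective" "in_hom CTS f X Y" "in_hom CTS g X Y"
    and "\<And>s. s \<in> states X \<Longrightarrow> st f s = st g s"
  shows "f = g"
  by (rule CTS_eqI[OF assms(2-4) label_injective_actions_eq[OF assms(1-3)]])

text \<open>Choosing preimages of actions gives a section of \<open>p\<close>, because
  \<open>p\<close> reflects transitions. Restricting along the section extends arrows into
  \<open>V\<close>: the composite agrees with the given arrow on states, and labels decide the
  rest.\<close>

lemma trivial_fibrations_local:
  "trivial_fibrations \<subseteq> CTS.local_equivalences (label_injective :: ('u, 'u, 'x) ts set)"
proof
  fix p :: "('u, 'x) ts_arrow" assume pt: "p \<in> trivial_fibrations"
  define X Y where d: "X = src p" "Y = tgt p"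
  have p: "in_hom CTS p X Y" "bij_betw (st p) (states X) (states Y)" "act p ` actions X = actions Y"
    and reflects: "\<And>\<alpha> us \<beta>. \<alpha> \<in> states X \<Longrightarrow> \<beta> \<in> states X \<Longrightarrow> set us \<subseteq> actions X \<Longrightarrow>
      (st p \<alpha>, map (act p) us, st p \<beta>) \<in> transitions Y \<Longrightarrow> (\<alpha>, us, \<beta>) \<in> transitions X"
    using pt by (auto simp: trivial_fibrations_def d CTS_arr_hom)
  define \<sigma> where "\<sigma> = inv_into (states X) (st p)"
  define \<tau> where "\<tau> = inv_into (actions X) (act p)"
  have \<sigma>: "\<sigma> y \<in> states X" "st p (\<sigma> y) = y" if "y \<in> states Y" for y
    using that p(2) unfolding \<sigma>_def bij_betw_def by (auto intro: inv_into_into f_inv_into_f)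
  have \<tau>: "\<tau> y \<in> actions X" "act p (\<tau> y) = y" if "y \<in> actions Y" for y
    using that p(3) unfolding \<tau>_def by (auto intro: inv_into_into f_inv_into_f)
  have sec: "ts_map Y X \<sigma> \<tau>"
  proof (rule ts_mapI)
    fix u assume "u \<in> actions Y"
    then show "lab X (\<tau> u) = lab Y u" using \<tau> CTS_st_act(3)[OF p(1)] by metis
  next
    fix \<alpha> us \<beta> assume t: "(\<alpha>, us, \<beta>) \<in> transitions Y"
    note wf = weak_tsD[OF CTS_homD(10)[OF p(1)] t]
    have e: "map (act p) (map \<tau> us) = us"
      unfolding map_map by (rule map_idI) (use wf(4) \<tau> in auto)
    have "(st p (\<sigma> \<alpha>), map (act p) (map \<tau> us), st p (\<sigma> \<beta>)) \<in> transitions Y"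
      unfolding e using t wf \<sigma> by simp
    then show "(\<sigma> \<alpha>, map \<tau> us, \<sigma> \<beta>) \<in> transitions X"
      using wf \<sigma> \<tau> by (intro reflects) auto
  qed (use \<sigma> \<tau> in auto)
  note o = CTS_homD(4,5)[OF p(1)]
  have S: "in_hom CTS (arrow Y X \<sigma> \<tau>) Y X" (is "in_hom CTS ?s _ _")
    by (rule arrow_in_hom[OF o(2,1) sec])
  show "p \<in> CTS.local_equivalences label_injective"
  proof (rule CTS.local_equivalencesI[OF p(1)])
    fix V a assume V: "V \<in> label_injective" and a: "in_hom CTS a X V"
    have "Comp CTS (Comp CTS a ?s) p = a"
    proof (rule label_injective_arrow_eq[OF V _ a])
      show "in_hom CTS (Comp CTS (Comp CTS a ?s) p) X V"
        using p(1) S a by (intro CTS_comp_in_hom)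
      fix x assume x: "x \<in> states X"
      then have "\<sigma> (st p x) = x" using p(2) by (simp add: \<sigma>_def bij_betw_def)
      then show "st (Comp CTS (Comp CTS a ?s) p) x = st a x"
        using x p(1) CTS_homD(2)[OF p(1)] by simp
    qed
    then show "\<exists>b. in_hom CTS b Y V \<and> Comp CTS b p = a" using CTS_comp_in_hom[OF S a] by blast
  next
    fix V b b' assume V: "V \<in> label_injective" and b: "in_hom CTS b Y V" "in_hom CTS b' Y V"
      and eq: "Comp CTS b p = Comp CTS b' p"
    show "b = b'"
    proof (rule label_injective_arrow_eq[OF V b])
      fix y assume "y \<in> states Y"
      then show "st b y = st b' y" using CTS_comp_eqD(1)[OF eq p(1) p(1)] \<sigma> by metis
    qed
  qed
qed

text \<open>Maps into it are exactly the label-preserving maps of actions into \<open>L\<close>,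
  without any condition on states or transitions. With one action for each label it is a terminal
  object; with two it detects subsets of actions.\<close>

definition chaotic_ts :: "'s \<Rightarrow> 'l set \<Rightarrow> ('l \<Rightarrow> 'x) \<Rightarrow> ('s, 'l, 'x) ts" where
  "chaotic_ts s L l =
     \<lparr>states = {s}, actions = L, lab = l,
      transitions = {(\<alpha>, us, \<beta>). \<alpha> = s \<and> \<beta> = s \<and> us \<noteq> [] \<and> set us \<subseteq> L}\<rparr>"

lemma chaotic_ts_simps [simp]:
  "states (chaotic_ts s L l) = {s}" "actions (chaotic_ts s L l) = L" "lab (chaotic_ts s L l) = l"
  "(\<alpha>, us, \<beta>) \<in> transitions (chaotic_ts s L l) \<longleftrightarrow> \<alpha> = s \<and> \<beta> = s \<and> us \<noteq> [] \<and> set us \<subseteq> L"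
  by (auto simp: chaotic_ts_def)

lemma cubical_chaotic_ts: "cubical_ts (chaotic_ts s L l)"
proof (rule cubical_tsI[OF weak_tsI])
  fix \<alpha> us vs \<beta> assume "(\<alpha>, us, \<beta>) \<in> transitions (chaotic_ts s L l)" "mset vs = mset us"
  then show "(\<alpha>, vs, \<beta>) \<in> transitions (chaotic_ts s L l)" using mset_eq_setD[of vs us] by auto
qed auto

lemma ts_map_chaotic_ts:
  assumes "weak_ts X" "\<And>u. u \<in> actions X \<Longrightarrow> g u \<in> L" "\<And>u. u \<in> actions X \<Longrightarrow> l (g u) = lab X u"
  shows "ts_map X (chaotic_ts s L l) (\<lambda>_. s) g"
  using assms weak_tsD[OF assms(1)] by (intro ts_mapI) fastforce+

lemma Well_orderD:
  assumes "Well_order r"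
  shows "i \<in> Field r \<Longrightarrow> (i, i) \<in> r"
    and "(i, j) \<in> r \<Longrightarrow> (j, k) \<in> r \<Longrightarrow> (i, k) \<in> r"
    and "(i, j) \<in> r \<Longrightarrow> (j, i) \<in> r \<Longrightarrow> i = j"
    and "i \<in> Field r \<Longrightarrow> j \<in> Field r \<Longrightarrow> (i, j) \<in> r \<or> (j, i) \<in> r"
proof -
  have r: "refl_on (Field r) r" "trans r" "antisym r" "total_on (Field r) r"
    using assms by (auto simp: well_order_on_def linear_order_on_def partial_order_on_def preorder_on_def)
  show "i \<in> Field r \<Longrightarrow> (i, i) \<in> r" using r(1) by (auto simp: refl_on_def)
  show "(i, j) \<in> r \<Longrightarrow> (j, k) \<in> r \<Longrightarrow> (i, k) \<in> r" using r(2) by (rule transD)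
  show "(i, j) \<in> r \<Longrightarrow> (j, i) \<in> r \<Longrightarrow> i = j" using r(3) by (rule antisymD)
  show "i \<in> Field r \<Longrightarrow> j \<in> Field r \<Longrightarrow> (i, j) \<in> r \<or> (j, i) \<in> r"
    using r(1,4) by (cases "i = j") (auto simp: total_on_def refl_on_def)
qed

context universe
begin

text \<open>Maps into a chaotic system with two actions for each label are subsets of the actions, so
  they test injectivity. The subset used here consists of the actions that eventually agree with
  a given one.\<close>

lemma inj_on_act_colimit:
  fixes D :: "'i \<Rightarrow> ('u, 'u, 'x) ts"
  assumes r: "Well_order r" and seq: "transfinite_sequence CTS r D \<phi>" and A: "A \<subseteq> Field r" "i \<in> A"
    and inj: "\<And>k. k \<in> A \<Longrightarrow> (i, k) \<in> r \<Longrightarrow> inj_on (act (\<phi> i k)) (actions (D i))"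
    and col: "is_colimit CTS A D (edges r A \<phi>) Q l"
  shows "inj_on (act (l i)) (actions (D i))"
proof (rule inj_onI)
  fix u v assume u: "u \<in> actions (D i)" and v: "v \<in> actions (D i)" and uv: "act (l i) u = act (l i) v"
  note W = Well_orderD[OF r]
  have hp: "in_hom CTS (\<phi> j k) (D j) (D k)" if "(j, k) \<in> r" for j k
    using seq that unfolding transfinite_sequence_def by auto
  have pp: "Comp CTS (\<phi> k m) (\<phi> j k) = \<phi> j m" if "(j, k) \<in> r" "(k, m) \<in> r" for j k m
    using seq that unfolding transfinite_sequence_def by blast
  have act_pp: "act (\<phi> k m) (act (\<phi> j k) w) = act (\<phi> j m) w"
    if "(j, k) \<in> r" "(k, m) \<in> r" "w \<in> actions (D j)" for j k m w
    using pp[OF that(1,2)] that(3) CTS_homD(2)[OF hp[OF that(1)]] by (metis CTS_comp_simps(4))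
  have oD: "D k \<in> cts_objects" if "k \<in> A" for k
    using seq that A unfolding transfinite_sequence_def by auto
  have hl: "in_hom CTS (l k) (D k) Q" if "k \<in> A" for k
    using col that unfolding is_colimit_def cocone_def by auto
  define L where "L = pair ` (range code \<times> {num 0, num 1})"
  define V :: "('u, 'u, 'x) ts" where "V = chaotic_ts (num 0) L (\<lambda>w. inv code (fst (unpair w)))"
  have V: "V \<in> cts_objects" unfolding V_def L_def
    by (rule cts_objectsI[OF cubical_chaotic_ts])
      (auto intro: small_finite intro!: small_pairs small_code)
  define E where "E k w \<longleftrightarrow> (\<exists>m\<in>A. (k, m) \<in> r \<and> (i, m) \<in> r \<and> act (\<phi> k m) w = act (\<phi> i m) u)" for k w
  define g where "g k w = pair (code (lab (D k) w), if E k w then num 1 else num 0)" for k w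
  define h where "h k = arrow (D k) V (\<lambda>_. num 0) (g k)" for k
  have h: "in_hom CTS (h k) (D k) V" if "k \<in> A" for k
    unfolding h_def using oD[OF that] V
    by (rule arrow_in_hom)
      (auto simp: V_def L_def g_def inj_code cts_objectsD oD[OF that] intro!: ts_map_chaotic_ts)
  have "cocone CTS A D (edges r A \<phi>) V h"
    unfolding cocone_def
  proof (intro conjI ballI)
    fix x assume "x \<in> edges r A \<phi>"
    then obtain j k where x: "x = (j, \<phi> j k, k)" "j \<in> A" "k \<in> A" "(j, k) \<in> r"
      by (auto simp: edges_def)
    \<comment> \<open>Belonging to the subset is invariant along the sequence. From right to left
      the witness has to be moved to a stage above both \<open>m\<close> and \<open>k\<close>, which
      exists because the order is total.\<close>
    have E: "E k (act (\<phi> j k) w) \<longleftrightarrow> E j w" if w: "w \<in> actions (D j)" for w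
    proof
      assume "E k (act (\<phi> j k) w)"
      then obtain m where m: "m \<in> A" "(k, m) \<in> r" "(i, m) \<in> r"
        "act (\<phi> k m) (act (\<phi> j k) w) = act (\<phi> i m) u"
        unfolding E_def by auto
      then show "E j w" using act_pp[OF x(4) m(2) w] W(2)[OF x(4) m(2)] unfolding E_def by auto
    next
      assume "E j w"
      then obtain m where m: "m \<in> A" "(j, m) \<in> r" "(i, m) \<in> r" "act (\<phi> j m) w = act (\<phi> i m) u"
        unfolding E_def by auto
      obtain n where n: "n \<in> A" "(m, n) \<in> r" "(k, n) \<in> r"
        using W(4)[of m k] W(1)[of m] W(1)[of k] m(1) x(3) A by (meson subsetD)
      have "act (\<phi> k n) (act (\<phi> j k) w) = act (\<phi> i n) u"
        using act_pp[OF x(4) n(3) w] act_pp[OF m(2) n(2) w] act_pp[OF m(3) n(2) u] m(4) by simp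
      then show "E k (act (\<phi> j k) w)" using n W(2)[OF m(3) n(2)] unfolding E_def by auto
    qed
    have "Comp CTS (h k) (\<phi> j k) = h j"
    proof (rule CTS_comp_eqI[OF hp[OF x(4)] h[OF x(3)] h[OF x(2)]])
      fix w assume w: "w \<in> actions (D j)"
      then show "act (h k) (act (\<phi> j k) w) = act (h j) w"
        using hp[OF x(4)] E[OF w] by (simp add: h_def g_def)
    next
      fix s assume "s \<in> states (D j)"
      then show "st (h k) (st (\<phi> j k) s) = st (h j) s"
        using hp[OF x(4)] by (simp add: h_def)
    qed
    then show "case x of (j, m, j') \<Rightarrow> Comp CTS (h j') m = h j" by (simp add: x(1))
  qed (use V h in auto)
  then obtain k where k: "in_hom CTS k Q V" "\<And>j. j \<in> A \<Longrightarrow> Comp CTS k (l j) = h j"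
    using col unfolding is_colimit_def by blast
  have gk: "g i w = act k (act (l i) w)" if "w \<in> actions (D i)" for w
    using arg_cong[OF k(2)[OF A(2)], of act] that CTS_homD(2)[OF hl[OF A(2)]]
    by (metis CTS_comp_simps(4) arrow_simps(4) h_def)
  \<comment> \<open>\<open>u\<close> lies in the subset by reflexivity, so \<open>v\<close> gets the
    same tag. Hence the two agree at some later stage, where the transition map is injective by
    assumption.\<close>
  have "E i u" unfolding E_def using A W(1) by auto
  moreover have "g i u = g i v" using gk[OF u] gk[OF v] uv by simp
  ultimately have "E i v" by (auto simp: g_def split: if_splits)
  then obtain m where "m \<in> A" "(i, m) \<in> r" "act (\<phi> i m) v = act (\<phi> i m) u"
    unfolding E_def by auto
  then show "u = v" using inj u v by (metis inj_onD)
qed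

text \<open>At successors injections are composed; at limit stages and in the final colimit,
  injectivity is the content of \<open>inj_on_act_colimit\<close>.\<close>

lemma closed_under_transfinite_composition_cofibrations:
  "closed_under_transfinite_composition CTS (small_ordinals :: 'u rel set)
     (cofibrations :: ('u, 'x) ts_arrow set)"
  unfolding closed_under_transfinite_composition_def
proof (intro ballI allI impI, elim conjE)
  fix r :: "'u rel" and D :: "'u \<Rightarrow> ('u, 'u, 'x) ts" and \<phi> Q l i0
  assume "r \<in> small_ordinals" and seq: "transfinite_sequence CTS r D \<phi>"
    and cov: "\<forall>i j. covers r i j \<longrightarrow> \<phi> i j \<in> cofibrations"
    and col: "is_colimit CTS (Field r) D (edges r (Field r) \<phi>) Q l" and i0: "least_index r i0"
  then have r: "Well_order r" by (simp add: small_ordinals_def)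
  note W = Well_orderD[OF r]
  have hp: "in_hom CTS (\<phi> j k) (D j) (D k)" if "(j, k) \<in> r" for j k
    using seq that unfolding transfinite_sequence_def by auto
  have ident: "inj_on (act (\<phi> j j)) (actions (D j))" if "j \<in> Field r" for j
  proof -
    have "\<phi> j j = Ident CTS (D j)" using seq that unfolding transfinite_sequence_def by auto
    then show ?thesis by (auto simp: inj_on_def)
  qed
  have "\<forall>i. (i, j) \<in> r \<longrightarrow> inj_on (act (\<phi> i j)) (actions (D i))" if "j \<in> Field r" for j
    using r that
  proof (induction j rule: CTS.well_order_induct_limit)
    case (least j)
    then have "i = j" if "(i, j) \<in> r" for i
      using that W(3) unfolding least_index_def by (meson FieldI1)
    then show ?case using ident least unfolding least_index_def by blast
  next
    case (successor i j)
    then have ij: "(i, j) \<in> r" by (auto simp: covers_def)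
    show ?case
    proof (intro allI impI)
      fix k assume k: "(k, j) \<in> r"
      show "inj_on (act (\<phi> k j)) (actions (D k))"
      proof (cases "k = j")
        case True
        then show ?thesis using ident k by (auto simp: FieldI1)
      next
        case False
        then have ki: "(k, i) \<in> r"
          using successor(1) k W(4)[of k i] W(1) unfolding covers_def by (metis FieldI1)
        have "\<phi> k j = Comp CTS (\<phi> i j) (\<phi> k i)"
          using seq ki ij unfolding transfinite_sequence_def by metis
        then have e: "act (\<phi> k j) u = act (\<phi> i j) (act (\<phi> k i) u)" if "u \<in> actions (D k)" for u
          using that CTS_homD(2)[OF hp[OF ki]] by simp
        have "\<phi> i j \<in> cofibrations" using cov successor(1) by auto
        then have "inj_on (act (\<phi> i j)) (actions (D i))"
          using CTS_homD(2)[OF hp[OF ij]] by (simp add: cofibrations_def)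
        moreover have "inj_on (act (\<phi> k i)) (actions (D k))" using successor(2) ki by auto
        ultimately show ?thesis
          using hp[OF ki] by (intro inj_onI) (metis CTS_st_act(2) e inj_onD)
      qed
    qed
  next
    case (limit j)
    have c: "is_colimit CTS (below r j) D (edges r (below r j) \<phi>) (D j) (\<lambda>i. \<phi> i j)"
      using seq limit(1) unfolding transfinite_sequence_def by auto
    show ?case
    proof (intro allI impI)
      fix i assume i: "(i, j) \<in> r"
      show "inj_on (act (\<phi> i j)) (actions (D i))"
      proof (cases "i = j")
        case True
        then show ?thesis using ident i by (auto simp: FieldI1)
      next
        case False
        then have "i \<in> below r j" using i by (auto simp: below_def)
        moreover have "below r j \<subseteq> Field r" by (auto simp: below_def FieldI1)
        ultimately show ?thesis using limit(2)
          by (intro inj_on_act_colimit[OF r seq _ _ _ c]) auto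
      qed
    qed
  qed
  moreover have F: "i0 \<in> Field r" using i0 by (auto simp: least_index_def)
  ultimately have "inj_on (act (l i0)) (actions (D i0))"
    by (intro inj_on_act_colimit[OF r seq _ _ _ col]) (auto simp: FieldI2)
  moreover have "in_hom CTS (l i0) (D i0) Q"
    using col F unfolding is_colimit_def cocone_def by auto
  ultimately show "l i0 \<in> cofibrations" by (simp add: cofibrationsI)
qed

lemma trivial_fibrations_arr: "(trivial_fibrations :: ('u, 'x) ts_arrow set) \<subseteq> Arr CTS"
  by (auto simp: trivial_fibrations_def)

lemma grothendieck_localizer_local_equivalences:
  "grothendieck_localizer CTS (small_ordinals :: 'u rel set) (cofibrations :: ('u, 'x) ts_arrow set)
     (CTS.local_equivalences label_injective)"
  unfolding grothendieck_localizer_def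
proof (intro conjI closed_under_intersection)
  show "closed_under_pushout CTS (cofibrations :: ('u, 'x) ts_arrow set)"
    using CTS.closed_under_pushout_llp[OF trivial_fibrations_arr] by (simp add: llp_trivial_fibrations)
  show "CTS.local_equivalences label_injective \<subseteq> (Arr CTS :: ('u, 'x) ts_arrow set)"
    by (auto simp: CTS.local_equivalences_def)
  show "rlp CTS cofibrations \<subseteq> CTS.local_equivalences (label_injective :: ('u, 'u, 'x) ts set)"
    by (simp add: rlp_cofibrations trivial_fibrations_local)
  show "closed_under_transfinite_composition CTS (small_ordinals :: 'u rel set)
      (CTS.local_equivalences (label_injective :: ('u, 'u, 'x) ts set))"
    by (rule CTS.closed_under_transfinite_composition_local) (simp add: small_ordinals_def)
qed (rule CTS.two_out_of_three_local CTS.closed_under_pushout_local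
    closed_under_transfinite_composition_cofibrations)+


section \<open>Factorization through local equivalences\<close>

lemma label_quotient_label_injective:
  fixes X :: "('u, 'u, 'x) ts"
  shows "X \<in> cts_objects \<Longrightarrow> label_quotient X \<in> label_injective"
  by (auto simp: label_injective_def inj_on_lab_label_rep cts_objectsD small_image
      intro!: cts_objectsI cubical_label_quotient)

text \<open>The intermediate object is the pullback, along the map between the reflections of \<open>X\<close> and
  \<open>Y\<close>, of the reflection of \<open>X\<close> and \<open>Y\<close>. As an action it has every pair of an action of \<open>X\<close>,
  rather than of its reflection, and an action of \<open>Y\<close>, so that \<open>X\<close> embeds.\<close>

lemma factor_local_equivalence:
  fixes f :: "('u, 'x) ts_arrow"
  assumes f: "in_hom CTS f X Y"
  obtains i p Z where "in_hom CTS i X Z" "in_hom CTS p Z Y" "i \<in> cofibrations"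
    "i \<in> CTS.local_equivalences label_injective"
    "p \<in> rlp CTS (cofibrations \<inter> CTS.local_equivalences label_injective)" "Comp CTS p i = f"
proof -
  note o = CTS_homD(4,5)[OF f]
  note w = CTS_homD(9,10)[OF f]
  let ?Q = "label_quotient X" and ?R = "label_quotient Y"
  note Qi = label_quotient_label_injective[OF o(1)] and Ri = label_quotient_label_injective[OF o(2)]
  have Qo: "?Q \<in> cts_objects" and Ro: "?R \<in> cts_objects" using Qi Ri by (auto simp: label_injective_def)
  have Qinj: "inj_on (lab ?Q) (actions ?Q)" and Rinj: "inj_on (lab ?R) (actions ?R)"
    using Qi Ri by (auto simp: label_injective_def)
  note wQ = cts_objectsD(2)[OF Qo] and wR = cts_objectsD(2)[OF Ro]
  define L where "L = {w \<in> pair ` (actions X \<times> actions Y). lab X (fst (unpair w)) = lab Y (snd (unpair w))}"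
  define q where "q w = label_rep X (fst (unpair w))" for w
  define r where "r w = snd (unpair w)" for w
  define N :: "('u, 'u, 'x) ts" where "N = \<lparr>states = states X, actions = L, lab = (\<lambda>w. lab X (fst (unpair w))),
      transitions = {(\<alpha>, us, \<beta>). set us \<subseteq> L \<and> (\<alpha>, map q us, \<beta>) \<in> transitions ?Q \<and>
        (st f \<alpha>, map r us, st f \<beta>) \<in> transitions Y}\<rparr>"
  have N: "states N = states X" "actions N = L" "\<And>w. lab N w = lab X (fst (unpair w))"
    "\<And>\<alpha> us \<beta>. (\<alpha>, us, \<beta>) \<in> transitions N \<longleftrightarrow> set us \<subseteq> L \<and> (\<alpha>, map q us, \<beta>) \<in> transitions ?Q \<and>
        (st f \<alpha>, map r us, st f \<beta>) \<in> transitions Y"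
    by (auto simp: N_def)
  have wN: "weak_ts N"
  proof (rule weak_tsI)
    fix \<alpha> us \<beta> assume "(\<alpha>, us, \<beta>) \<in> transitions N"
    then show "\<alpha> \<in> states N \<and> \<beta> \<in> states N \<and> us \<noteq> [] \<and> set us \<subseteq> actions N"
      using weak_tsD[OF wQ, of \<alpha> "map q us" \<beta>] by (auto simp: N)
  next
    fix \<alpha> us vs \<beta> assume t: "(\<alpha>, us, \<beta>) \<in> transitions N" "mset vs = mset us"
    then show "(\<alpha>, vs, \<beta>) \<in> transitions N"
      using weak_ts_mset[OF wQ, of \<alpha> "map q us" \<beta> "map q vs"]
        weak_ts_mset[OF w(2), of "st f \<alpha>" "map r us" "st f \<beta>" "map r vs"] mset_eq_setD[OF t(2)]
      by (simp add: N)
  next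
    fix \<alpha> \<beta> \<nu>1 \<nu>2 us vs ws
    assume "us \<noteq> []" "vs \<noteq> []" "ws \<noteq> []" "(\<alpha>, us @ vs @ ws, \<beta>) \<in> transitions N"
      "(\<alpha>, us, \<nu>1) \<in> transitions N" "(\<nu>1, vs @ ws, \<beta>) \<in> transitions N"
      "(\<alpha>, us @ vs, \<nu>2) \<in> transitions N" "(\<nu>2, ws, \<beta>) \<in> transitions N"
    then show "(\<nu>1, vs, \<nu>2) \<in> transitions N"
      using weak_ts_patch[OF wQ, of "map q us" "map q vs" "map q ws" \<alpha> \<beta> \<nu>1 \<nu>2]
        weak_ts_patch[OF w(2), of "map r us" "map r vs" "map r ws" "st f \<alpha>" "st f \<beta>" "st f \<nu>1" "st f \<nu>2"]
      by (simp add: N)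
  qed
  \<comment> \<open>In the pullback \<open>N\<close> a transition may lack intermediate states,
    since those found in \<open>?Q\<close> and in \<open>Y\<close> need not match under
    \<open>st f\<close>. The coreflection repairs this.\<close>
  let ?Z = "cubical_core N"
  have sL: "small L" by (rule small_subset[OF small_pairs]) (use o in \<open>auto simp: L_def cts_objectsD\<close>)
  have Zo: "?Z \<in> cts_objects"
    by (rule cts_objectsI[OF cubical_cubical_core[OF wN]])
      (use sL o in \<open>auto simp: N cts_objectsD intro: small_subset\<close>)
  have mN: "ts_map N ?Q (\<lambda>s. s) q" "ts_map N Y (st f) r"
    using f by (auto intro!: ts_mapI simp: N q_def r_def L_def label_rep)
  have mZ: "ts_map ?Z ?Q (\<lambda>s. s) q" "ts_map ?Z Y (st f) r"
    using ts_map_comp[OF ts_map_from_cubical_core mN(1)] ts_map_comp[OF ts_map_from_cubical_core mN(2)]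
    by simp_all
  have mi: "ts_map X ?Z (\<lambda>s. s) (\<lambda>u. pair (u, act f u))"
  proof (rule ts_map_to_cubical_core[OF CTS_homD(7)[OF f] ts_mapI])
    fix \<alpha> us \<beta> assume t: "(\<alpha>, us, \<beta>) \<in> transitions X"
    have "(\<alpha>, map (label_rep X) us, \<beta>) \<in> transitions ?Q"
      using ts_mapD(4)[OF ts_map_label_quotient t] .
    moreover have "set (map (\<lambda>u. pair (u, act f u)) us) \<subseteq> L"
      using weak_tsD(4)[OF w(1) t] f by (auto simp: L_def)
    ultimately show "(\<alpha>, map (\<lambda>u. pair (u, act f u)) us, \<beta>) \<in> transitions N"
      using CTS_trans[OF f t] by (simp add: N q_def r_def comp_def)
  qed (use f in \<open>auto simp: N L_def\<close>)
  define i where "i = arrow X ?Z (\<lambda>s. s) (\<lambda>u. pair (u, act f u))"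
  define p where "p = arrow ?Z Y (st f) r"
  define e where "e = arrow ?Z ?Q (\<lambda>s. s) q"
  have i: "in_hom CTS i X ?Z" unfolding i_def by (rule arrow_in_hom[OF o(1) Zo mi])
  have p: "in_hom CTS p ?Z Y" unfolding p_def by (rule arrow_in_hom[OF Zo o(2) mZ(2)])
  have e: "in_hom CTS e ?Z ?Q" unfolding e_def by (rule arrow_in_hom[OF Zo Qo mZ(1)])
  have iC: "i \<in> cofibrations"
    by (rule cofibrationsI[OF i]) (auto simp: i_def inj_on_def)
  have pi: "Comp CTS p i = f"
    using CTS_st_act[OF i]
    by (intro CTS_comp_eqI[OF i p f]) (auto simp: i_def p_def N r_def)
  \<comment> \<open>The composite of \<open>i\<close> and \<open>e\<close> is the reflection map of
    \<open>X\<close>, so an arrow into \<open>V\<close> first factors through \<open>?Q\<close> and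
    then extends by way of \<open>e\<close>. Uniqueness holds because \<open>i\<close> is the
    identity on states.\<close>
  have iW: "i \<in> CTS.local_equivalences label_injective"
  proof (rule CTS.local_equivalencesI[OF i])
    fix V a assume V: "V \<in> label_injective" and a: "in_hom CTS a X V"
    have Vi: "inj_on (lab V) (actions V)" using V by (auto simp: label_injective_def)
    have "ts_map ?Q V (st a) (act a)"
      by (rule ts_map_from_label_quotient(1)[OF CTS_homD(6,9,10)[OF a] Vi])
    then have k: "in_hom CTS (arrow ?Q V (st a) (act a)) ?Q V" (is "in_hom CTS ?k _ _")
      using CTS_homD(5)[OF a] by (intro arrow_in_hom Qo)
    have "Comp CTS (Comp CTS ?k e) i = a"
    proof (rule label_injective_arrow_eq[OF V CTS_comp_in_hom[OF i CTS_comp_in_hom[OF e k]] a])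
      fix s assume "s \<in> states X"
      then show "st (Comp CTS (Comp CTS ?k e) i) s = st a s"
        using CTS_homD(2)[OF i] CTS_homD(2)[OF e] by (simp add: i_def e_def N)
    qed
    then show "\<exists>b. in_hom CTS b ?Z V \<and> Comp CTS b i = a" using CTS_comp_in_hom[OF e k] by blast
  next
    fix V b b' assume V: "V \<in> label_injective" and b: "in_hom CTS b ?Z V" "in_hom CTS b' ?Z V"
      and eq: "Comp CTS b i = Comp CTS b' i"
    show "b = b'"
    proof (rule label_injective_arrow_eq[OF V b])
      fix s assume "s \<in> states ?Z"
      then show "st b s = st b' s"
        using CTS_comp_eqD(1)[OF eq i i, of s] by (simp add: i_def N)
    qed
  qed
  have pR: "p \<in> rlp CTS (cofibrations \<inter> CTS.local_equivalences label_injective)"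
    unfolding rlp_def
  proof (intro CollectI conjI ballI)
    show "p \<in> Arr CTS" using CTS_homD(1)[OF p] .
    fix j assume j': "j \<in> cofibrations \<inter> CTS.local_equivalences (label_injective :: ('u, 'u, 'x) ts set)"
    define A B where "A = src j" and "B = tgt j"
    have j: "in_hom CTS j A B" "inj_on (act j) (actions A)"
      using j' by (auto simp: cofibrations_def A_def B_def CTS_arr_hom)
    show "lifts CTS j p"
    proof (subst CTS.lifts_iff[OF j(1) p], intro allI impI, elim conjE)
      fix a b assume a: "in_hom CTS a A ?Z" and b: "in_hom CTS b B Y" and sq: "Comp CTS p a = Comp CTS b j"
      note sqs = CTS_comp_eqD[OF sq a j(1)]
      have jW: "j \<in> CTS.local_equivalences label_injective" using j' by auto
      obtain h where h: "in_hom CTS h B ?Q" "Comp CTS h j = Comp CTS e a"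
        using CTS.local_equivalences_ex[OF jW j(1) Qi CTS_comp_in_hom[OF a e]] .
      note hs = CTS_comp_eqD[OF h(2) j(1) a]
      note m1 = ts_map_comp[OF CTS_homD(6)[OF f] ts_map_label_quotient]
      have QR: "in_hom CTS (arrow ?Q ?R (st f) (\<lambda>u. label_rep Y (act f u))) ?Q ?R" (is "in_hom CTS ?c _ _")
        by (rule arrow_in_hom[OF Qo Ro ts_map_from_label_quotient(1)[OF m1 w(1) wR Rinj]])
      have YR: "in_hom CTS (arrow Y ?R (\<lambda>s. s) (label_rep Y)) Y ?R" (is "in_hom CTS ?d _ _")
        by (rule arrow_in_hom[OF o(2) Ro ts_map_label_quotient])
      \<comment> \<open>The extension \<open>h\<close> and the given \<open>b\<close> agree in the
        reflection of \<open>Y\<close> since they do so after \<open>j\<close>. As reflections do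
        not change states, this yields \<open>fh\<close>, the compatibility needed to enter the
        pullback.\<close>
      have "Comp CTS ?c h = Comp CTS ?d b"
      proof (rule CTS.local_equivalences_unique[OF jW j(1) Ri CTS_comp_in_hom[OF h(1) QR] CTS_comp_in_hom[OF b YR]])
        show "Comp CTS (Comp CTS ?c h) j = Comp CTS (Comp CTS ?d b) j"
        proof (rule label_injective_arrow_eq[OF Ri CTS_comp_in_hom[OF j(1) CTS_comp_in_hom[OF h(1) QR]]
              CTS_comp_in_hom[OF j(1) CTS_comp_in_hom[OF b YR]]])
          fix s assume s: "s \<in> states A"
          have "st h (st j s) = st a s" "st f (st a s) = st b (st j s)" "st a s \<in> states X"
            "st b (st j s) \<in> states Y"
            using hs(1)[OF s] sqs(1)[OF s] CTS_st_act(1)[OF a s] CTS_st_act(1)[OF b CTS_st_act(1)[OF j(1) s]]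
            by (simp_all add: e_def p_def N)
          then show "st (Comp CTS (Comp CTS ?c h) j) s = st (Comp CTS (Comp CTS ?d b) j) s"
            using s CTS_homD(2)[OF j(1)] CTS_homD(2)[OF h(1)] CTS_homD(2)[OF b] CTS_st_act(1)[OF j(1) s]
            by simp
        qed
      qed
      note cd = CTS_comp_eqD(1)[OF this h(1) b]
      have fh: "st f (st h s) = st b s" if "s \<in> states B" for s
        using cd[OF that] CTS_st_act(1)[OF h(1) that] CTS_st_act(1)[OF b that] by simp
      \<comment> \<open>Actions from \<open>A\<close> must follow \<open>a\<close> to make the upper
        triangle commute; both branches have the same image in \<open>?Q\<close> and in
        \<open>Y\<close>, so transitions are not affected by the choice.\<close>
      define k where "k v = (if v \<in> act j ` actions A then act a (inv_into (actions A) (act j) v)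
        else pair (act h v, act b v))" for v
      have k: "k v \<in> L \<and> q (k v) = act h v \<and> r (k v) = act b v \<and> lab X (fst (unpair (k v))) = lab B v"
        if v: "v \<in> actions B" for v
      proof (cases "v \<in> act j ` actions A")
        case True
        then obtain u where u: "u \<in> actions A" "v = act j u" by auto
        then have kv: "k v = act a u" using j(2) by (simp add: k_def)
        have au: "act a u \<in> actions ?Z" "lab ?Z (act a u) = lab A u" using CTS_st_act[OF a] u by auto
        then have "act a u \<in> L" by (simp add: N)
        moreover have "q (act a u) = act h v" using hs(2)[OF u(1)] au u(2) by (simp add: e_def)
        moreover have "r (act a u) = act b v" using sqs(2)[OF u(1)] au u(2) by (simp add: p_def)
        moreover have "lab X (fst (unpair (act a u))) = lab B v"
          using au(2) CTS_st_act(3)[OF j(1) u(1)] u(2) by (simp add: N)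
        ultimately show ?thesis by (simp add: kv)
      next
        case False
        have hv: "act h v \<in> label_rep X ` actions X" "lab X (act h v) = lab B v"
          using CTS_st_act(2,3)[OF h(1) v] by auto
        then obtain x where x: "x \<in> actions X" "act h v = label_rep X x" by auto
        \<comment> \<open>\<open>act h v\<close> is an action of \<open>?Q\<close>, hence already a
          representative, and it can serve as the first component of the pair.\<close>
        have "label_rep X (act h v) = act h v"
          using label_rep(2)[OF x(1)] unfolding x(2) by (rule label_rep_eq)
        moreover have "act h v \<in> actions X" using label_rep(1)[OF x(1)] x(2) by simp
        ultimately show ?thesis
          using hv CTS_st_act(2,3)[OF b v] False by (simp add: k_def q_def r_def L_def)
      qed
      have "ts_map B ?Z (st h) k"
      proof (rule ts_map_to_cubical_core[OF CTS_homD(7)[OF b] ts_mapI])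
        fix s assume "s \<in> states B"
        then show "st h s \<in> states N" using CTS_st_act(1)[OF h(1)] by (simp add: N)
      next
        fix \<alpha> us \<beta> assume t: "(\<alpha>, us, \<beta>) \<in> transitions B"
        note wf = weak_tsD[OF CTS_homD(9)[OF b] t]
        have "map q (map k us) = map (act h) us" "map r (map k us) = map (act b) us" "set (map k us) \<subseteq> L"
          using wf(4) k by auto
        then show "(st h \<alpha>, map k us, st h \<beta>) \<in> transitions N"
          unfolding N using CTS_trans[OF h(1) t] CTS_trans[OF b t] fh wf by metis
      qed (use k in \<open>auto simp: N\<close>)
      then have K: "in_hom CTS (arrow B ?Z (st h) k) B ?Z" (is "in_hom CTS ?k _ _")
        by (rule arrow_in_hom[OF CTS_homD(4)[OF b] Zo])
      have "Comp CTS ?k j = a"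
      proof (rule CTS_comp_eqI[OF j(1) K a])
        fix s assume s: "s \<in> states A"
        show "st ?k (st j s) = st a s"
          using hs(1)[OF s] CTS_st_act(1)[OF j(1) s] CTS_st_act(1)[OF a s] by (simp add: e_def)
      next
        fix u assume u: "u \<in> actions A"
        show "act ?k (act j u) = act a u"
          using CTS_st_act(2)[OF j(1) u] u j(2) by (simp add: k_def)
      qed
      moreover have "Comp CTS p ?k = b"
      proof (rule CTS_comp_eqI[OF K p b])
        fix s assume s: "s \<in> states B"
        show "st p (st ?k s) = st b s"
          using CTS_st_act(1)[OF K s] s fh[OF s] by (simp add: p_def)
      next
        fix u assume u: "u \<in> actions B"
        show "act p (act ?k u) = act b u"
          using CTS_st_act(2)[OF K u] u k[OF u] by (simp add: p_def)
      qed
      ultimately show "\<exists>h. in_hom CTS h B ?Z \<and> Comp CTS h j = a \<and> Comp CTS p h = b" using K by blast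
    qed
  qed
  show ?thesis by (rule that[OF i p iC iW pR pi])
qed

lemma model_structure_local_equivalences:
  "model_structure CTS (model_of CTS (cofibrations :: ('u, 'x) ts_arrow set)
     (CTS.local_equivalences label_injective))"
proof (rule CTS.model_structure_model_of[OF llp_trivial_fibrations[symmetric] trivial_fibrations_arr])
  show "CTS.local_equivalences label_injective \<subseteq> (Arr CTS :: ('u, 'x) ts_arrow set)"
    by (auto simp: CTS.local_equivalences_def)
  show "rlp CTS cofibrations \<subseteq> CTS.local_equivalences (label_injective :: ('u, 'u, 'x) ts set)"
    by (simp add: rlp_cofibrations trivial_fibrations_local)
  show "factors_through CTS (cofibrations :: ('u, 'x) ts_arrow set) (rlp CTS cofibrations)"
    unfolding factors_through_def rlp_cofibrations
  proof
    fix f :: "('u, 'x) ts_arrow" assume "f \<in> Arr CTS"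
    then have "in_hom CTS f (src f) (tgt f)" by (simp add: CTS_arr_hom)
    from factor_cofibration_trivial_fibration[OF this]
    show "\<exists>i\<in>cofibrations. \<exists>p\<in>trivial_fibrations. Cod CTS i = Dom CTS p \<and> Comp CTS p i = f"
      by (metis CTS_homD(2,3) CTS_simps(2,3))
  qed
  show "factors_through CTS (cofibrations \<inter> CTS.local_equivalences (label_injective :: ('u, 'u, 'x) ts set))
    (rlp CTS (cofibrations \<inter> CTS.local_equivalences label_injective))"
    unfolding factors_through_def
  proof
    fix f :: "('u, 'x) ts_arrow" assume "f \<in> Arr CTS"
    then have "in_hom CTS f (src f) (tgt f)" by (simp add: CTS_arr_hom)
    from factor_local_equivalence[OF this]
    show "\<exists>i\<in>cofibrations \<inter> CTS.local_equivalences label_injective.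
        \<exists>p\<in>rlp CTS (cofibrations \<inter> CTS.local_equivalences label_injective).
          Cod CTS i = Dom CTS p \<and> Comp CTS p i = f"
      by (metis CTS_homD(2,3) CTS_simps(2,3) IntI)
  qed
qed (rule CTS.two_out_of_three_local CTS.closed_under_retract_local)+

section \<open>Extension of arrows into combinatorially fibrant systems\<close>

lemma combinatorially_fibrant_extension:
  fixes X :: "('u, 'u, 'x) ts"
  assumes X: "X \<in> cts_objects" "combinatorially_fibrant X"
    and i: "in_hom CTS i A B" "i \<in> cofibrations" "i \<in> CTS.local_equivalences label_injective"
    and a: "in_hom CTS a A X"
  obtains h where "in_hom CTS h B X" "Comp CTS h i = a"
proof -
  have swap: "(\<alpha>, vs, \<beta>) \<in> transitions X"
    if "(\<alpha>, us, \<beta>) \<in> transitions X" "length vs = length us" "set vs \<subseteq> actions X"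
      "\<And>n. n < length us \<Longrightarrow> lab X (us ! n) = lab X (vs ! n)" for \<alpha> us vs \<beta>
    using X(2)[unfolded combinatorially_fibrant_def, rule_format, of "length us" \<alpha> \<beta> us vs]
      weak_tsD[OF cts_objectsD(2)[OF X(1)] that(1)] that by (simp add: Suc_le_eq)
  \<comment> \<open>The full subsystem on the representatives. Combinatorial fibrancy makes
    \<open>label_rep\<close> a map onto it, so that it can stand in for the reflection while still
    mapping back to \<open>X\<close> by inclusion.\<close>
  let ?X = "pull_actions X (label_rep X ` actions X) (\<lambda>u. u)"
  have rep: "(\<lambda>u. u) ` (label_rep X ` actions X) \<subseteq> actions X" by (auto simp: label_rep)
  have Xo: "?X \<in> cts_objects"
    using X by (intro cts_objectsI cubical_pull_actions rep) (auto simp: cts_objectsD small_image)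
  then have Xi: "?X \<in> label_injective"
    using inj_on_lab_label_rep[of X] by (simp add: label_injective_def inj_on_def)
  have c: "in_hom CTS (arrow X ?X (\<lambda>s. s) (label_rep X)) X ?X" (is "in_hom CTS ?c _ _")
  proof (rule arrow_in_hom[OF X(1) Xo ts_mapI])
    fix \<alpha> us \<beta> assume t: "(\<alpha>, us, \<beta>) \<in> transitions X"
    note wf = weak_tsD[OF cts_objectsD(2)[OF X(1)] t]
    have "(\<alpha>, map (label_rep X) us, \<beta>) \<in> transitions X"
      by (rule swap[OF t]) (use wf(4) in \<open>auto simp: label_rep subset_iff\<close>)
    then show "(\<alpha>, map (label_rep X) us, \<beta>) \<in> transitions ?X" using wf by auto
  qed (auto simp: label_rep)
  obtain g where g: "in_hom CTS g B ?X" "Comp CTS g i = Comp CTS ?c a"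
    using CTS.local_equivalences_ex[OF i(3,1) Xi CTS_comp_in_hom[OF a c]] .
  note gs = CTS_comp_eqD[OF g(2) i(1) a]
  have inj: "inj_on (act i) (actions A)" using i CTS_homD(2)[OF i(1)] by (simp add: cofibrations_def)
  \<comment> \<open>This differs from \<open>g\<close> only by exchanging actions for others with
    the same label. By \<open>swap\<close> it still sends transitions to transitions, and it
    restores the original values of \<open>a\<close>.\<close>
  define k where "k w = (if w \<in> act i ` actions A then act a (inv_into (actions A) (act i) w) else act g w)" for w
  have k: "k w \<in> actions X \<and> lab X (k w) = lab B w" if w: "w \<in> actions B" for w
  proof (cases "w \<in> act i ` actions A")
    case True
    then obtain u where u: "u \<in> actions A" "w = act i u" by auto
    then have "k w = act a u" using inj by (simp add: k_def)
    then show ?thesis using a u CTS_st_act(3)[OF i(1) u(1)] by simp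
  next
    case False
    then show ?thesis using CTS_st_act(2,3)[OF g(1) w] label_rep(1) by (auto simp: k_def)
  qed
  have "ts_map B X (st g) k"
  proof (rule ts_mapI)
    fix \<alpha> us \<beta> assume t: "(\<alpha>, us, \<beta>) \<in> transitions B"
    note wf = weak_tsD[OF CTS_homD(9)[OF g(1)] t]
    have gt: "(st g \<alpha>, map (act g) us, st g \<beta>) \<in> transitions X" using CTS_trans[OF g(1) t] by simp
    show "(st g \<alpha>, map k us, st g \<beta>) \<in> transitions X"
    proof (rule swap[OF gt])
      fix n assume n: "n < length (map (act g) us)"
      then have "us ! n \<in> actions B" using wf(4) by auto
      then show "lab X (map (act g) us ! n) = lab X (map k us ! n)"
        using n k CTS_st_act(3)[OF g(1)] by simp
    qed (use wf(4) k in auto)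
  qed (use k CTS_st_act(1)[OF g(1)] in auto)
  then have K: "in_hom CTS (arrow B X (st g) k) B X" (is "in_hom CTS ?k _ _")
    by (rule arrow_in_hom[OF CTS_homD(5)[OF i(1)] X(1)])
  have "Comp CTS ?k i = a"
  proof (rule CTS_comp_eqI[OF i(1) K a])
    fix s assume s: "s \<in> states A"
    show "st ?k (st i s) = st a s"
      using gs(1)[OF s] CTS_st_act(1)[OF i(1) s] CTS_st_act(1)[OF a s] by simp
  next
    fix u assume u: "u \<in> actions A"
    show "act ?k (act i u) = act a u"
      using CTS_st_act(2)[OF i(1) u] u inj by (simp add: k_def)
  qed
  with K show ?thesis by (rule that)
qed

text \<open>A chaotic system with one action for each label: the labels form a small set, and an
  arrow into it is determined by the labels of the actions.\<close>

lemma terminal_CTS: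
  obtains T :: "('u, 'u, 'x) ts" where "terminal CTS T"
proof -
  define T :: "('u, 'u, 'x) ts" where "T = chaotic_ts (num 0) (range code) (inv code)"
  have To: "T \<in> cts_objects" unfolding T_def
    by (rule cts_objectsI[OF cubical_chaotic_ts]) (auto intro: small_finite small_code)
  then have Ti: "T \<in> label_injective"
    using inj_code by (auto simp: label_injective_def T_def inj_on_def)
  have "\<exists>!f. in_hom CTS f X T" if X: "X \<in> cts_objects" for X
  proof (rule ex_ex1I)
    have "ts_map X T (\<lambda>_. num 0) (\<lambda>u. code (lab X u))"
      unfolding T_def by (rule ts_map_chaotic_ts[OF cts_objectsD(2)[OF X]]) (simp_all add: inj_code)
    from arrow_in_hom[OF X To this] show "\<exists>f. in_hom CTS f X T" by blast
    fix f g assume fg: "in_hom CTS f X T" "in_hom CTS g X T"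
    show "f = g"
    proof (rule label_injective_arrow_eq[OF Ti fg])
      fix s assume "s \<in> states X"
      then show "st f s = st g s"
        using CTS_st_act(1)[OF fg(1), of s] CTS_st_act(1)[OF fg(2), of s] by (simp add: T_def)
    qed
  qed
  then have "terminal CTS T" using To unfolding terminal_def CTS_simps by blast
  then show ?thesis by (rule that)
qed

end


section \<open>Cubification\<close>

lemma cubes_over_iff:
  "c \<in> cubes_over X \<longleftrightarrow> is_cube (src c) \<and> in_hom CTS c (src c) X"
  unfolding cubes_over_def CTS_arr_hom using CTS_homD(3) by blast

lemma is_cube_discrete_ts: "is_cube (discrete_ts {s} :: ('s, 'l, 'x) ts)"
proof -
  have "transitions (cube ([] :: 'x list)) = {}"
    by (auto simp: cube_def)
  then have "ts_iso (cube ([] :: 'x list)) (discrete_ts {s} :: ('s, 'l, 'x) ts) (\<lambda>_. s) (\<lambda>_. undefined)"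
    unfolding ts_iso_def
    by (intro conjI exI[of _ "\<lambda>_. []"] exI[of _ "\<lambda>_. undefined"] ts_mapI) auto
  then show ?thesis unfolding is_cube_def by blast
qed

definition edge_ts :: "('l \<Rightarrow> 'x) \<Rightarrow> 's \<Rightarrow> 'l \<Rightarrow> 's \<Rightarrow> ('s, 'l, 'x) ts" where
  "edge_ts l \<alpha> t \<beta> = \<lparr>states = {\<alpha>, \<beta>}, actions = {t}, lab = l, transitions = {(\<alpha>, [t], \<beta>)}\<rparr>"

lemma edge_ts_simps [simp]:
  "states (edge_ts l \<alpha> t \<beta>) = {\<alpha>, \<beta>}" "actions (edge_ts l \<alpha> t \<beta>) = {t}" "lab (edge_ts l \<alpha> t \<beta>) = l"
  "transitions (edge_ts l \<alpha> t \<beta>) = {(\<alpha>, [t], \<beta>)}"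
  by (auto simp: edge_ts_def)

lemma cubical_edge_ts: "cubical_ts (edge_ts l \<alpha> t \<beta>)"
  by (rule cubical_length_one) auto

lemma cube_short_trans:
  assumes "(\<epsilon>, us, \<epsilon>') \<in> transitions (cube xs)" "length xs \<le> 1"
  shows "\<epsilon> = [False] \<and> us = [(xs ! 0, 0)] \<and> \<epsilon>' = [True] \<and> length xs = 1"
proof -
  have us: "us \<noteq> []" "length us \<le> length xs" "set us \<subseteq> actions (cube xs)"
    using assms(1) cube_trans_length[OF assms(1)] by (auto simp: cube_trans_iff)
  have "length us \<ge> 1" using us(1) by (simp add: Suc_le_eq)
  then have n: "length xs = 1" "length us = 1" using assms(2) us(2) by linarith+
  then obtain u where u: "us = [u]" by (cases us) auto
  then have "u = (xs ! 0, 0)" using us(3) n by auto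
  moreover obtain e e' where "\<epsilon> = [e]" "\<epsilon>' = [e']"
    using assms(1) n by (cases \<epsilon>; cases \<epsilon>') (auto simp: cube_trans_iff)
  ultimately show ?thesis using assms(1) u n by (auto simp: cube_trans_iff)
qed

lemma is_cube_edge_ts:
  assumes "\<alpha> \<noteq> \<beta>"
  shows "is_cube (edge_ts l \<alpha> t \<beta>)"
proof -
  have l: "length \<epsilon> = Suc 0 \<Longrightarrow> \<epsilon> = [False] \<or> \<epsilon> = [True]" for \<epsilon> by (cases \<epsilon>) auto
  have "ts_iso (cube [l t]) (edge_ts l \<alpha> t \<beta>) (\<lambda>\<epsilon>. if \<epsilon> = [True] then \<beta> else \<alpha>) (\<lambda>_. t)"
    unfolding ts_iso_def
  proof (intro conjI exI)
    show "ts_map (cube [l t]) (edge_ts l \<alpha> t \<beta>) (\<lambda>\<epsilon>. if \<epsilon> = [True] then \<beta> else \<alpha>) (\<lambda>_. t)"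
      by (rule ts_mapI) (auto dest: cube_short_trans)
    show "ts_map (edge_ts l \<alpha> t \<beta>) (cube [l t]) (\<lambda>s. if s = \<beta> then [True] else [False]) (\<lambda>_. (l t, 0))"
      using assms by (intro ts_mapI) (auto simp: cube_trans_iff)
  qed (use assms l in auto)
  then show ?thesis unfolding is_cube_def by blast
qed

text \<open>The long transition of an n-cube uses n actions, so the dimension is at most 1, and a
  1-cube has a single transition.\<close>

lemma is_cube_length_one_unique:
  assumes c: "is_cube C" and l: "\<And>\<alpha> us \<beta>. (\<alpha>, us, \<beta>) \<in> transitions C \<Longrightarrow> length us = 1"
    and t: "t \<in> transitions C" "t' \<in> transitions C"
    and w: "weak_ts C"
  shows "t = t'"
proof -
  obtain xs f g where i: "ts_iso (cube xs) C f g" using c by (auto simp: is_cube_def)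
  then obtain f' g' where m: "ts_map (cube xs) C f g" and m': "ts_map C (cube xs) f' g'"
    and fg: "\<And>s. s \<in> states C \<Longrightarrow> f (f' s) = s" "\<And>u. u \<in> actions C \<Longrightarrow> g (g' u) = u"
    unfolding ts_iso_def by blast
  have n: "length xs \<le> 1"
  proof (cases "xs = []")
    case False
    then show ?thesis using l[OF ts_mapD(4)[OF m cube_top]] by simp
  qed simp
  have e: "(\<alpha>, us, \<beta>) = (f [False], [g (xs ! 0, 0)], f [True])" if "(\<alpha>, us, \<beta>) \<in> transitions C" for \<alpha> us \<beta>
  proof -
    note wf = weak_tsD[OF w that]
    have "f' \<alpha> = [False] \<and> map g' us = [(xs ! 0, 0)] \<and> f' \<beta> = [True]"
      using cube_short_trans[OF ts_mapD(4)[OF m' that] n] by blast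
    moreover from this obtain u where "us = [u]" "g' u = (xs ! 0, 0)" by auto
    ultimately show ?thesis using fg wf by (metis list.set_intros(1) subsetD)
  qed
  show ?thesis using e t by (metis prod_cases3)
qed

context universe
begin

definition point_over :: "('u, 'u, 'x) ts \<Rightarrow> 'u \<Rightarrow> ('u, 'x) ts_arrow" where
  "point_over X s = arrow (discrete_ts {s}) X (\<lambda>s. s) (\<lambda>u. u)"

lemma discrete_ts_object: "(discrete_ts {s} :: ('u, 'u, 'x) ts) \<in> cts_objects"
  by (rule cts_objectsI[OF cubical_discrete_ts]) (auto intro: small_finite)

lemma point_over:
  fixes X :: "('u, 'u, 'x) ts"
  assumes "X \<in> cts_objects" "s \<in> states X"
  shows "in_hom CTS (point_over X s) (discrete_ts {s}) X" "point_over X s \<in> cubes_over X"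
    "st (point_over X s) s = s"
proof -
  show h: "in_hom CTS (point_over X s) (discrete_ts {s}) X"
    unfolding point_over_def using assms(2)
    by (intro arrow_in_hom[OF discrete_ts_object assms(1)] ts_mapI) auto
  then show "point_over X s \<in> cubes_over X"
    using CTS_homD(2)[OF h] by (simp add: cubes_over_iff is_cube_discrete_ts)
qed (simp add: point_over_def)

text \<open>Puts the map of \<open>cube_map_exists\<close> into the universe: a transition of
  \<open>X\<close> is the image of the long transition of a cube whose labels are those of its
  actions.\<close>

lemma cube_over_transition:
  fixes X :: "('u, 'u, 'x) ts"
  assumes X: "X \<in> cts_objects" and t: "(\<alpha>, us, \<beta>) \<in> transitions X"
  obtains c a ws b where "c \<in> cubes_over X" "(a, ws, b) \<in> transitions (src c)"
    "st c a = \<alpha>" "map (act c) ws = us" "st c b = \<beta>"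
proof -
  note w = cts_objectsD(2)[OF X]
  let ?C = "cube (map (lab X) us)"
  obtain \<phi> where \<phi>: "ts_map ?C X \<phi> (\<lambda>u. us ! snd u)"
    "\<phi> (replicate (length us) False) = \<alpha>" "\<phi> (replicate (length us) True) = \<beta>"
    using cube_map_exists[OF cts_objectsD(1)[OF X] t] .
  let ?s = "\<lambda>\<epsilon>. num (to_nat \<epsilon>)" and ?l = "\<lambda>u. num (snd u)"
  note inj = num_to_nat_inj(1)[of "states ?C"] num_snd_inj(1)[of "map (lab X) us"]
  let ?D = "image_ts ?C ?s ?l"
  have i: "ts_iso ?C ?D ?s ?l" by (rule ts_iso_image_ts[OF cubical_ts_weak[OF cubical_cube] inj])
  then have D: "is_cube ?D" "ts_map ?C ?D ?s ?l" unfolding is_cube_def by (blast, simp add: ts_iso_def)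
  have Do: "?D \<in> cts_objects"
    using finite_cube[of "map (lab X) us"]
    by (intro cts_objectsI cubical_image_ts cubical_cube inj) (auto intro!: small_finite)
  define c where "c = arrow ?D X (\<lambda>x. \<phi> (inv_into (states ?C) ?s x)) (\<lambda>v. us ! snd (inv_into (actions ?C) ?l v))"
  have c: "in_hom CTS c ?D X"
    unfolding c_def by (rule arrow_in_hom[OF Do X ts_map_image_ts[OF cubical_cube inj \<phi>(1)]])
  let ?z = "zip (map (lab X) us) [0..<length us]"
  have top: "(replicate (length us) False, ?z, replicate (length us) True) \<in> transitions ?C"
    using cube_top[of "map (lab X) us"] weak_tsD(3)[OF w t] by simp
  have z: "set ?z \<subseteq> actions ?C" using top by (simp add: cube_trans_iff)
  show ?thesis
  proof (rule that)
    show "c \<in> cubes_over X" using CTS_homD(2)[OF c] D(1) c by (simp add: cubes_over_iff)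
    show "(?s (replicate (length us) False), map ?l ?z, ?s (replicate (length us) True)) \<in> transitions (src c)"
      using ts_mapD(4)[OF D(2) top] CTS_homD(2)[OF c] by simp
    have "st c (?s \<epsilon>) = \<phi> \<epsilon>" if "\<epsilon> \<in> states ?C" for \<epsilon>
      using inv_into_f_f[OF inj(1) that] that by (simp add: c_def del: cube_simps(1))
    then show "st c (?s (replicate (length us) False)) = \<alpha>" "st c (?s (replicate (length us) True)) = \<beta>"
      using \<phi>(2,3) by simp_all
    show "map (act c) (map ?l ?z) = us"
    proof (rule nth_equalityI)
      fix n assume n: "n < length (map (act c) (map ?l ?z))"
      then have "?z ! n \<in> set ?z" by (intro nth_mem) simp
      then have zn: "?z ! n \<in> actions ?C" "snd (?z ! n) = n" using z n by (blast, simp)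
      have "act c (?l (?z ! n)) = us ! snd (inv_into (actions ?C) ?l (?l (?z ! n)))"
        unfolding c_def using zn(1) by (simp del: cube_simps)
      also have "inv_into (actions ?C) ?l (?l (?z ! n)) = ?z ! n"
        using inv_into_f_f[OF inj(2) zn(1)] .
      finally show "map (act c) (map ?l ?z) ! n = us ! n" using n zn(2) by simp
    qed simp
  qed
qed

text \<open>0-cubes detect the states, and every action is reached by some cube because it occurs in
  a 1-transition.\<close>

lemma cubes_dense:
  fixes X :: "('u, 'u, 'x) ts"
  assumes b: "in_hom CTS b X V" "in_hom CTS b' X V"
    and eq: "\<And>c. c \<in> cubes_over X \<Longrightarrow> Comp CTS b c = Comp CTS b' c"
  shows "b = b'"
proof (rule CTS_eqI[OF b])
  note X = CTS_homD(4)[OF b(1)]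
  fix s assume s: "s \<in> states X"
  note p = point_over[OF X s]
  from CTS_comp_eqD(1)[OF eq[OF p(2)] p(1) p(1), of s] show "st b s = st b' s"
    by (simp add: p(3))
next
  note X = CTS_homD(4)[OF b(1)]
  fix u assume "u \<in> actions X"
  then obtain \<alpha> \<beta> where t: "(\<alpha>, [u], \<beta>) \<in> transitions X" by (rule cubical_ts_used[OF cts_objectsD(1)[OF X]])
  obtain c x ws y where c: "c \<in> cubes_over X" "(x, ws, y) \<in> transitions (src c)" "map (act c) ws = [u]"
    using cube_over_transition[OF X t] .
  have ch: "in_hom CTS c (src c) X" using c(1) by (simp add: cubes_over_iff)
  from c(3) obtain v where v: "ws = [v]" "act c v = u" by auto
  have "v \<in> actions (src c)" using weak_tsD(4)[OF CTS_homD(9)[OF ch] c(2)] v by auto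
  from CTS_comp_eqD(2)[OF eq[OF c(1)] ch ch this] show "act b u = act b' u" using v by simp
qed

text \<open>The inclusion of the vertex \<open>a\<close> into the cube is an edge of the diagram
  from a 0-cube over \<open>X\<close> to \<open>c\<close>. Hence the value of a cocone at a vertex
  depends only on the state of \<open>X\<close> below it.\<close>

lemma cocone_on_cubes_state:
  fixes X :: "('u, 'u, 'x) ts"
  assumes X: "X \<in> cts_objects" and l: "cocone CTS (cubes_over X) src (cubes_over_edges X) V l"
    and c: "c \<in> cubes_over X" and a: "a \<in> states (src c)"
  shows "st (l c) a = st (l (point_over X (st c a))) (st c a)"
proof -
  have ch: "in_hom CTS c (src c) X" using c by (simp add: cubes_over_iff)
  then have s: "st c a \<in> states X" using a by simp
  note p = point_over[OF X s]
  let ?m = "arrow (discrete_ts {st c a}) (src c) (\<lambda>_. a) (\<lambda>u. u)"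
  have m: "in_hom CTS ?m (discrete_ts {st c a}) (src c)"
    using a by (intro arrow_in_hom[OF discrete_ts_object CTS_homD(4)[OF ch]] ts_mapI) auto
  have "Comp CTS c ?m = point_over X (st c a)"
    by (rule CTS_comp_eqI[OF m ch p(1)]) (auto simp: point_over_def)
  then have "(point_over X (st c a), ?m, c) \<in> cubes_over_edges X"
    using c p(2) m CTS_homD(2)[OF p(1)] by (simp add: cubes_over_edges_def)
  then have "Comp CTS (l c) ?m = l (point_over X (st c a))"
    using l unfolding cocone_def by blast
  then have "st (Comp CTS (l c) ?m) (st c a) = st (l (point_over X (st c a))) (st c a)" by simp
  then show ?thesis by simp
qed

text \<open>On states the cocone glues through 0-cubes. On actions it need not glue in general, as
  one action of \<open>X\<close> may receive different values on unrelated cubes; injective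
  labelling of \<open>V\<close> forces them to coincide.\<close>

lemma cocone_on_cubes_extends:
  fixes X :: "('u, 'u, 'x) ts"
  assumes X: "X \<in> cts_objects" and V: "V \<in> label_injective"
    and l: "cocone CTS (cubes_over X) src (cubes_over_edges X) V l"
  obtains b where "in_hom CTS b X V" "\<And>c. c \<in> cubes_over X \<Longrightarrow> Comp CTS b c = l c"
proof -
  have hl: "in_hom CTS (l c) (src c) V" if "c \<in> cubes_over X" for c
    using l that unfolding cocone_def by blast
  have hc: "in_hom CTS c (src c) X" if "c \<in> cubes_over X" for c
    using that by (simp add: cubes_over_iff)
  note state = cocone_on_cubes_state[OF X l]
  define f where "f s = st (l (point_over X s)) s" for s
  define g where "g u = inv_into (actions V) (lab V) (lab X u)" for u
  have g: "act (l c) w = g (act c w)" if c: "c \<in> cubes_over X" and w: "w \<in> actions (src c)" for c w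
  proof -
    have "lab V (act (l c) w) = lab X (act c w)" "act (l c) w \<in> actions V"
      using CTS_st_act(2,3)[OF hl[OF c] w] CTS_st_act(3)[OF hc[OF c] w] by simp_all
    moreover have "inj_on (lab V) (actions V)" using V by (simp add: label_injective_def)
    ultimately show ?thesis unfolding g_def by (metis inv_into_f_f)
  qed
  have m: "ts_map X V f g"
  proof (rule ts_mapI)
    fix s assume s: "s \<in> states X"
    note p = point_over[OF X s]
    have "s \<in> states (src (point_over X s))" using CTS_homD(2)[OF p(1)] by simp
    then show "f s \<in> states V" using CTS_st_act(1)[OF hl[OF p(2)]] by (simp add: f_def)
  next
    fix u assume "u \<in> actions X"
    then obtain \<alpha> \<beta> where t: "(\<alpha>, [u], \<beta>) \<in> transitions X" by (rule cubical_ts_used[OF cts_objectsD(1)[OF X]])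
    obtain c x ws y where c: "c \<in> cubes_over X" "(x, ws, y) \<in> transitions (src c)" "map (act c) ws = [u]"
      using cube_over_transition[OF X t] .
    from c(3) obtain v where v: "ws = [v]" "act c v = u" by auto
    have va: "v \<in> actions (src c)" using weak_tsD(4)[OF CTS_homD(9)[OF hc[OF c(1)]] c(2)] v by auto
    show "g u \<in> actions V" "lab V (g u) = lab X u"
      using g[OF c(1) va] CTS_st_act(2,3)[OF hl[OF c(1)] va] CTS_st_act(3)[OF hc[OF c(1)] va] v by simp_all
  next
    fix \<alpha> us \<beta> assume t: "(\<alpha>, us, \<beta>) \<in> transitions X"
    obtain c x ws y where c: "c \<in> cubes_over X" "(x, ws, y) \<in> transitions (src c)"
      "st c x = \<alpha>" "map (act c) ws = us" "st c y = \<beta>"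
      using cube_over_transition[OF X t] .
    note wf = weak_tsD[OF CTS_homD(9)[OF hc[OF c(1)]] c(2)]
    have "map (act (l c)) ws = map g us" unfolding c(4)[symmetric] using g[OF c(1)] wf(4) by auto
    then show "(f \<alpha>, map g us, f \<beta>) \<in> transitions V"
      using CTS_trans[OF hl[OF c(1)] c(2)] state[OF c(1) wf(1)] state[OF c(1) wf(2)] c(3,5)
      by (simp add: f_def)
  qed
  have b: "in_hom CTS (arrow X V f g) X V" (is "in_hom CTS ?b _ _")
    using V by (intro arrow_in_hom[OF X _ m]) (simp add: label_injective_def)
  show ?thesis
  proof (rule that[OF b])
    fix c assume c: "c \<in> cubes_over X"
    show "Comp CTS ?b c = l c"
    proof (rule CTS_comp_eqI[OF hc[OF c] b hl[OF c]])
      fix s assume s: "s \<in> states (src c)"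
      show "st ?b (st c s) = st (l c) s"
        using state[OF c s] CTS_st_act(1)[OF hc[OF c] s] by (simp add: f_def)
    next
      fix u assume u: "u \<in> actions (src c)"
      show "act ?b (act c u) = act (l c) u"
        using g[OF c u] CTS_st_act(2)[OF hc[OF c] u] by simp
    qed
  qed
qed

text \<open>For \<open>V\<close> with injective labelling, arrows to \<open>V\<close> from a system
  and from its cubification are both the same as cocones on the cubes. Unique extension along
  \<open>g\<close> therefore becomes unique extension along \<open>f\<close>.\<close>

lemma local_equivalence_of_cubification:
  fixes f g :: "('u, 'x) ts_arrow"
  assumes c: "cubification_map f g" and g: "g \<in> CTS.local_equivalences label_injective"
  shows "f \<in> CTS.local_equivalences label_injective"
proof -
  define X X' Q Q' where d: "X = src f" "X' = tgt f" "Q = src g" "Q' = tgt g"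
  obtain l l' where f: "in_hom CTS f X X'" and gh: "in_hom CTS g Q Q'"
    and l: "is_cubification X Q l" and l': "is_cubification X' Q' l'"
    and comm: "\<And>c. c \<in> cubes_over X \<Longrightarrow> Comp CTS g (l c) = l' (Comp CTS f c)"
    using c unfolding cubification_map_def d CTS_arr_hom by blast
  note X = CTS_homD(4)[OF f] and X' = CTS_homD(5)[OF f]
  have hc: "in_hom CTS c (src c) Y" if "c \<in> cubes_over Y" for c and Y :: "('u, 'u, 'x) ts"
    using that by (simp add: cubes_over_iff)
  have hl: "in_hom CTS (l c) (src c) Q" if "c \<in> cubes_over X" for c
    using l that unfolding is_cubification_def is_colimit_def cocone_def by auto
  have hl': "in_hom CTS (l' c) (src c) Q'" if "c \<in> cubes_over X'" for c
    using l' that unfolding is_cubification_def is_colimit_def cocone_def by auto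
  have fc: "Comp CTS f c \<in> cubes_over X'" if "c \<in> cubes_over X" for c
    using that CTS_comp_in_hom[OF hc[OF that] f] by (simp add: cubes_over_iff)
  have cocone: "cocone CTS (cubes_over Y) src (cubes_over_edges Y) V (\<lambda>c. Comp CTS a c)"
    if a: "in_hom CTS a Y V" for a and Y V :: "('u, 'u, 'x) ts"
    using CTS_homD(5)[OF a] CTS_comp_in_hom[OF hc a] CTS.comp_assoc[OF _ hc a]
    unfolding cocone_def by (fastforce simp: cubes_over_edges_def)
  have univ: "\<exists>!h. in_hom CTS h Q V \<and> (\<forall>c\<in>cubes_over X. Comp CTS h (l c) = k c)"
    if "cocone CTS (cubes_over X) src (cubes_over_edges X) V k" for V k
    using l that unfolding is_cubification_def is_colimit_def by blast
  have univ': "\<exists>!h. in_hom CTS h Q' V \<and> (\<forall>c\<in>cubes_over X'. Comp CTS h (l' c) = k c)"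
    if "cocone CTS (cubes_over X') src (cubes_over_edges X') V k" for V k
    using l' that unfolding is_cubification_def is_colimit_def by blast
  have lcoc': "Comp CTS (l' c') m = l' c" if "(c, m, c') \<in> cubes_over_edges X'" for c m c'
    using l' that unfolding is_cubification_def is_colimit_def cocone_def by blast
  show ?thesis
  proof (rule CTS.local_equivalencesI[OF f])
    fix V a assume V: "V \<in> label_injective" and a: "in_hom CTS a X V"
    obtain h where h: "in_hom CTS h Q V" "\<And>c. c \<in> cubes_over X \<Longrightarrow> Comp CTS h (l c) = Comp CTS a c"
      using univ[OF cocone[OF a]] by blast
    obtain h' where h': "in_hom CTS h' Q' V" "Comp CTS h' g = h"
      using CTS.local_equivalences_ex[OF g gh V h(1)] .
    have "cocone CTS (cubes_over X') src (cubes_over_edges X') V (\<lambda>c. Comp CTS h' (l' c))"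
      unfolding cocone_def
    proof (intro conjI ballI)
      fix x assume x: "x \<in> cubes_over_edges X'"
      then obtain c m c' where e: "x = (c, m, c')" "in_hom CTS m (src c) (src c')" "c' \<in> cubes_over X'"
        by (auto simp: cubes_over_edges_def)
      show "case x of (c, m, c') \<Rightarrow> Comp CTS (Comp CTS h' (l' c')) m = Comp CTS h' (l' c)"
        using CTS.comp_assoc[OF e(2) hl'[OF e(3)] h'(1)] lcoc'[of c m c'] x e(1) by simp
    qed (use CTS_homD(5)[OF h'(1)] CTS_comp_in_hom[OF hl' h'(1)] in auto)
    then obtain b where b: "in_hom CTS b X' V" "\<And>c. c \<in> cubes_over X' \<Longrightarrow> Comp CTS b c = Comp CTS h' (l' c)"
      using cocone_on_cubes_extends[OF X' V] by blast
    have "Comp CTS b f = a"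
    proof (rule cubes_dense[OF CTS_comp_in_hom[OF f b(1)] a])
      fix c assume c: "c \<in> cubes_over X"
      have "Comp CTS (Comp CTS b f) c = Comp CTS b (Comp CTS f c)"
        using CTS.comp_assoc[OF hc[OF c] f b(1)] by simp
      also have "\<dots> = Comp CTS h' (Comp CTS g (l c))" using b(2)[OF fc[OF c]] comm[OF c] by simp
      also have "\<dots> = Comp CTS (Comp CTS h' g) (l c)" using CTS.comp_assoc[OF hl[OF c] gh h'(1)] .
      also have "\<dots> = Comp CTS a c" using h'(2) h(2)[OF c] by simp
      finally show "Comp CTS (Comp CTS b f) c = Comp CTS a c" .
    qed
    then show "\<exists>b. in_hom CTS b X' V \<and> Comp CTS b f = a" using b(1) by blast
  next
    fix V b b' assume V: "V \<in> label_injective" and b: "in_hom CTS b X' V" "in_hom CTS b' X' V"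
      and eq: "Comp CTS b f = Comp CTS b' f"
    obtain k where k: "in_hom CTS k Q' V" "\<And>c. c \<in> cubes_over X' \<Longrightarrow> Comp CTS k (l' c) = Comp CTS b c"
      using univ'[OF cocone[OF b(1)]] by blast
    obtain k' where k': "in_hom CTS k' Q' V" "\<And>c. c \<in> cubes_over X' \<Longrightarrow> Comp CTS k' (l' c) = Comp CTS b' c"
      using univ'[OF cocone[OF b(2)]] by blast
    have e: "Comp CTS (Comp CTS k g) (l c) = Comp CTS (Comp CTS b f) c"
      "Comp CTS (Comp CTS k' g) (l c) = Comp CTS (Comp CTS b f) c" if c: "c \<in> cubes_over X" for c
    proof -
      show "Comp CTS (Comp CTS k g) (l c) = Comp CTS (Comp CTS b f) c"
        using CTS.comp_assoc[OF hl[OF c] gh k(1)] CTS.comp_assoc[OF hc[OF c] f b(1)]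
          comm[OF c] k(2)[OF fc[OF c]] by simp
      show "Comp CTS (Comp CTS k' g) (l c) = Comp CTS (Comp CTS b f) c"
        using CTS.comp_assoc[OF hl[OF c] gh k'(1)] CTS.comp_assoc[OF hc[OF c] f b(2)]
          comm[OF c] k'(2)[OF fc[OF c]] eq by simp
    qed
    have "Comp CTS k g = Comp CTS k' g"
      using univ[OF cocone[OF CTS_comp_in_hom[OF f b(1)]]] e CTS_comp_in_hom[OF gh k(1)] CTS_comp_in_hom[OF gh k'(1)]
      by blast
    then have kk: "k = k'" by (rule CTS.local_equivalences_unique[OF g gh V k(1) k'(1)])
    show "b = b'" by (rule cubes_dense[OF b]) (use k(2) k'(2) kk in simp)
  qed
qed

text \<open>A system without higher-dimensional transitions is cubified by giving each of its
  transitions an action of its own. Transitions are not allowed to be loops, which makes the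
  source of each edge a subsystem.\<close>

lemma cubification_length_one:
  fixes p :: "('u, 'x) ts_arrow"
  assumes p: "in_hom CTS p A B" "states A = states B" "\<And>s. s \<in> states A \<Longrightarrow> st p s = s"
    and one: "\<And>\<alpha> us \<beta>. (\<alpha>, us, \<beta>) \<in> transitions B \<Longrightarrow> length us = 1"
    and lift: "\<And>\<alpha> u \<beta>. (\<alpha>, [u], \<beta>) \<in> transitions B \<Longrightarrow> \<exists>t. (\<alpha>, [t], \<beta>) \<in> transitions A \<and> act p t = u"
    and ends: "\<And>\<alpha> t \<beta> \<alpha>' \<beta>'. (\<alpha>, [t], \<beta>) \<in> transitions A \<Longrightarrow> (\<alpha>', [t], \<beta>') \<in> transitions A \<Longrightarrow>
      \<alpha>' = \<alpha> \<and> \<beta>' = \<beta> \<and> \<alpha> \<noteq> \<beta>"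
    and unique: "\<And>\<alpha> t t' \<beta>. (\<alpha>, [t], \<beta>) \<in> transitions A \<Longrightarrow> (\<alpha>, [t'], \<beta>) \<in> transitions A \<Longrightarrow>
      act p t = act p t' \<Longrightarrow> t = t'"
  shows "c \<in> cubes_over B \<Longrightarrow> \<exists>!d. in_hom CTS d (src c) A \<and> Comp CTS p d = c"
    and "is_cubification B A (\<lambda>c. THE d. in_hom CTS d (src c) A \<and> Comp CTS p d = c)"
proof -
  note A = CTS_homD(4)[OF p(1)] and B = CTS_homD(5)[OF p(1)]
  have lift_unique: "d = d'"
    if d: "in_hom CTS d C A" "in_hom CTS d' C A" and eq: "Comp CTS p d = Comp CTS p d'" for d d' C
  proof (rule CTS_eqI[OF d])
    note e = CTS_comp_eqD[OF eq d]
    fix s assume s: "s \<in> states C"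
    show st: "st d s = st d' s"
      using e(1)[OF s] p(3) CTS_st_act(1)[OF d(1) s] CTS_st_act(1)[OF d(2) s] by simp
  next
    note e = CTS_comp_eqD[OF eq d]
    fix u assume u: "u \<in> actions C"
    obtain a b where t: "(a, [u], b) \<in> transitions C" using cubical_ts_used[OF CTS_homD(7)[OF d(1)] u] .
    note wf = weak_tsD[OF CTS_homD(9)[OF d(1)] t]
    have "st d s = st d' s" if s: "s \<in> states C" for s
      using e(1)[OF s] p(3) CTS_st_act(1)[OF d(1) s] CTS_st_act(1)[OF d(2) s] by simp
    then have "(st d a, [act d u], st d b) \<in> transitions A" "(st d a, [act d' u], st d b) \<in> transitions A"
      using CTS_trans[OF d(1) t] CTS_trans[OF d(2) t] wf by simp_all
    then show "act d u = act d' u" by (rule unique) (rule e(2)[OF u])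
  qed
  \<comment> \<open>A cube over \<open>B\<close> has at most one transition, so the action of
    \<open>A\<close> lifting it can be chosen without conflict. The assumption \<open>unique\<close>
    then makes the lift unique, by \<open>lift_unique\<close>.\<close>
  have ex: "\<exists>!d. in_hom CTS d (src c) A \<and> Comp CTS p d = c" if c: "c \<in> cubes_over B" for c
  proof (rule ex_ex1I)
    have cc: "is_cube (src c)" and ch: "in_hom CTS c (src c) B" using c by (auto simp: cubes_over_iff)
    note wC = CTS_homD(9)[OF ch]
    have one_c: "length us = 1" if "(\<alpha>, us, \<beta>) \<in> transitions (src c)" for \<alpha> us \<beta>
      using one[OF CTS_trans[OF ch that]] by simp
    have "\<exists>t. \<forall>a b. (a, [w], b) \<in> transitions (src c) \<longrightarrow>
        (st c a, [t], st c b) \<in> transitions A \<and> act p t = act c w" if w: "w \<in> actions (src c)" for w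
    proof -
      obtain a b where t: "(a, [w], b) \<in> transitions (src c)" using cubical_ts_used[OF CTS_homD(7)[OF ch] w] .
      from lift[of "st c a" "act c w" "st c b"] CTS_trans[OF ch t]
      obtain t where "(st c a, [t], st c b) \<in> transitions A \<and> act p t = act c w" by auto
      moreover have "a' = a \<and> b' = b" if "(a', [w], b') \<in> transitions (src c)" for a' b'
        using is_cube_length_one_unique[OF cc one_c that t wC] by simp
      ultimately show ?thesis by blast
    qed
    then obtain k where k: "\<And>w a b. w \<in> actions (src c) \<Longrightarrow> (a, [w], b) \<in> transitions (src c) \<Longrightarrow>
        (st c a, [k w], st c b) \<in> transitions A \<and> act p (k w) = act c w"
      by metis
    have k': "k w \<in> actions A \<and> act p (k w) = act c w" if w: "w \<in> actions (src c)" for w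
    proof -
      obtain a b where t: "(a, [w], b) \<in> transitions (src c)" using cubical_ts_used[OF CTS_homD(7)[OF ch] w] .
      then show ?thesis using k[OF w t] weak_tsD(4)[OF cts_objectsD(2)[OF A]] by fastforce
    qed
    have "ts_map (src c) A (st c) k"
    proof (rule ts_mapI)
      fix w assume w: "w \<in> actions (src c)"
      show "lab A (k w) = lab (src c) w"
        using k'[OF w] CTS_st_act(3)[OF p(1)] CTS_st_act(3)[OF ch w] by metis
    next
      fix \<alpha> us \<beta> assume t: "(\<alpha>, us, \<beta>) \<in> transitions (src c)"
      then obtain w where w: "us = [w]" using one_c[OF t] by (cases us) auto
      then show "(st c \<alpha>, map k us, st c \<beta>) \<in> transitions A"
        using k[of w \<alpha> \<beta>] t weak_tsD(4)[OF wC t] by simp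
    qed (use k' p(2) CTS_st_act(1)[OF ch] in auto)
    then have d: "in_hom CTS (arrow (src c) A (st c) k) (src c) A" (is "in_hom CTS ?d _ _")
      by (rule arrow_in_hom[OF CTS_homD(4)[OF ch] A])
    have "Comp CTS p ?d = c"
      by (rule CTS_comp_eqI[OF d p(1) ch]) (use k' p(2,3) CTS_st_act(1)[OF ch] in auto)
    then show "\<exists>d. in_hom CTS d (src c) A \<and> Comp CTS p d = c" using d by blast
    show "d = d'" if "in_hom CTS d (src c) A \<and> Comp CTS p d = c" "in_hom CTS d' (src c) A \<and> Comp CTS p d' = c"
      for d d' using that lift_unique[of d "src c" d'] by simp
  qed
  then show "c \<in> cubes_over B \<Longrightarrow> \<exists>!d. in_hom CTS d (src c) A \<and> Comp CTS p d = c" .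
  define l where "l c = (THE d. in_hom CTS d (src c) A \<and> Comp CTS p d = c)" for c
  have l: "in_hom CTS (l c) (src c) A" "Comp CTS p (l c) = c" if "c \<in> cubes_over B" for c
    using theI'[OF ex[OF that]] unfolding l_def by auto
  have l_eq: "l c = d" if "c \<in> cubes_over B" "in_hom CTS d (src c) A" "Comp CTS p d = c" for c d
    using lift_unique[OF l(1)[OF that(1)] that(2)] l(2)[OF that(1)] that(3) by simp
  have hc: "in_hom CTS c (src c) B" if "c \<in> cubes_over B" for c using that by (simp add: cubes_over_iff)
  have st_l: "st (l c) s = st c s" if c: "c \<in> cubes_over B" and s: "s \<in> states (src c)" for c s
  proof -
    have "st (Comp CTS p (l c)) s = st p (st (l c) s)" using s CTS_homD(2)[OF l(1)[OF c]] by simp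
    then show ?thesis using l(2)[OF c] p(3) CTS_st_act(1)[OF l(1)[OF c] s] by simp
  qed
  \<comment> \<open>A transition of \<open>A\<close> has distinct ends and is therefore a 1-cube
    over \<open>B\<close>, whose chosen lift is its inclusion into \<open>A\<close>. These cubes
    determine the arrow out of the colimit.\<close>
  have edge: "\<exists>d. d \<in> cubes_over B \<and> src d = edge_ts (lab A) \<alpha> t \<beta> \<and> st d \<alpha> = \<alpha> \<and> st d \<beta> = \<beta> \<and> act d t = act p t \<and>
      act (l d) t = t"
    if t: "(\<alpha>, [t], \<beta>) \<in> transitions A" for \<alpha> t \<beta>
  proof -
    let ?E = "edge_ts (lab A) \<alpha> t \<beta>"
    have Eo: "?E \<in> cts_objects" by (rule cts_objectsI[OF cubical_edge_ts]) (auto intro: small_finite)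
    have i: "in_hom CTS (arrow ?E A (\<lambda>s. s) (\<lambda>u. u)) ?E A" (is "in_hom CTS ?i _ _")
      using weak_tsD[OF cts_objectsD(2)[OF A] t] t by (intro arrow_in_hom[OF Eo A] ts_mapI) auto
    let ?d = "Comp CTS p ?i"
    have d: "in_hom CTS ?d ?E B" by (rule CTS_comp_in_hom[OF i p(1)])
    have dc: "?d \<in> cubes_over B"
      using d is_cube_edge_ts[of \<alpha> \<beta> "lab A" t] ends[OF t t] by (simp add: cubes_over_iff)
    have "l ?d = ?i" by (rule l_eq[OF dc]) (use i in simp_all)
    then show ?thesis
      using dc p(3) weak_tsD[OF cts_objectsD(2)[OF A] t] by (intro exI[of _ ?d]) simp
  qed
  have used: "\<exists>\<alpha> \<beta>. (\<alpha>, [t], \<beta>) \<in> transitions A" if "t \<in> actions A" for t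
    using that by (rule cubical_ts_used[OF cts_objectsD(1)[OF A]]) blast
  have one_A: "\<exists>t. us = [t]" if "(\<alpha>, us, \<beta>) \<in> transitions A" for \<alpha> us \<beta>
    using one[OF CTS_trans[OF p(1) that]] by (cases us) auto
  have "is_cubification B A l"
    unfolding is_cubification_def is_colimit_def
  proof (intro conjI allI impI)
    show "cocone CTS (cubes_over B) src (cubes_over_edges B) A l"
      unfolding cocone_def
    proof (intro conjI ballI)
      fix x assume "x \<in> cubes_over_edges B"
      then obtain c m c' where x: "x = (c, m, c')" "c \<in> cubes_over B" "c' \<in> cubes_over B"
        "in_hom CTS m (src c) (src c')" "Comp CTS c' m = c"
        by (auto simp: cubes_over_edges_def)
      have "l c = Comp CTS (l c') m"
        using CTS.comp_assoc[OF x(4) l(1)[OF x(3)] p(1)] l(2)[OF x(3)] x(5)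
        by (intro l_eq[OF x(2)] CTS_comp_in_hom[OF x(4) l(1)[OF x(3)]]) simp
      then show "case x of (c, m, c') \<Rightarrow> Comp CTS (l c') m = l c" by (simp add: x(1))
    qed (use A l in auto)
  next
    fix V l' assume l': "cocone CTS (cubes_over B) src (cubes_over_edges B) V l'"
    note state = cocone_on_cubes_state[OF B l']
    have hl': "in_hom CTS (l' c) (src c) V" if "c \<in> cubes_over B" for c
      using l' that unfolding cocone_def by auto
    have V: "V \<in> cts_objects" using l' by (simp add: cocone_def)
    define f where "f s = st (l' (point_over B s)) s" for s
    obtain d where d: "\<And>\<alpha> t \<beta>. (\<alpha>, [t], \<beta>) \<in> transitions A \<Longrightarrow> d t \<in> cubes_over B \<and>
        src (d t) = edge_ts (lab A) \<alpha> t \<beta> \<and> st (d t) \<alpha> = \<alpha> \<and> st (d t) \<beta> = \<beta> \<and> act (d t) t = act p t \<and> act (l (d t)) t = t"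
    proof -
      have "\<forall>t\<in>actions A. \<exists>d. \<forall>\<alpha> \<beta>. (\<alpha>, [t], \<beta>) \<in> transitions A \<longrightarrow> d \<in> cubes_over B \<and>
        src d = edge_ts (lab A) \<alpha> t \<beta> \<and> st d \<alpha> = \<alpha> \<and> st d \<beta> = \<beta> \<and> act d t = act p t \<and> act (l d) t = t"
      proof
        fix t assume "t \<in> actions A"
        then obtain \<alpha> \<beta> where t: "(\<alpha>, [t], \<beta>) \<in> transitions A" using used by blast
        have eq: "\<alpha>' = \<alpha> \<and> \<beta>' = \<beta>" if "(\<alpha>', [t], \<beta>') \<in> transitions A" for \<alpha>' \<beta>'
          using ends[OF t that] by blast
        from edge[OF t] obtain d where "d \<in> cubes_over B \<and> src d = edge_ts (lab A) \<alpha> t \<beta> \<and>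
          st d \<alpha> = \<alpha> \<and> st d \<beta> = \<beta> \<and> act d t = act p t \<and> act (l d) t = t" by blast
        then show "\<exists>d. \<forall>\<alpha> \<beta>. (\<alpha>, [t], \<beta>) \<in> transitions A \<longrightarrow> d \<in> cubes_over B \<and>
          src d = edge_ts (lab A) \<alpha> t \<beta> \<and> st d \<alpha> = \<alpha> \<and> st d \<beta> = \<beta> \<and> act d t = act p t \<and> act (l d) t = t"
          using eq by (intro exI[of _ d] allI impI) (drule eq, simp)
      qed
      from bchoice[OF this] obtain d where D: "\<forall>t\<in>actions A. \<forall>\<alpha> \<beta>. (\<alpha>, [t], \<beta>) \<in> transitions A \<longrightarrow> d t \<in> cubes_over B \<and>
        src (d t) = edge_ts (lab A) \<alpha> t \<beta> \<and> st (d t) \<alpha> = \<alpha> \<and> st (d t) \<beta> = \<beta> \<and> act (d t) t = act p t \<and> act (l (d t)) t = t"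
        by blast
      show ?thesis
      proof (rule that)
        fix \<alpha> t \<beta> assume t: "(\<alpha>, [t], \<beta>) \<in> transitions A"
        then have "t \<in> actions A" using weak_tsD(4)[OF cts_objectsD(2)[OF A] t] by simp
        from D[rule_format, OF this t] show "d t \<in> cubes_over B \<and>
          src (d t) = edge_ts (lab A) \<alpha> t \<beta> \<and> st (d t) \<alpha> = \<alpha> \<and> st (d t) \<beta> = \<beta> \<and> act (d t) t = act p t \<and> act (l (d t)) t = t" .
      qed
    qed
    \<comment> \<open>Each action of \<open>A\<close> belongs to a single transition and takes the
      value of the cocone on the edge cube of that transition.\<close>
    define g where "g t = act (l' (d t)) t" for t
    have m: "ts_map A V f g"
    proof (rule ts_mapI)
      fix s assume "s \<in> states A"
      then have s: "s \<in> states B" by (simp add: p(2))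
      note pt = point_over[OF B s]
      have "s \<in> states (src (point_over B s))" using CTS_homD(2)[OF pt(1)] by simp
      then show "f s \<in> states V" using CTS_st_act(1)[OF hl'[OF pt(2)]] by (simp add: f_def)
    next
      fix t assume "t \<in> actions A"
      then obtain \<alpha> \<beta> where "(\<alpha>, [t], \<beta>) \<in> transitions A" using used by blast
      then have e: "d t \<in> cubes_over B" "src (d t) = edge_ts (lab A) \<alpha> t \<beta>" using d by auto
      then show "g t \<in> actions V" "lab V (g t) = lab A t"
        using CTS_st_act(2,3)[OF hl'[OF e(1)], of t] by (simp_all add: g_def)
    next
      fix \<alpha> us \<beta> assume t: "(\<alpha>, us, \<beta>) \<in> transitions A"
      then obtain t where us: "us = [t]" using one_A by blast
      note e = d[OF t[unfolded us]]
      have "(st (l' (d t)) \<alpha>, [g t], st (l' (d t)) \<beta>) \<in> transitions V"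
        using CTS_trans[OF hl', of "d t" \<alpha> "[t]" \<beta>] e by (simp add: g_def)
      then show "(f \<alpha>, map g us, f \<beta>) \<in> transitions V"
        using state[of "d t" \<alpha>] state[of "d t" \<beta>] e us by (simp add: f_def)
    qed
    have h: "in_hom CTS (arrow A V f g) A V" (is "in_hom CTS ?h _ _") by (rule arrow_in_hom[OF A V m])
    have hl: "Comp CTS ?h (l c) = l' c" if c: "c \<in> cubes_over B" for c
    proof (rule CTS_comp_eqI[OF l(1)[OF c] h hl'[OF c]])
      fix s assume s: "s \<in> states (src c)"
      show "st ?h (st (l c) s) = st (l' c) s"
        using st_l[OF c s] state[OF c s] CTS_st_act(1)[OF l(1)[OF c] s] by (simp add: f_def)
    next
      fix w assume w: "w \<in> actions (src c)"
      obtain a b where ab: "(a, [w], b) \<in> transitions (src c)"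
        using cubical_ts_used[OF CTS_homD(7)[OF hc[OF c]] w] .
      note wf = weak_tsD[OF CTS_homD(9)[OF hc[OF c]] ab]
      define t where "t = act (l c) w"
      have t: "(st c a, [t], st c b) \<in> transitions A"
        using CTS_trans[OF l(1)[OF c] ab] st_l[OF c] wf by (simp add: t_def)
      note e = d[OF t]
      let ?E = "edge_ts (lab A) (st c a) t (st c b)"
      \<comment> \<open>An edge of the diagram from the cube of the transition \<open>t\<close> into
        \<open>c\<close>, comparing the cocone at the two. Its map on states sends the ends to
        \<open>a\<close> and \<open>b\<close> because the ends are distinct.\<close>
      let ?m = "arrow ?E (src c) (\<lambda>s. if s = st c a then a else b) (\<lambda>_. w)"
      have ne: "st c a \<noteq> st c b" using ends[OF t t] by simp
      have hd: "in_hom CTS (d t) ?E B" using e hc by metis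
      have m: "in_hom CTS ?m ?E (src c)"
      proof (rule arrow_in_hom[OF CTS_homD(4)[OF hd] CTS_homD(4)[OF hc[OF c]] ts_mapI])
        show "lab (src c) w = lab ?E u" if "u \<in> actions ?E" for u
          using that CTS_st_act(3)[OF l(1)[OF c] w] by (simp add: t_def)
      qed (use wf w ab ne in auto)
      have "act p t = act c w"
        using l(2)[OF c] w CTS_homD(2)[OF l(1)[OF c]] CTS_comp_simps(4)[of w "l c" p] by (simp add: t_def)
      then have "Comp CTS c ?m = d t"
        using e ne by (intro CTS_comp_eqI[OF m hc[OF c] hd]) auto
      then have "(d t, ?m, c) \<in> cubes_over_edges B"
        using c e m by (simp add: cubes_over_edges_def)
      then have "Comp CTS (l' c) ?m = l' (d t)" using l' unfolding cocone_def by blast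
      then have "act (Comp CTS (l' c) ?m) t = act (l' (d t)) t" by simp
      then have "act (l' c) w = g t" by (simp add: g_def)
      then show "act ?h (act (l c) w) = act (l' c) w"
        using CTS_st_act(2)[OF l(1)[OF c] w] by (simp add: t_def)
    qed
    show "\<exists>!h. in_hom CTS h A V \<and> (\<forall>c\<in>cubes_over B. Comp CTS h (l c) = l' c)"
    proof (rule ex1I)
      show "in_hom CTS ?h A V \<and> (\<forall>c\<in>cubes_over B. Comp CTS ?h (l c) = l' c)" using h hl by blast
      fix k assume k: "in_hom CTS k A V \<and> (\<forall>c\<in>cubes_over B. Comp CTS k (l c) = l' c)"
      then have kh: "in_hom CTS k A V" by blast
      have kl: "Comp CTS k (l c) = Comp CTS ?h (l c)" if "c \<in> cubes_over B" for c
        using k that hl by simp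
      show "k = ?h"
      proof (rule CTS_eqI[OF kh h])
        fix s assume "s \<in> states A"
        then have s: "s \<in> states B" by (simp add: p(2))
        note pt = point_over[OF B s]
        have sp: "s \<in> states (src (point_over B s))" using CTS_homD(2)[OF pt(1)] by simp
        show "st k s = st ?h s"
          using CTS_comp_eqD(1)[OF kl[OF pt(2)] l(1)[OF pt(2)] l(1)[OF pt(2)] sp] st_l[OF pt(2) sp]
          unfolding pt(3) by simp
      next
        fix t assume "t \<in> actions A"
        then obtain \<alpha> \<beta> where "(\<alpha>, [t], \<beta>) \<in> transitions A" using used by blast
        note e = d[OF this]
        then have dt: "d t \<in> cubes_over B" "t \<in> actions (src (d t))" by auto
        show "act k t = act ?h t"
          using CTS_comp_eqD(2)[OF kl[OF dt(1)] l(1)[OF dt(1)] l(1)[OF dt(1)] dt(2)] e by simp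
      qed
    qed
  qed
  then show "is_cubification B A (\<lambda>c. THE d. in_hom CTS d (src c) A \<and> Comp CTS p d = c)"
    by (simp add: l_def[abs_def])
qed

end


section \<open>The localized model structure and the first implication\<close>

context universe
begin

abbreviation cubification_equivalences :: "('u, 'x) ts_arrow set" where
  "cubification_equivalences \<equiv> {f. \<exists>g. cubification_map f g \<and>
     g \<in> smallest_localizer CTS (small_ordinals :: 'u rel set) cofibrations}"

definition localizing :: "('u, 'x) ts_arrow set \<Rightarrow> bool" where
  "localizing W \<longleftrightarrow> model_structure CTS (model_of CTS cofibrations W) \<and>
     smallest_localizer CTS (small_ordinals :: 'u rel set) cofibrations \<union> cubification_equivalences \<subseteq> W"

lemma LCub_CTS_eq:
  "LCub_CTS = (model_of CTS cofibrations (\<Inter> {W. localizing W}) :: ('u, 'x) ts_arrow model)"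
  by (simp add: LCub_CTS_def left_bousfield_localization_def left_determined_CTS_def
      left_determined_model_def llp_rlp_generating_cofibrations model_of_def localizing_def)

lemma trivial_fibrations_smallest_localizer:
  "trivial_fibrations \<subseteq> smallest_localizer CTS (small_ordinals :: 'u rel set) (cofibrations :: ('u, 'x) ts_arrow set)"
  unfolding smallest_localizer_def grothendieck_localizer_def rlp_cofibrations by blast

lemma localizing_local_equivalences:
  "localizing (CTS.local_equivalences (label_injective :: ('u, 'u, 'x) ts set))"
proof -
  have "smallest_localizer CTS (small_ordinals :: 'u rel set) cofibrations
      \<subseteq> CTS.local_equivalences (label_injective :: ('u, 'u, 'x) ts set)"
    unfolding smallest_localizer_def using grothendieck_localizer_local_equivalences by blast
  then show ?thesis
    unfolding localizing_def
    using model_structure_local_equivalences local_equivalence_of_cubification by blast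
qed

lemma fibrant_if_combinatorially_fibrant:
  fixes X :: "('u, 'u, 'x) ts"
  assumes X: "X \<in> cts_objects" "combinatorially_fibrant X"
  shows "fibrant CTS LCub_CTS X"
proof -
  obtain T :: "('u, 'u, 'x) ts" where T: "terminal CTS T" using terminal_CTS .
  then obtain f where f: "in_hom CTS f X T" using X(1) unfolding terminal_def by auto
  have "f \<in> rlp CTS (cofibrations \<inter> \<Inter> {W. localizing W})"
    unfolding rlp_def
  proof (intro CollectI conjI ballI)
    show "f \<in> Arr CTS" using CTS_homD(1)[OF f] .
    fix i :: "('u, 'x) ts_arrow" assume "i \<in> cofibrations \<inter> \<Inter> {W. localizing W}"
    then have i: "i \<in> cofibrations" "i \<in> CTS.local_equivalences label_injective"
      using localizing_local_equivalences by auto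
    have ih: "in_hom CTS i (src i) (tgt i)" using i(1) by (simp add: cofibrations_def CTS_arr_hom)
    show "lifts CTS i f"
    proof (subst CTS.lifts_iff[OF ih f], intro allI impI, elim conjE)
      fix a b assume a: "in_hom CTS a (src i) X" and b: "in_hom CTS b (tgt i) T"
      obtain h where h: "in_hom CTS h (tgt i) X" "Comp CTS h i = a"
        using combinatorially_fibrant_extension[OF X ih i a] .
      have "Comp CTS f h = b"
        using T CTS_comp_in_hom[OF h(1) f] b CTS_homD(4)[OF b] unfolding terminal_def CTS_simps by blast
      with h show "\<exists>h. in_hom CTS h (tgt i) X \<and> Comp CTS h i = a \<and> Comp CTS f h = b" by blast
    qed
  qed
  then show ?thesis
    using T f X(1) unfolding fibrant_def LCub_CTS_eq by (auto simp: model_of_def)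
qed

text \<open>The only consequence of fibrancy used for the converse. Squares over a terminal object
  commute automatically, so lifting amounts to extending.\<close>

lemma fibrant_extension:
  fixes X :: "('u, 'u, 'x) ts"
  assumes X: "fibrant CTS LCub_CTS X"
    and i: "in_hom CTS i A B" "i \<in> cofibrations" "\<And>W. localizing W \<Longrightarrow> i \<in> W"
    and a: "in_hom CTS a A X"
  obtains h where "in_hom CTS h B X" "Comp CTS h i = a"
proof -
  obtain T f where T: "terminal CTS T" and f: "in_hom CTS f X T"
    and "f \<in> rlp CTS (cofibrations \<inter> \<Inter> {W. localizing W})"
    using X unfolding fibrant_def LCub_CTS_eq by (auto simp: model_of_def)
  then have l: "lifts CTS i f" using i(2,3) by (auto simp: rlp_def)
  obtain b where b: "in_hom CTS b B T" using T CTS_homD(5)[OF i(1)] unfolding terminal_def CTS_simps by blast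
  have "Comp CTS f a = Comp CTS b i"
    using T CTS_comp_in_hom[OF a f] CTS_comp_in_hom[OF i(1) b] CTS_homD(4)[OF i(1)]
    unfolding terminal_def CTS_simps by blast
  with l[unfolded CTS.lifts_iff[OF i(1) f]] a b show ?thesis using that by blast
qed


section \<open>Fibrant objects are combinatorially fibrant\<close>

lemma two_out_of_threeD:
  assumes "two_out_of_three CTS W" "in_hom CTS f X Y" "in_hom CTS g Y Z"
  shows "g \<in> W \<Longrightarrow> Comp CTS g f \<in> W \<Longrightarrow> f \<in> W" "f \<in> W \<Longrightarrow> Comp CTS g f \<in> W \<Longrightarrow> g \<in> W"
proof -
  have "f \<in> Arr CTS" "g \<in> Arr CTS" "Cod CTS f = Dom CTS g"
    using CTS_homD[OF assms(2)] CTS_homD[OF assms(3)] by simp_all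
  then show "g \<in> W \<Longrightarrow> Comp CTS g f \<in> W \<Longrightarrow> f \<in> W" "f \<in> W \<Longrightarrow> Comp CTS g f \<in> W \<Longrightarrow> g \<in> W"
    using assms(1) unfolding two_out_of_three_def by blast+
qed

lemma ident_trivial_fibration:
  fixes X :: "('u, 'u, 'x) ts"
  assumes "X \<in> cts_objects"
  shows "Ident CTS X \<in> trivial_fibrations"
proof (rule trivial_fibrationsI[OF CTS_ident_in_hom[OF assms]])
  fix \<alpha> us \<beta> assume "\<alpha> \<in> states X" "\<beta> \<in> states X" and us: "set us \<subseteq> actions X"
    and t: "(st (Ident CTS X) \<alpha>, map (act (Ident CTS X)) us, st (Ident CTS X) \<beta>) \<in> transitions X"
  have "map (act (Ident CTS X)) us = us" by (rule map_idI) (use us in auto)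
  then show "(\<alpha>, us, \<beta>) \<in> transitions X" using t \<open>\<alpha> \<in> states X\<close> \<open>\<beta> \<in> states X\<close> by simp
qed (auto simp: bij_betw_def inj_on_def image_iff)

text \<open>For distinct actions this is a copy of \<open>C_1[x]\<close> twice, disjointly; for
  equal ones it is a copy of the double transition. One definition thus covers the source and the
  target of \<open>p_x\<close>.\<close>

definition two_edges :: "'x \<Rightarrow> 'u \<Rightarrow> 'u \<Rightarrow> ('u, 'u, 'x) ts" where
  "two_edges x s t =
     \<lparr>states = {num 1, num 2, num 3, num 4}, actions = {s, t}, lab = (\<lambda>_. x),
      transitions = {(num 1, [s], num 2), (num 3, [t], num 4)}\<rparr>"

lemma two_edges_simps [simp]:
  "states (two_edges x s t) = {num 1, num 2, num 3, num 4}" "actions (two_edges x s t) = {s, t}"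
  "lab (two_edges x s t) = (\<lambda>_. x)"
  "transitions (two_edges x s t) = {(num 1, [s], num 2), (num 3, [t], num 4)}"
  by (auto simp: two_edges_def)

lemma two_edges_object: "two_edges x s t \<in> cts_objects"
  by (intro cts_objectsI cubical_length_one) (auto intro!: small_finite)

text \<open>A cube over the double transition sees only one of its two edges and lifts uniquely to
  the two separate edges. Hence source and target of \<open>p\<close> have the same cubification,
  and an identity arrow is a value of the cubification functor on \<open>p\<close>.\<close>

lemma label_identification_localizing:
  fixes x :: 'x
  defines "p \<equiv> arrow (two_edges x (num 0) (num 1)) (two_edges x (num 0) (num 0)) (\<lambda>s. s) (\<lambda>_. num 0)"
  assumes "localizing W"
  shows "in_hom CTS p (two_edges x (num 0) (num 1)) (two_edges x (num 0) (num 0))" "p \<in> W"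
proof -
  let ?A = "two_edges x (num 0) (num 1)" and ?B = "two_edges x (num 0) (num 0)"
  note o = two_edges_object[of x "num 0" "num 1"] two_edges_object[of x "num 0" "num 0"]
  show p: "in_hom CTS p ?A ?B"
    unfolding p_def by (intro arrow_in_hom o ts_mapI) auto
  have lift_p: "c \<in> cubes_over ?B \<Longrightarrow> \<exists>!d. in_hom CTS d (src c) ?A \<and> Comp CTS p d = c"
    and cub_p: "is_cubification ?B ?A (\<lambda>c. THE d. in_hom CTS d (src c) ?A \<and> Comp CTS p d = c)" for c
    by (rule cubification_length_one[OF p]; force simp: p_def)+
  let ?i = "Ident CTS ?A"
  note i = CTS_ident_in_hom[OF o(1)]
  have lift_i: "c \<in> cubes_over ?A \<Longrightarrow> \<exists>!d. in_hom CTS d (src c) ?A \<and> Comp CTS ?i d = c"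
    and cub_i: "is_cubification ?A ?A (\<lambda>c. THE d. in_hom CTS d (src c) ?A \<and> Comp CTS ?i d = c)" for c
    by (rule cubification_length_one[OF i]; force)+
  have "cubification_map p ?i"
    unfolding cubification_map_def
  proof (intro conjI exI ballI)
    show "p \<in> Arr CTS" "?i \<in> Arr CTS" using CTS_homD(1)[OF p] CTS_homD(1)[OF i] .
    show "is_cubification (src p) (src ?i) (\<lambda>c. THE d. in_hom CTS d (src c) ?A \<and> Comp CTS ?i d = c)"
      "is_cubification (tgt p) (tgt ?i) (\<lambda>c. THE d. in_hom CTS d (src c) ?A \<and> Comp CTS p d = c)"
      using cub_i cub_p CTS_homD(2,3)[OF p] CTS_homD(2,3)[OF i] by simp_all
    fix c assume "c \<in> cubes_over (src p)"
    then have c: "c \<in> cubes_over ?A" using CTS_homD(2)[OF p] by simp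
    then have ch: "in_hom CTS c (src c) ?A" by (simp add: cubes_over_iff)
    have "(THE d. in_hom CTS d (src c) ?A \<and> Comp CTS ?i d = c) = c"
      using ch CTS.comp_ident_left[OF ch] lift_i[OF c] by (intro the1_equality) auto
    moreover have pc: "Comp CTS p c \<in> cubes_over ?B"
      using c CTS_comp_in_hom[OF ch p] by (simp add: cubes_over_iff)
    \<comment> \<open>\<open>c\<close> is itself a lift of its composite with \<open>p\<close>, so
      by uniqueness the leg over that composite is \<open>c\<close>.\<close>
    have "(THE d. in_hom CTS d (src (Comp CTS p c)) ?A \<and> Comp CTS p d = Comp CTS p c) = c"
      using ch lift_p[OF pc] by (intro the1_equality) auto
    ultimately show "Comp CTS ?i (THE d. in_hom CTS d (src c) ?A \<and> Comp CTS ?i d = c) =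
        (THE d. in_hom CTS d (src (Comp CTS p c)) ?A \<and> Comp CTS p d = Comp CTS p c)"
      using CTS.comp_ident_left[OF ch] by simp
  qed
  moreover have "?i \<in> smallest_localizer CTS (small_ordinals :: 'u rel set) cofibrations"
    using ident_trivial_fibration[OF o(1)] trivial_fibrations_smallest_localizer by blast
  ultimately show "p \<in> W" using assms(2) unfolding localizing_def by blast
qed

lemma fibrant_swap_one:
  fixes X :: "('u, 'u, 'x) ts"
  assumes X: "X \<in> cts_objects" "fibrant CTS LCub_CTS X"
    and t: "(\<alpha>, [u], \<beta>) \<in> transitions X" and v: "v \<in> actions X" "lab X v = lab X u"
  shows "(\<alpha>, [v], \<beta>) \<in> transitions X"
proof -
  note w = cts_objectsD(2)[OF X(1)]
  \<comment> \<open>The second edge of \<open>?A\<close> must go to a transition that carries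
    \<open>v\<close>; any one will do.\<close>
  obtain \<gamma> \<delta> where t': "(\<gamma>, [v], \<delta>) \<in> transitions X" using cubical_ts_used[OF cts_objectsD(1)[OF X(1)] v(1)] .
  define x where "x = lab X u"
  let ?A = "two_edges x (num 0) (num 1)" and ?B = "two_edges x (num 0) (num 0)"
  \<comment> \<open>\<open>p_x\<close> identifies two actions and is no cofibration. In
    \<open>?P\<close> both actions exist and each of them occurs on each edge, so \<open>?A\<close>
    embeds and the first edge acquires the second action.\<close>
  let ?P = "pull_actions ?B {num 0, num 1} (\<lambda>_. num 0)"
  note o = two_edges_object[of x "num 0" "num 1"] two_edges_object[of x "num 0" "num 0"]
  have L: "small {num 0, num 1}" "(\<lambda>_. num 0) ` {num 0, num 1} = actions ?B"
    by (auto intro: small_finite)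
  note P = pull_actions_trivial_fibration[OF o(2) L]
  have j: "in_hom CTS (arrow ?A ?P (\<lambda>s. s) (\<lambda>u. u)) ?A ?P" (is "in_hom CTS ?j _ _")
    by (intro arrow_in_hom[OF o(1) P(1)] ts_mapI) auto
  have jC: "?j \<in> cofibrations" by (rule cofibrationsI[OF j]) (auto simp: inj_on_def)
  have jW: "?j \<in> W" if W: "localizing W" for W
  proof (rule two_out_of_threeD(1)[OF _ j P(2)])
    show "two_out_of_three CTS W" using W by (simp add: localizing_def model_structure_def model_of_def)
    show "arrow ?P ?B id (\<lambda>_. num 0) \<in> W"
      using W P(3) trivial_fibrations_smallest_localizer unfolding localizing_def by blast
    note p = label_identification_localizing[OF W, of x]
    have "Comp CTS (arrow ?P ?B id (\<lambda>_. num 0)) ?j = arrow ?A ?B (\<lambda>s. s) (\<lambda>_. num 0)"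
      by (rule CTS_comp_eqI[OF j P(2) p(1)]) auto
    then show "Comp CTS (arrow ?P ?B id (\<lambda>_. num 0)) ?j \<in> W" using p(2) by simp
  qed
  define f where "f s = (if s = num 1 then \<alpha> else if s = num 2 then \<beta> else if s = num 3 then \<gamma> else \<delta>)" for s
  define g where "g t = (if t = num 0 then u else v)" for t
  have "u \<in> actions X" using weak_tsD(4)[OF w t] by simp
  then have a: "in_hom CTS (arrow ?A X f g) ?A X" (is "in_hom CTS ?a _ _")
    using weak_tsD(1,2)[OF w t] weak_tsD(1,2)[OF w t'] v t t'
    by (intro arrow_in_hom[OF o(1) X(1)] ts_mapI) (auto simp: f_def g_def x_def)
  obtain h where h: "in_hom CTS h ?P X" "Comp CTS h ?j = ?a"
    using fibrant_extension[OF X(2) j jC jW a] .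
  have hj: "Comp CTS h ?j = Comp CTS ?a (Ident CTS ?A)"
    using h(2) CTS.comp_ident_right[OF a] by simp
  note e = CTS_comp_eqD[OF hj j CTS_ident_in_hom[OF o(1)]]
  have "(num 1, [num 1], num 2) \<in> transitions ?P" by simp
  from CTS_trans[OF h(1) this] have "(st h (num 1), [act h (num 1)], st h (num 2)) \<in> transitions X" by simp
  moreover have "st h (num 1) = \<alpha>" "st h (num 2) = \<beta>" "act h (num 1) = v"
    using e(1)[of "num 1"] e(1)[of "num 2"] e(2)[of "num 1"] by (simp_all add: f_def g_def)
  ultimately show ?thesis by simp
qed

text \<open>The pushout-product of the inclusion of the skeleton with a cylinder inclusion. The cylinder
  used here has a pair \<open>(u, v)\<close> as an action for all actions \<open>u\<close>, \<open>v\<close> with the same label, and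
  the first projection as its retraction; the second projection transports the transitions of
  the cylinder into a fibrant object.\<close>

lemma fibrant_swap_step:
  fixes X :: "('u, 'u, 'x) ts"
  assumes X: "X \<in> cts_objects" "fibrant CTS LCub_CTS X" and n: "n \<ge> 2"
    and IH: "\<And>\<alpha> us vs \<beta>. (\<alpha>, us, \<beta>) \<in> transitions X \<Longrightarrow> length us < n \<Longrightarrow> set vs \<subseteq> actions X \<Longrightarrow>
      map (lab X) us = map (lab X) vs \<Longrightarrow> (\<alpha>, vs, \<beta>) \<in> transitions X"
    and t: "(\<alpha>, us, \<beta>) \<in> transitions X" "set vs \<subseteq> actions X" "map (lab X) us = map (lab X) vs"
  shows "(\<alpha>, vs, \<beta>) \<in> transitions X"
proof -
  note cX = cts_objectsD(1)[OF X(1)]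
  note w = cts_objectsD(2)[OF X(1)]
  define L where "L = {z \<in> pair ` (actions X \<times> actions X). lab X (fst (unpair z)) = lab X (snd (unpair z))}"
  define q r where "q z = fst (unpair z)" and "r z = snd (unpair z)" for z
  define \<delta> where "\<delta> u = pair (u, u)" for u
  have qr: "q (\<delta> u) = u" "r (\<delta> u) = u" for u by (simp_all add: q_def r_def \<delta>_def)
  have \<delta>L: "\<delta> u \<in> L" if "u \<in> actions X" for u using that by (simp add: L_def \<delta>_def)
  have L: "z \<in> L \<Longrightarrow> q z \<in> actions X" "z \<in> L \<Longrightarrow> r z \<in> actions X" "z \<in> L \<Longrightarrow> lab X (r z) = lab X (q z)" for z
    by (auto simp: L_def q_def r_def)
  have sL: "small L" by (rule small_subset[OF small_pairs]) (use X in \<open>auto simp: L_def cts_objectsD\<close>)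
  have qL: "q ` L = actions X" using L(1) \<delta>L qr(1) by (metis image_eqI image_subsetI subsetI subset_antisym)
  have map_\<delta>: "map q (map \<delta> us) = us" "map r (map \<delta> us) = us" for us
    by (simp_all add: comp_def qr)
  let ?K = "skeleton_ts n X"
  have Ko: "?K \<in> cts_objects" using X(1) n by (intro cts_objectsI cubical_skeleton_ts) (auto simp: cts_objectsD)
  let ?CK = "pull_actions ?K L q" and ?CX = "pull_actions X L q"
  have qK: "q ` L = actions ?K" using qL by simp
  note CK = pull_actions_trivial_fibration[OF Ko sL qK]
  note CX = pull_actions_trivial_fibration[OF X(1) sL qL]
  note wCK = cts_objectsD(2)[OF CK(1)]
  \<comment> \<open>The gluing of \<open>X\<close> with the cylinder on its skeleton, along the
    diagonal \<open>\<delta>\<close>: below length \<open>n\<close> arbitrary pairs are allowed,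
    from length \<open>n\<close> on only diagonal ones.\<close>
  define E :: "('u, 'u, 'x) ts" where "E = \<lparr>states = states X, actions = L, lab = (\<lambda>z. lab X (q z)),
    transitions = transitions ?CK \<union> {(\<alpha>, map \<delta> us, \<beta>) | \<alpha> us \<beta>. (\<alpha>, us, \<beta>) \<in> transitions X}\<rparr>"
  have E: "states E = states X" "actions E = L" "\<And>z. lab E z = lab X (q z)"
    "\<And>\<alpha> us \<beta>. (\<alpha>, us, \<beta>) \<in> transitions E \<longleftrightarrow> (\<alpha>, us, \<beta>) \<in> transitions ?CK \<or>
      (\<exists>us'. us = map \<delta> us' \<and> (\<alpha>, us', \<beta>) \<in> transitions X)"
    by (auto simp: E_def)
  have E_CX: "set us \<subseteq> L \<and> (\<alpha>, map q us, \<beta>) \<in> transitions X" if "(\<alpha>, us, \<beta>) \<in> transitions E" for \<alpha> us \<beta>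
    using that weak_tsD(4)[OF w] \<delta>L unfolding E(4) by (auto simp: comp_def qr) blast
  have E_short: "(\<alpha>, us, \<beta>) \<in> transitions E" if "set us \<subseteq> L" "(\<alpha>, map q us, \<beta>) \<in> transitions X" "length us < n"
    for \<alpha> us \<beta>
    using that by (simp add: E(4))
  have E_long: "\<exists>us'. us = map \<delta> us' \<and> (\<alpha>, us', \<beta>) \<in> transitions X"
    if "(\<alpha>, us, \<beta>) \<in> transitions E" "\<not> length us < n" for \<alpha> us \<beta>
    using that unfolding E(4) by auto
  have cE: "cubical_ts E"
  proof (rule cubical_tsI[OF weak_tsI])
    fix \<alpha> us \<beta> assume "(\<alpha>, us, \<beta>) \<in> transitions E"
    from E_CX[OF this] show "\<alpha> \<in> states E \<and> \<beta> \<in> states E \<and> us \<noteq> [] \<and> set us \<subseteq> actions E"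
      using weak_tsD[OF w, of \<alpha> "map q us" \<beta>] by (auto simp: E)
  next
    fix \<alpha> us vs \<beta> assume t: "(\<alpha>, us, \<beta>) \<in> transitions E" "mset vs = mset us"
    from t(1) consider "(\<alpha>, us, \<beta>) \<in> transitions ?CK"
      | us' where "us = map \<delta> us'" "(\<alpha>, us', \<beta>) \<in> transitions X" unfolding E(4) by blast
    then show "(\<alpha>, vs, \<beta>) \<in> transitions E"
    proof cases
      case 1
      then show ?thesis using weak_ts_mset[OF wCK 1 t(2)] unfolding E(4) by blast
    next
      case 2
      obtain vs' where "mset vs' = mset us'" "map \<delta> vs' = vs"
        using mset_map_lift[of \<delta> us' vs] t(2) 2(1) by metis
      then show ?thesis using weak_ts_mset[OF w 2(2)] unfolding E(4) by blast
    qed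
  next
    fix \<alpha> \<beta> \<nu>1 \<nu>2 us vs ws
    assume ne: "us \<noteq> []" "vs \<noteq> []" "ws \<noteq> []"
      and t: "(\<alpha>, us @ vs @ ws, \<beta>) \<in> transitions E" "(\<alpha>, us, \<nu>1) \<in> transitions E"
      "(\<nu>1, vs @ ws, \<beta>) \<in> transitions E" "(\<alpha>, us @ vs, \<nu>2) \<in> transitions E" "(\<nu>2, ws, \<beta>) \<in> transitions E"
    have x: "(\<nu>1, map q vs, \<nu>2) \<in> transitions X" "set vs \<subseteq> L"
      using weak_ts_patch[OF w, of "map q us" "map q vs" "map q ws" \<alpha> \<beta> \<nu>1 \<nu>2] ne t[THEN E_CX] by auto
    show "(\<nu>1, vs, \<nu>2) \<in> transitions E"
    \<comment> \<open>If \<open>vs\<close> is long, so is \<open>us @ vs\<close>. That transition is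
      then diagonal, which makes \<open>vs\<close> diagonal too.\<close>
    proof (cases "length vs < n")
      case True
      then show ?thesis using E_short x by blast
    next
      case False
      then obtain zs where "us @ vs = map \<delta> zs" using E_long[OF t(4)] by auto
      then obtain vs' where "vs = map \<delta> vs'" by (auto simp: append_eq_map_conv)
      then show ?thesis using x(1) map_\<delta>(1) unfolding E(4) by metis
    qed
  next
    fix z assume "z \<in> actions E"
    then have "z \<in> actions ?CK" by (simp add: E)
    then obtain \<alpha> \<beta> where "(\<alpha>, [z], \<beta>) \<in> transitions ?CK" by (rule cubical_ts_used[OF cts_objectsD(1)[OF CK(1)]])
    then show "\<exists>\<alpha> \<beta>. (\<alpha>, [z], \<beta>) \<in> transitions E" unfolding E(4) by blast
  next
    fix \<alpha> \<beta> xs ys assume t: "(\<alpha>, xs @ ys, \<beta>) \<in> transitions E" "xs \<noteq> []" "ys \<noteq> []"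
    from t(1) consider "(\<alpha>, xs @ ys, \<beta>) \<in> transitions ?CK"
      | us' where "xs @ ys = map \<delta> us'" "(\<alpha>, us', \<beta>) \<in> transitions X" unfolding E(4) by blast
    then show "\<exists>\<nu>. (\<alpha>, xs, \<nu>) \<in> transitions E \<and> (\<nu>, ys, \<beta>) \<in> transitions E"
    proof cases
      case 1
      then obtain \<nu> where "(\<alpha>, xs, \<nu>) \<in> transitions ?CK" "(\<nu>, ys, \<beta>) \<in> transitions ?CK"
        by (rule cubical_ts_split[OF cts_objectsD(1)[OF CK(1)] _ refl t(2,3)])
      then show ?thesis unfolding E(4) by blast
    next
      case 2
      then obtain xs' ys' where e: "us' = xs' @ ys'" "xs = map \<delta> xs'" "ys = map \<delta> ys'"
        by (auto simp: append_eq_map_conv)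
      obtain \<nu> where "(\<alpha>, xs', \<nu>) \<in> transitions X" "(\<nu>, ys', \<beta>) \<in> transitions X"
        by (rule cubical_ts_split[OF cX 2(2), of xs' ys']) (use e t(2,3) in auto)
      then show ?thesis using e unfolding E(4) by blast
    qed
  qed
  have Eo: "E \<in> cts_objects" using cE sL X(1) by (intro cts_objectsI) (auto simp: E cts_objectsD)
  have m\<delta>: "ts_map Y (pull_actions Y L q) (\<lambda>s. s) \<delta>" if "weak_ts Y" "actions Y = actions X" for Y :: "('u, 'u, 'x) ts"
  proof (rule ts_mapI)
    fix \<alpha> us \<beta> assume t: "(\<alpha>, us, \<beta>) \<in> transitions Y"
    then show "(\<alpha>, map \<delta> us, \<beta>) \<in> transitions (pull_actions Y L q)"
      using weak_tsD(4)[OF that(1) t] \<delta>L that(2) map_\<delta>(1)[of us] by auto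
  qed (use \<delta>L that qr in auto)
  define dK where "dK = arrow ?K ?CK (\<lambda>s. s) \<delta>"
  define dX where "dX = arrow X ?CX (\<lambda>s. s) \<delta>"
  define k where "k = arrow ?K X (\<lambda>s. s) (\<lambda>u. u)"
  define m where "m = arrow X E (\<lambda>s. s) \<delta>"
  define l where "l = arrow ?CK E (\<lambda>s. s) (\<lambda>u. u)"
  define e where "e = arrow E ?CX (\<lambda>s. s) (\<lambda>u. u)"
  have dK: "in_hom CTS dK ?K ?CK"
    unfolding dK_def using cts_objectsD(2)[OF Ko] by (intro arrow_in_hom[OF Ko CK(1)] m\<delta>) auto
  have dX: "in_hom CTS dX X ?CX" unfolding dX_def by (intro arrow_in_hom[OF X(1) CX(1)] m\<delta> w) auto
  have k: "in_hom CTS k ?K X" unfolding k_def by (intro arrow_in_hom[OF Ko X(1)] ts_mapI) auto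
  have m: "in_hom CTS m X E" unfolding m_def by (intro arrow_in_hom[OF X(1) Eo] ts_mapI) (auto simp: E(1-3) \<delta>L qr, auto simp: E(4))
  have l: "in_hom CTS l ?CK E" unfolding l_def by (intro arrow_in_hom[OF CK(1) Eo] ts_mapI) (auto simp: E(1-3), auto simp: E(4))
  have e: "in_hom CTS e E ?CX" unfolding e_def by (intro arrow_in_hom[OF Eo CX(1)] ts_mapI) (auto simp: E(1-3) dest!: E_CX)
  have inj: "inj_on \<delta> S" for S by (auto simp: inj_on_def \<delta>_def)
  have dKC: "dK \<in> cofibrations" by (rule cofibrationsI[OF dK]) (use inj in \<open>auto simp: dK_def inj_on_def\<close>)
  have eC: "e \<in> cofibrations" by (rule cofibrationsI[OF e]) (auto simp: e_def inj_on_def)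
  \<comment> \<open>\<open>E\<close> has the states and actions of the cylinder on the skeleton, so
    the induced arrow is \<open>b\<close> on underlying sets; \<open>a\<close> ensures that the long
    diagonal transitions are respected.\<close>
  have po: "is_pushout CTS dK k m l"
    unfolding is_pushout_def
  proof (intro conjI allI impI; (elim conjE)?)
    show "Comp CTS m k = Comp CTS l dK"
      by (rule CTS_comp_eqI[OF k m CTS_comp_in_hom[OF dK l]])
        (use CTS_homD(2)[OF dK] \<delta>L in \<open>auto simp: k_def m_def l_def dK_def\<close>)
    fix Z a b
    assume "in_hom CTS a (Cod CTS k) Z" "in_hom CTS b (Cod CTS dK) Z" and ab: "Comp CTS a k = Comp CTS b dK"
    then have a: "in_hom CTS a X Z" and b: "in_hom CTS b ?CK Z" using CTS_homD(3)[OF k] CTS_homD(3)[OF dK] by simp_all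
    note abs = CTS_comp_eqD[OF ab k dK]
    have st_eq: "st a s = st b s" if "s \<in> states X" for s using abs(1)[of s] that by (simp add: k_def dK_def)
    have act_eq: "act a u = act b (\<delta> u)" if "u \<in> actions X" for u using abs(2)[of u] that by (simp add: k_def dK_def)
    have "ts_map E Z (st b) (act b)"
    proof (rule ts_mapI)
      fix \<alpha> us \<beta> assume t: "(\<alpha>, us, \<beta>) \<in> transitions E"
      then consider "(\<alpha>, us, \<beta>) \<in> transitions ?CK"
        | us' where "us = map \<delta> us'" "(\<alpha>, us', \<beta>) \<in> transitions X" unfolding E(4) by blast
      then show "(st b \<alpha>, map (act b) us, st b \<beta>) \<in> transitions Z"
      proof cases
        case 1
        then show ?thesis by (rule CTS_trans[OF b])
      next
        case 2
        note wf = weak_tsD[OF w 2(2)]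
        have "map (act b) us = map (act a) us'" unfolding 2(1) using act_eq wf(4) by auto
        then show ?thesis using CTS_trans[OF a 2(2)] st_eq[OF wf(1)] st_eq[OF wf(2)] by simp
      qed
    qed (use CTS_st_act[OF b] in \<open>auto simp: E(1-3)\<close>)
    then have h: "in_hom CTS (arrow E Z (st b) (act b)) E Z" (is "in_hom CTS ?h _ _")
      by (rule arrow_in_hom[OF Eo CTS_homD(5)[OF b]])
    show "\<exists>!h. in_hom CTS h (Cod CTS m) Z \<and> Comp CTS h m = a \<and> Comp CTS h l = b"
    proof (rule ex1I)
      have "Comp CTS ?h m = a"
        by (rule CTS_comp_eqI[OF m h a]) (use \<delta>L in \<open>auto simp: m_def E(1,2) st_eq act_eq\<close>)
      moreover have "Comp CTS ?h l = b"
        by (rule CTS_comp_eqI[OF l h b]) (auto simp: l_def E(1,2))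
      ultimately show "in_hom CTS ?h (Cod CTS m) Z \<and> Comp CTS ?h m = a \<and> Comp CTS ?h l = b"
        using h CTS_homD(3)[OF m] by simp
      fix h' assume "in_hom CTS h' (Cod CTS m) Z \<and> Comp CTS h' m = a \<and> Comp CTS h' l = b"
      then have h': "in_hom CTS h' E Z" "Comp CTS h' l = Comp CTS ?h l"
        using CTS_homD(3)[OF m] \<open>Comp CTS ?h l = b\<close> by simp_all
      show "h' = ?h"
        by (rule CTS_eqI[OF h'(1) h])
          (use CTS_comp_eqD[OF h'(2) l l] in \<open>auto simp: l_def E(1,2)\<close>)
    qed
  qed (use k m l dK CTS_homD[OF k] CTS_homD[OF m] CTS_homD[OF l] CTS_homD[OF dK] in simp_all)
  \<comment> \<open>\<open>dK\<close> and \<open>dX\<close> are sections of trivial fibrations,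
    hence weak equivalences; \<open>m\<close> is one as a pushout of the cofibration
    \<open>dK\<close>. Two-out-of-three for \<open>dX\<close>, the composite of \<open>m\<close> and
    \<open>e\<close>, gives \<open>e\<close>.\<close>
  have eW: "e \<in> W" if W: "grothendieck_localizer CTS (small_ordinals :: 'u rel set) cofibrations W" for W
  proof -
    have tt: "two_out_of_three CTS W" and tf: "trivial_fibrations \<subseteq> W" and pc: "closed_under_pushout CTS (W \<inter> cofibrations)"
      using W unfolding grothendieck_localizer_def rlp_cofibrations by auto
    have "dK \<in> W"
    proof (rule two_out_of_threeD(1)[OF tt dK CK(2)])
      have "Comp CTS (arrow ?CK ?K id q) dK = Ident CTS ?K"
        by (rule CTS_comp_eqI[OF dK CK(2) CTS_ident_in_hom[OF Ko]]) (use \<delta>L qr in \<open>auto simp: dK_def\<close>)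
      then show "Comp CTS (arrow ?CK ?K id q) dK \<in> W" using ident_trivial_fibration[OF Ko] tf by auto
    qed (use CK(3) tf in blast)
    then have mW: "m \<in> W" using pc po dKC unfolding closed_under_pushout_def by blast
    have "dX \<in> W"
    proof (rule two_out_of_threeD(1)[OF tt dX CX(2)])
      have "Comp CTS (arrow ?CX X id q) dX = Ident CTS X"
        by (rule CTS_comp_eqI[OF dX CX(2) CTS_ident_in_hom[OF X(1)]]) (use \<delta>L qr in \<open>auto simp: dX_def\<close>)
      then show "Comp CTS (arrow ?CX X id q) dX \<in> W" using ident_trivial_fibration[OF X(1)] tf by auto
    qed (use CX(3) tf in blast)
    moreover have "Comp CTS e m = dX"
      by (rule CTS_comp_eqI[OF m e dX]) (use \<delta>L in \<open>auto simp: e_def m_def dX_def E(1,2)\<close>)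
    ultimately show "e \<in> W" using two_out_of_threeD(2)[OF tt m e mW] by simp
  qed
  have eL: "e \<in> W" if "localizing W" for W
    using that eW unfolding localizing_def smallest_localizer_def by blast
  \<comment> \<open>On short transitions the second projection exchanges actions with equal labels,
    which \<open>IH\<close> permits; on diagonal transitions it returns the original
    transition.\<close>
  have "ts_map E X (\<lambda>s. s) r"
  proof (rule ts_mapI)
    fix \<alpha> us \<beta> assume t: "(\<alpha>, us, \<beta>) \<in> transitions E"
    then consider "(\<alpha>, us, \<beta>) \<in> transitions ?CK"
      | us' where "us = map \<delta> us'" "(\<alpha>, us', \<beta>) \<in> transitions X" unfolding E(4) by blast
    then show "(\<alpha>, map r us, \<beta>) \<in> transitions X"
    proof cases
      case 1
      then have us: "(\<alpha>, map q us, \<beta>) \<in> transitions X" "length (map q us) < n" "set us \<subseteq> L" by simp_all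
      have "map (lab X) (map q us) = map (lab X) (map r us)" "set (map r us) \<subseteq> actions X"
        using us(3) L by auto
      then show ?thesis using IH[OF us(1,2)] by blast
    next
      case 2
      then show ?thesis using map_\<delta>(2) by simp
    qed
  qed (auto simp: E(1-3) L)
  then have a: "in_hom CTS (arrow E X (\<lambda>s. s) r) E X" (is "in_hom CTS ?a _ _")
    by (rule arrow_in_hom[OF Eo X(1)])
  \<comment> \<open>\<open>e\<close> is bijective on states and actions, so \<open>h\<close> is
    again the second projection. The gain is that it now respects the long transitions of
    \<open>?CX\<close> with non-diagonal pairs.\<close>
  obtain h where h: "in_hom CTS h ?CX X" "Comp CTS h e = ?a"
    using fibrant_extension[OF X(2) e eC eL a] .
  have he: "Comp CTS h e = Comp CTS ?a (Ident CTS E)"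
    using h(2) CTS.comp_ident_right[OF a] by simp
  note hs = CTS_comp_eqD[OF he e CTS_ident_in_hom[OF Eo]]
  \<comment> \<open>The transition of the cylinder that projects to \<open>us\<close> on one side
    and to \<open>vs\<close> on the other.\<close>
  define zs where "zs = map pair (zip us vs)"
  have len: "length us = length vs" using t(3) by (metis length_map)
  have zs: "map q zs = us" "map r zs = vs"
    using len by (simp_all add: zs_def q_def r_def comp_def)
  have "set zs \<subseteq> L"
  proof
    fix z assume "z \<in> set zs"
    then obtain i where i: "i < length us" "z = pair (us ! i, vs ! i)"
      using len by (auto simp: zs_def set_zip)
    have "lab X (us ! i) = lab X (vs ! i)" using arg_cong[OF t(3), of "\<lambda>l. l ! i"] i len by simp
    moreover have "us ! i \<in> actions X" "vs ! i \<in> actions X"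
      using weak_tsD(4)[OF w t(1)] t(2) i len by auto
    ultimately show "z \<in> L" by (simp add: L_def i)
  qed
  then have z: "(\<alpha>, zs, \<beta>) \<in> transitions ?CX" using t(1) zs(1) by simp
  have "map (act h) zs = vs"
  proof -
    have "act h z = r z" if "z \<in> set zs" for z
      using hs(2)[of z] that \<open>set zs \<subseteq> L\<close> by (auto simp: e_def E(2))
    then have "map (act h) zs = map r zs" by simp
    then show ?thesis using zs(2) by simp
  qed
  moreover have "st h \<alpha> = \<alpha>" "st h \<beta> = \<beta>"
    using hs(1)[of \<alpha>] hs(1)[of \<beta>] weak_tsD(1,2)[OF w t(1)] by (simp_all add: e_def E(1))
  ultimately show ?thesis using CTS_trans[OF h(1) z] by simp
qed

lemma combinatorially_fibrant_if_fibrant: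
  fixes X :: "('u, 'u, 'x) ts"
  assumes X: "X \<in> cts_objects" "fibrant CTS LCub_CTS X"
  shows "combinatorially_fibrant X"
proof -
  have swap: "(\<alpha>, vs, \<beta>) \<in> transitions X"
    if "(\<alpha>, us, \<beta>) \<in> transitions X" "set vs \<subseteq> actions X" "map (lab X) us = map (lab X) vs" for \<alpha> us vs \<beta>
    using that
  proof (induction "length us" arbitrary: \<alpha> us vs \<beta> rule: less_induct)
    case less
    note ne = weak_tsD(3)[OF cts_objectsD(2)[OF X(1)] less.prems(1)]
    show ?case
    proof (cases "length us \<ge> 2")
      case True
      show ?thesis
        by (rule fibrant_swap_step[OF X True _ less.prems]) (rule less.hyps)
    next
      case False
      then obtain u where u: "us = [u]" using ne by (cases us; cases "tl us") auto
      then obtain v where v: "vs = [v]" "lab X v = lab X u" using less.prems(3) by auto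
      then show ?thesis
        using fibrant_swap_one[OF X, of \<alpha> u \<beta> v] less.prems u by simp
    qed
  qed
  show ?thesis
    unfolding combinatorially_fibrant_def
  proof (intro allI impI ballI, elim conjE)
    fix n \<alpha> \<beta> us vs
    assume "length us = n" "length vs = n" "set vs \<subseteq> actions X"
      "\<forall>i<n. lab X (us ! i) = lab X (vs ! i)" "(\<alpha>, us, \<beta>) \<in> transitions X"
    then show "(\<alpha>, vs, \<beta>) \<in> transitions X"
      by (intro swap[of \<alpha> us \<beta> vs]) (auto intro: nth_equalityI)
  qed
qed

end

theorem corollary7p16:
  fixes X :: "('u, 'u, 'x) ts"
  assumes "infinite (UNIV :: 'u set)"
    and "|UNIV :: 'x set| <o |UNIV :: 'u set|"
    and "X \<in> Obj CTS"
  shows "fibrant CTS LCub_CTS X \<longleftrightarrow> combinatorially_fibrant X"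
proof -
  \<comment> \<open>The encodings come from cardinal comparison: labels inject because there are
    fewer of them than elements of \<open>'u\<close>, pairs because an infinite cardinal equals its
    square. Strictness of the first inequality makes the range of \<open>code\<close> small.\<close>
  obtain code :: "'x \<Rightarrow> 'u" where code: "inj code"
    using ordLess_imp_ordLeq[OF assms(2)] card_of_ordLeq[of "UNIV :: 'x set" "UNIV :: 'u set"] by auto
  have "|UNIV :: ('u \<times> 'u) set| \<le>o |UNIV :: 'u set|"
    using card_of_Times_same_infinite[OF assms(1)] by (simp add: ordIso_imp_ordLeq)
  then obtain pair :: "'u \<times> 'u \<Rightarrow> 'u" where pair: "inj pair"
    using card_of_ordLeq[of "UNIV :: ('u \<times> 'u) set" "UNIV :: 'u set"] by auto
  obtain num :: "nat \<Rightarrow> 'u" where num: "inj num"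
    using infinite_countable_subset[OF assms(1)] by auto
  have "small (range code)"
    unfolding small_def using card_of_image assms(2) ordLeq_ordLess_trans by blast
  then interpret universe code pair num
    using assms(1) code pair num by unfold_locales
  show ?thesis
    using assms(3) fibrant_if_combinatorially_fibrant combinatorially_fibrant_if_fibrant by auto
qed

end
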